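(* Let $\Gamma=(X,\mathcal E)$ be the Pappus graph (the distance-regular graph with $18$ vertices and intersection array $\{3,2,2,1;1,1,2,3\}$); the spectrum of its adjacency matrix $A$ is $3^1(\sqrt3)^60^4(-\sqrt3)^6(-3)^1$. Let $x\in X$ and $T=T(x)$. Order the three vertices of $\Gamma_1(x)$ arbitrarily. Order $\Gamma_2(x)$ as $y_1,\dots,y_6$ so that each of the pairs $\{y_1,y_2\},\{y_3,y_4\},\{y_5,y_6\}$ has a common neighbor in $\Gamma_1(x)$, and any two consecutive vertices in the cyclic sequence $y_1,y_3,y_5,y_2,y_4,y_6$ have a common neighbor in $\Gamma_3(x)$. Order $\Gamma_3(x)$ as $z_1,\dots,z_6$ so that $z_1,z_4,z_6$ are the neighbors of one of the two vertices of $\Gamma_4(x)$, and $z_2,z_3,z_5$ are the neighbors of the other. Then the standard module $V=\mathbb C^X$ is an orthogonal direct sum of irreducible $T$-modules $V=W_0\oplus W_{1,a}\oplus W_{1,b}\oplus W_{2,a}\oplus W_{2,b}\oplus W_{2,c}\oplus W_3$, where two summands are isomorphic if and only if they have the same type in the following list, and the data are as listed. Each listed basis is a pure basis of the module. For each summand other than $W_0$, the seed vector $\nu$ spans $E_r^*W$ (so $\dim E_r^*W=1$), where $r$ is the endpoint of the summand $W$, and is given by its essential part. Type I ($W_0$): endpoint 0, multiplicity 1, dimension 5, diameter 4, shape $(1,1,1,1,1)$; basis $e_0^*,\dots,e_4^*$; matrix representing $A$: $\begin{pmatrix}0&3&0&0&0\\1&0&2&0&0\\0&1&0&2&0\\0&0&2&0&1\\0&0&0&3&0\end{pmatrix}$,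 with eigenvalues $3,\sqrt3,0,-\sqrt3,-3$. Type II ($W_{1,a},W_{1,b}$): endpoint 1, multiplicity 2, dimension 3, diameter 2, shape $(1,1,1)$; basis $\nu,A\nu,E_3^*A^2\nu$ (with $A\nu=E_2^*A\nu$), where $\nu=[1,-1,0]$ for $W_{1,a}$ and $\nu=[1,1,-2]$ for $W_{1,b}$; matrix representing $A$: $\begin{pmatrix}0&2&0\\1&0&1\\0&1&0\end{pmatrix}$, with eigenvalues $\sqrt3,0,-\sqrt3$. Type III ($W_{2,a}$): endpoint 2, multiplicity 1, dimension 1, diameter 0, shape $(1)$; basis $\nu$, where $\nu=[-1,1,1,-1,-1,1]$; matrix representing $A$: $\begin{pmatrix}0\end{pmatrix}$, with eigenvalue $0$. Type IV ($W_{2,b},W_{2,c}$): endpoint 2, multiplicity 2, dimension 2, diameter 1, shape $(1,1)$; basis $\nu,A\nu$ (with $A\nu=E_3^*A\nu$), where $\nu=[1,-1,0,0,-1,1]$ for $W_{2,b}$ and $\nu=[1,-1,2,-2,1,-1]$ for $W_{2,c}$; matrix representing $A$: $\begin{pmatrix}0&3\\1&0\end{pmatrix}$, with eigenvalues $\sqrt3,-\sqrt3$. Type V ($W_3$): endpoint 3, multiplicity 1, dimension 2, diameter 1, shape $(1,1)$; basis $\nu,A\nu$ (with $A\nu=E_4^*A\nu$), where $\nu=[1,-1,-1,1,-1,1]$; matrix representing $A$: $\begin{pmatrix}0&3\\1&0\end{pmatrix}$. Moreover $\dim T=5^2+3^2+1^2+2^2+2^2=43$.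
   Context: Let $\Gamma=(X,\mathcal E)$ be a finite undirected connected graph without loops or multiple edges, with path-length distance $d$ and diameter $D\ge1$; put $\Gamma_i(x)=\{y\in X:d(x,y)=i\}$. $\Gamma$ is distance-regular if for all $0\le h,i,j\le D$ the number $p^h_{i,j}=|\Gamma_i(y)\cap\Gamma_j(z)|$ is the same for all $y,z\in X$ with $d(y,z)=h$. Its intersection array is $\{b_0,\dots,b_{D-1};c_1,\dots,c_D\}$ with $b_i=p^i_{1,i+1}$, $c_i=p^i_{1,i-1}$. $A\in\mathrm{Mat}_X(\mathbb C)$ is the adjacency matrix; in its spectrum, exponents denote multiplicities. The standard module $V=\mathbb C^X$ (column vectors) carries the Hermitian inner product $\langle u,v\rangle=u^t\bar v$. Fix a base vertex $x\in X$. For $0\le i\le D$, $E_i^*=E_i^*(x)$ is the diagonal matrix with $(y,y)$-entry $1$ if $d(x,y)=i$ and $0$ otherwise, and $e_i^*\in V$ is the vector with $y$-entry $1$ if $d(x,y)=i$ and $0$ otherwise. The Terwilliger algebra $T=T(x)$ is the subalgebra of $\mathrm{Mat}_X(\mathbb C)$ generated by $A$ and $E_0^*,\dots,E_D^*$. A $T$-module is a subspace $W\subseteq V$ with $BW\subseteq W$ for all $B\in T$; it is irreducible if $W\ne0$ and it properly contains no nonzero $T$-module. Isomorphisms of $T$-modules are vector space isomorphisms commuting with every $B\in T$. The endpoint of $W$ is $r=\min\{i:E_i^*W\ne0\}$; the diameter of an irreducible $W$ is $\delta=|\{i:E_i^*W\ne0\}|-1$, and its shape is $(\dim E_r^*W,\dots,\dim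 E_{r+\delta}^*W)$. The multiplicity of an irreducible module is the number of summands isomorphic to it in an orthogonal decomposition of $V$ into irreducible $T$-modules. A nonzero vector is pure with support $i$ if it lies in $E_i^*V$; its essential part is the row vector of its coordinates at the vertices of $\Gamma_i(x)$, in the chosen order (all its other coordinates are $0$). A pure basis of an irreducible $T$-module is an ordered basis of pure vectors with weakly increasing supports. The matrix $B$ representing $A$ with respect to a basis $v_1,\dots,v_\ell$ is given by $Av_j=\sum_iB_{ij}v_i$. *)

theory Defs
  imports "Jordan_Normal_Form.Spectral_Radius" "HOL-Analysis.Analysis"
begin

(* A graph on the finite vertex set (UNIV :: 'v set) is given by its adjacency relation.
   Vectors and matrices indexed by vertices are complex ^ 'v and complex ^ 'v ^ 'v; the small
   matrices representing A on a basis are matrices of Jordan_Normal_Form.  Both libraries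
   use the infix "$"; below it is always the one of HOL-Analysis. *)
no_notation Matrix.vec_index (infixl "$" 100)

section \<open>Distance-regular graphs\<close>

definition simple_graph :: "('v \<Rightarrow> 'v \<Rightarrow> bool) \<Rightarrow> bool" where
  "simple_graph adj \<longleftrightarrow> (\<forall>u v. adj u v \<longrightarrow> adj v u) \<and> (\<forall>u. \<not> adj u u)"

definition connected_graph :: "('v \<Rightarrow> 'v \<Rightarrow> bool) \<Rightarrow> bool" where
  "connected_graph adj \<longleftrightarrow> (\<forall>u v. adj\<^sup>*\<^sup>* u v)"

(* adj ^^ n relates the ends of walks with n edges; only meaningful for connected graphs. *)
definition gdist :: "('v \<Rightarrow> 'v \<Rightarrow> bool) \<Rightarrow> 'v \<Rightarrow> 'v \<Rightarrow> nat" where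
  "gdist adj u v = (LEAST n. (adj ^^ n) u v)"

definition gdiameter :: "('v::finite \<Rightarrow> 'v \<Rightarrow> bool) \<Rightarrow> nat" where
  "gdiameter adj = Max {gdist adj u v | u v. True}"

definition gsphere :: "('v \<Rightarrow> 'v \<Rightarrow> bool) \<Rightarrow> nat \<Rightarrow> 'v \<Rightarrow> 'v set" where
  "gsphere adj i x = {y. gdist adj x y = i}"

definition distance_regular :: "('v::finite \<Rightarrow> 'v \<Rightarrow> bool) \<Rightarrow> bool" where
  "distance_regular adj \<longleftrightarrow>
     simple_graph adj \<and> connected_graph adj \<and> gdiameter adj \<ge> 1 \<and>
     (\<forall>h \<le> gdiameter adj. \<forall>i \<le> gdiameter adj. \<forall>j \<le> gdiameter adj.
        \<exists>p. \<forall>y z. gdist adj y z = h \<longrightarrow> card (gsphere adj i y \<inter> gsphere adj j z) = p)"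

definition intersection_number ::
  "('v::finite \<Rightarrow> 'v \<Rightarrow> bool) \<Rightarrow> nat \<Rightarrow> nat \<Rightarrow> nat \<Rightarrow> nat" where
  "intersection_number adj h i j =
     (THE p. \<forall>y z. gdist adj y z = h \<longrightarrow> card (gsphere adj i y \<inter> gsphere adj j z) = p)"

definition intersection_array :: "('v::finite \<Rightarrow> 'v \<Rightarrow> bool) \<Rightarrow> nat list \<times> nat list" where
  "intersection_array adj =
     (map (\<lambda>i. intersection_number adj i 1 (i + 1)) [0..<gdiameter adj],
      map (\<lambda>i. intersection_number adj i 1 (i - 1)) [1..<gdiameter adj + 1])"

definition pappus_graph :: "('v::finite \<Rightarrow> 'v \<Rightarrow> bool) \<Rightarrow> bool" where
  "pappus_graph adj \<longleftrightarrow>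
     distance_regular adj \<and> CARD('v) = 18 \<and>
     intersection_array adj = ([3, 2, 2, 1], [1, 1, 2, 3])"


section \<open>Matrices and spectrum\<close>

definition mat_scale :: "complex \<Rightarrow> complex ^ 'v ^ 'v \<Rightarrow> complex ^ 'v ^ 'v" where
  "mat_scale c M = map_matrix ((*) c) M"

(* The complex vector space structure of Mat_X(C), providing cmat.subspace, cmat.dim, etc. *)
interpretation cmat: vector_space "mat_scale :: complex \<Rightarrow> complex ^ 'v ^ 'v \<Rightarrow> complex ^ 'v ^ 'v"
  by standard (auto simp: mat_scale_def map_matrix_def vec_eq_iff algebra_simps)

definition adjacency_matrix :: "('v::finite \<Rightarrow> 'v \<Rightarrow> bool) \<Rightarrow> complex ^ 'v ^ 'v" where
  "adjacency_matrix adj = (\<chi> u v. if adj u v then 1 else 0)"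

definition eigenspace :: "complex ^ 'v ^ 'v \<Rightarrow> complex \<Rightarrow> (complex ^ 'v) set" where
  "eigenspace M \<theta> = {v. M *v v = \<theta> *s v}"

(* Multiplicities are dimensions of eigenspaces; used for the Hermitian adjacency matrix,
   for which they agree with the multiplicities in the characteristic polynomial. *)
definition has_spectrum :: "complex ^ 'v ^ 'v \<Rightarrow> (complex \<times> nat) list \<Rightarrow> bool" where
  "has_spectrum M ps \<longleftrightarrow>
     distinct (map fst ps) \<and>
     {\<theta>. eigenspace M \<theta> \<noteq> {0}} = set (map fst ps) \<and>
     (\<forall>(\<theta>, m) \<in> set ps. vec.dim (eigenspace M \<theta>) = m)"

definition herm_inner :: "complex ^ 'v \<Rightarrow> complex ^ 'v \<Rightarrow> complex" where
  "herm_inner u v = (\<Sum>y\<in>UNIV. u $ y * cnj (v $ y))"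


section \<open>The Terwilliger algebra\<close>

definition Estar :: "('v::finite \<Rightarrow> 'v \<Rightarrow> bool) \<Rightarrow> 'v \<Rightarrow> nat \<Rightarrow> complex ^ 'v ^ 'v" where
  "Estar adj x i = (\<chi> y z. if y = z \<and> gdist adj x y = i then 1 else 0)"

definition estar :: "('v::finite \<Rightarrow> 'v \<Rightarrow> bool) \<Rightarrow> 'v \<Rightarrow> nat \<Rightarrow> complex ^ 'v" where
  "estar adj x i = (\<chi> y. if gdist adj x y = i then 1 else 0)"

definition mat_subalgebra :: "(complex ^ 'v ^ 'v) set \<Rightarrow> bool" where
  "mat_subalgebra S \<longleftrightarrow>
     cmat.subspace S \<and> mat 1 \<in> S \<and> (\<forall>M\<in>S. \<forall>N\<in>S. M ** N \<in> S)"

definition terwilliger :: "('v::finite \<Rightarrow> 'v \<Rightarrow> bool) \<Rightarrow> 'v \<Rightarrow> (complex ^ 'v ^ 'v) set" where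
  "terwilliger adj x =
     mat_subalgebra hull ({adjacency_matrix adj} \<union> Estar adj x ` {0..gdiameter adj})"


section \<open>Modules\<close>

definition is_module :: "(complex ^ 'v ^ 'v) set \<Rightarrow> (complex ^ 'v) set \<Rightarrow> bool" where
  "is_module T W \<longleftrightarrow> vec.subspace W \<and> (\<forall>B\<in>T. \<forall>w\<in>W. B *v w \<in> W)"

definition irreducible_module :: "(complex ^ 'v ^ 'v) set \<Rightarrow> (complex ^ 'v) set \<Rightarrow> bool" where
  "irreducible_module T W \<longleftrightarrow>
     is_module T W \<and> W \<noteq> {0} \<and> \<not> (\<exists>U. is_module T U \<and> U \<noteq> {0} \<and> U \<subset> W)"

definition module_iso ::
  "(complex ^ 'v ^ 'v) set \<Rightarrow> (complex ^ 'v) set \<Rightarrow> (complex ^ 'v) set \<Rightarrow> bool" where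
  "module_iso T W W' \<longleftrightarrow>
     (\<exists>f. bij_betw f W W' \<and>
          (\<forall>u\<in>W. \<forall>v\<in>W. f (u + v) = f u + f v) \<and>
          (\<forall>c. \<forall>u\<in>W. f (c *s u) = c *s f u) \<and>
          (\<forall>B\<in>T. \<forall>u\<in>W. f (B *v u) = B *v f u))"

(* Pairwise orthogonal subspaces are independent, so their sum is automatically direct. *)
definition orthogonal_decomposition ::
  "(complex ^ 'v ^ 'v) set \<Rightarrow> (complex ^ 'v) set list \<Rightarrow> bool" where
  "orthogonal_decomposition T Ws \<longleftrightarrow>
     (\<forall>W\<in>set Ws. irreducible_module T W) \<and>
     (\<forall>i<length Ws. \<forall>j<length Ws. i \<noteq> j \<longrightarrow>
        (\<forall>u\<in>Ws ! i. \<forall>v\<in>Ws ! j. herm_inner u v = 0)) \<and>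
     vec.span (\<Union>(set Ws)) = UNIV"

(* Using THE includes the fact that the number does not depend on the decomposition. *)
definition module_multiplicity ::
  "(complex ^ 'v ^ 'v) set \<Rightarrow> (complex ^ 'v) set \<Rightarrow> nat" where
  "module_multiplicity T W =
     (THE m. \<exists>Ws. orthogonal_decomposition T Ws \<and> m = length (filter (module_iso T W) Ws))"

definition layer ::
  "('v::finite \<Rightarrow> 'v \<Rightarrow> bool) \<Rightarrow> 'v \<Rightarrow> (complex ^ 'v) set \<Rightarrow> nat \<Rightarrow> (complex ^ 'v) set" where
  "layer adj x W i = (\<lambda>w. Estar adj x i *v w) ` W"

definition module_support ::
  "('v::finite \<Rightarrow> 'v \<Rightarrow> bool) \<Rightarrow> 'v \<Rightarrow> (complex ^ 'v) set \<Rightarrow> nat set" where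
  "module_support adj x W = {i. i \<le> gdiameter adj \<and> layer adj x W i \<noteq> {0}}"

definition endpoint ::
  "('v::finite \<Rightarrow> 'v \<Rightarrow> bool) \<Rightarrow> 'v \<Rightarrow> (complex ^ 'v) set \<Rightarrow> nat" where
  "endpoint adj x W = Min (module_support adj x W)"

definition module_diameter ::
  "('v::finite \<Rightarrow> 'v \<Rightarrow> bool) \<Rightarrow> 'v \<Rightarrow> (complex ^ 'v) set \<Rightarrow> nat" where
  "module_diameter adj x W = card (module_support adj x W) - 1"

definition module_shape ::
  "('v::finite \<Rightarrow> 'v \<Rightarrow> bool) \<Rightarrow> 'v \<Rightarrow> (complex ^ 'v) set \<Rightarrow> nat list" where
  "module_shape adj x W =
     map (\<lambda>i. vec.dim (layer adj x W i))
       [endpoint adj x W ..< endpoint adj x W + module_diameter adj x W + 1]"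


section \<open>Pure bases\<close>

definition pure_vector ::
  "('v::finite \<Rightarrow> 'v \<Rightarrow> bool) \<Rightarrow> 'v \<Rightarrow> nat \<Rightarrow> complex ^ 'v \<Rightarrow> bool" where
  "pure_vector adj x i v \<longleftrightarrow> v \<noteq> 0 \<and> v \<in> layer adj x UNIV i"

(* os is the chosen ordering of the sphere that supports v *)
definition essential_part :: "'v list \<Rightarrow> complex ^ 'v \<Rightarrow> complex list" where
  "essential_part os v = map (\<lambda>y. v $ y) os"

definition ordered_basis :: "(complex ^ 'v) set \<Rightarrow> (complex ^ 'v) list \<Rightarrow> bool" where
  "ordered_basis W vs \<longleftrightarrow>
     distinct vs \<and> vec.independent (set vs) \<and> vec.span (set vs) = W"

definition pure_basis ::
  "('v::finite \<Rightarrow> 'v \<Rightarrow> bool) \<Rightarrow> 'v \<Rightarrow> (complex ^ 'v) set \<Rightarrow> (complex ^ 'v) list \<Rightarrow> bool" where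
  "pure_basis adj x W vs \<longleftrightarrow>
     ordered_basis W vs \<and> (\<exists>is. sorted is \<and> list_all2 (pure_vector adj x) is vs)"

definition represents ::
  "complex ^ 'v ^ 'v \<Rightarrow> (complex ^ 'v) list \<Rightarrow> complex mat \<Rightarrow> bool" where
  "represents M vs B \<longleftrightarrow>
     B \<in> carrier_mat (length vs) (length vs) \<and>
     (\<forall>j<length vs. M *v (vs ! j) = (\<Sum>i<length vs. (B $$ (i, j)) *s (vs ! i)))"

(* r, m, l, \<delta>, sh: endpoint, multiplicity, dimension, diameter and shape of W *)
definition summand_data ::
  "('v::finite \<Rightarrow> 'v \<Rightarrow> bool) \<Rightarrow> 'v \<Rightarrow> (complex ^ 'v) set \<Rightarrow>
   nat \<Rightarrow> nat \<Rightarrow> nat \<Rightarrow> nat \<Rightarrow> nat list \<Rightarrow> (complex ^ 'v) list \<Rightarrow> complex mat \<Rightarrow> bool" where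
  "summand_data adj x W r m l \<delta> sh vs B \<longleftrightarrow>
     endpoint adj x W = r \<and> module_multiplicity (terwilliger adj x) W = m \<and>
     vec.dim W = l \<and> module_diameter adj x W = \<delta> \<and> module_shape adj x W = sh \<and>
     pure_basis adj x W vs \<and> represents (adjacency_matrix adj) vs B"

definition seed_vector ::
  "('v::finite \<Rightarrow> 'v \<Rightarrow> bool) \<Rightarrow> 'v \<Rightarrow> (complex ^ 'v) set \<Rightarrow>
   'v list \<Rightarrow> complex list \<Rightarrow> complex ^ 'v \<Rightarrow> bool" where
  "seed_vector adj x W os cs \<nu> \<longleftrightarrow>
     pure_vector adj x (endpoint adj x W) \<nu> \<and> essential_part os \<nu> = cs \<and>
     vec.span {\<nu>} = layer adj x W (endpoint adj x W) \<and>
     vec.dim (layer adj x W (endpoint adj x W)) = 1"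


section \<open>Orderings of the spheres around the base vertex\<close>

definition sphere_ordering :: "('v \<Rightarrow> 'v \<Rightarrow> bool) \<Rightarrow> 'v \<Rightarrow> nat \<Rightarrow> 'v list \<Rightarrow> bool" where
  "sphere_ordering adj x i os \<longleftrightarrow> distinct os \<and> set os = gsphere adj i x"

definition common_neighbor_in :: "('v \<Rightarrow> 'v \<Rightarrow> bool) \<Rightarrow> 'v set \<Rightarrow> 'v \<Rightarrow> 'v \<Rightarrow> bool" where
  "common_neighbor_in adj S u v \<longleftrightarrow> (\<exists>w\<in>S. adj u w \<and> adj v w)"

(* In the next two definitions list positions start at 0: y_k is ys ! (k - 1). *)
definition pappus_ordering2 :: "('v \<Rightarrow> 'v \<Rightarrow> bool) \<Rightarrow> 'v \<Rightarrow> 'v list \<Rightarrow> bool" where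
  "pappus_ordering2 adj x ys \<longleftrightarrow>
     sphere_ordering adj x 2 ys \<and> length ys = 6 \<and>
     (\<forall>(i, j) \<in> {(0, 1), (2, 3), (4, 5)}.
        common_neighbor_in adj (gsphere adj 1 x) (ys ! i) (ys ! j)) \<and>
     (\<forall>(i, j) \<in> {(0, 2), (2, 4), (4, 1), (1, 3), (3, 5), (5, 0)}.
        common_neighbor_in adj (gsphere adj 3 x) (ys ! i) (ys ! j))"

definition pappus_ordering3 :: "('v \<Rightarrow> 'v \<Rightarrow> bool) \<Rightarrow> 'v \<Rightarrow> 'v list \<Rightarrow> bool" where
  "pappus_ordering3 adj x zs \<longleftrightarrow>
     sphere_ordering adj x 3 zs \<and> length zs = 6 \<and>
     (\<exists>w w'. w \<noteq> w' \<and> gsphere adj 4 x = {w, w'} \<and>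
        {z. adj w z} = {zs ! 0, zs ! 3, zs ! 5} \<and>
        {z. adj w' z} = {zs ! 1, zs ! 2, zs ! 4})"

end

(* Around a base vertex x, the two neighbors at distance 3 of each vertex at distance 2 join the
   second sphere into a hexagon, and consecutive vertices of that hexagon are linked through
   vertices at distance 3 whose neighbors at distance 4 alternate between w and w'.  This fixes the
   graph up to labels, so that the action of A on each seed vector is a computation with 18
   coordinates.  The resulting 18 vectors are an orthogonal basis of V on which A is tridiagonal
   along each summand and each E_i^* is diagonal.

   In this basis every element of T acts by one matrix per type.  Conversely all matrix units
   lie in T: a diagonal unit of type t is E_i^* minus the units of the other types meeting layer i,
   for a layer i at which those are already known, and the remaining units of type t arise from
   it by multiplying with A and the E_j^*.  Irreducibility, the isomorphism classes and
   dim T = 43 follow.  The multiplicity of a type is the rank of one of its diagonal units, hence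
   the same for every decomposition. *)

theory Submission
  imports Defs
begin

section \<open>Distances and intersection numbers\<close>

text \<open>Two consequences of the array carry the labelling: \<open>b_i + c_i = 3\<close> at every
  inner level, so no edge stays inside a sphere, and \<open>c_2 = 1\<close>, so there are no
  4-cycles. Then \<open>c_3 = 2\<close> makes the distance-2 relation between children of different
  neighbors of \<open>x\<close> 2-regular on the second sphere: a hexagon or two triangles, and
  triangles would force a 4-cycle because only two vertices lie at distance 4. Hence suitable
  orderings exist, and the claim about all orderings is not vacuous. The seeds in a layer are
  vectors that \<open>A\<close> does not send downwards. The layers have sizes 1, 3, 6, 6, 2, and
  the chains that start in them number 1, 2, 3, 1, 0. In layer 2 the seeds take opposite values at
  opposite vertices of the hexagon. Going up to layer 3 and back acts there as 2 plus the adjacency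
  of the hexagon, whose eigenvalues on such vectors are -2, 1, 1. The resulting scalars 0, 3, 3 give
  one module that stops at once and two isomorphic ones of dimension 2.\<close>

lemma gdist_relpowp:
  assumes "connected_graph adj"
  shows "(adj ^^ gdist adj u v) u v"
proof -
  have "adj\<^sup>*\<^sup>* u v"
    using assms unfolding connected_graph_def by blast
  then have "\<exists>n. (adj ^^ n) u v"
    by (rule rtranclp_imp_relpowp)
  then show ?thesis
    unfolding gdist_def by (rule LeastI_ex)
qed

lemma gdist_le: "(adj ^^ n) u v \<Longrightarrow> gdist adj u v \<le> n"
  unfolding gdist_def by (rule Least_le)

lemma gdist_self [simp]: "gdist adj u u = 0"
  using gdist_le[of 0 adj u u] by simp

lemma gdist_eq_0_iff:
  assumes "connected_graph adj"
  shows "gdist adj u v = 0 \<longleftrightarrow> u = v"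
  using gdist_relpowp[OF assms, of u v] by auto

lemma relpowp_sym:
  assumes "\<And>u v. R u v \<Longrightarrow> R v u"
  shows "(R ^^ n) u v \<Longrightarrow> (R ^^ n) v u"
proof (induction n arbitrary: v)
  case 0
  then show ?case
    by simp
next
  case (Suc n)
  then obtain w where "(R ^^ n) u w" "R w v"
    by auto
  then have "(R ^^ n) w u" "R v w"
    by (blast intro: Suc.IH assms)+
  then show ?case
    by (rule relpowp_Suc_I2[rotated])
qed

lemma gdist_commute:
  assumes "simple_graph adj" "connected_graph adj"
  shows "gdist adj u v = gdist adj v u"
proof -
  have "gdist adj v u \<le> gdist adj u v" for u v
    by (rule gdist_le, rule relpowp_sym[OF _ gdist_relpowp[OF assms(2)]])
      (use assms(1) in \<open>simp add: simple_graph_def\<close>)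
  then show ?thesis
    by (simp add: le_antisym)
qed

lemma gdist_eq_1_iff:
  assumes "simple_graph adj" "connected_graph adj"
  shows "gdist adj u v = 1 \<longleftrightarrow> adj u v"
proof
  assume "gdist adj u v = 1"
  then show "adj u v"
    using gdist_relpowp[OF assms(2), of u v] by auto
next
  assume uv: "adj u v"
  then have "gdist adj u v \<noteq> 0"
    using assms by (metis gdist_eq_0_iff simple_graph_def)
  moreover have "(adj ^^ 1) u v"
    using uv by auto
  then have "gdist adj u v \<le> 1"
    by (rule gdist_le)
  ultimately show "gdist adj u v = 1"
    by simp
qed

lemma gdist_le_gdiameter:
  fixes adj :: "'v::finite \<Rightarrow> 'v \<Rightarrow> bool"
  shows "gdist adj u v \<le> gdiameter adj"
proof -
  have "{gdist adj u v |u v. True} = (\<lambda>(u, v). gdist adj u v) ` UNIV"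
    by auto
  then have "finite {gdist adj u v |u v. True}"
    by simp
  then show ?thesis
    unfolding gdiameter_def by (intro Max_ge) auto
qed

lemma card_gsphere_Int:
  assumes dr: "distance_regular adj"
    and "h \<le> gdiameter adj" "i \<le> gdiameter adj" "j \<le> gdiameter adj" "gdist adj y z = h"
  shows "card (gsphere adj i y \<inter> gsphere adj j z) = intersection_number adj h i j"
proof -
  obtain p where p: "\<And>y z. gdist adj y z = h \<Longrightarrow> card (gsphere adj i y \<inter> gsphere adj j z) = p"
    using assms unfolding distance_regular_def by metis
  have "intersection_number adj h i j = p"
    unfolding intersection_number_def using p assms(5) by (intro the_equality) auto
  then show ?thesis
    using p assms(5) by simp
qed

locale pappus =
  fixes adj :: "'v::finite \<Rightarrow> 'v \<Rightarrow> bool"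
  assumes pappus: "pappus_graph adj"
begin

abbreviation d :: "'v \<Rightarrow> 'v \<Rightarrow> nat" where "d \<equiv> gdist adj"

abbreviation N :: "'v \<Rightarrow> 'v set" where "N u \<equiv> {v. adj u v}"

lemma dr: "distance_regular adj"
  and simple: "simple_graph adj"
  and conn: "connected_graph adj"
  and arr: "intersection_array adj = ([3, 2, 2, 1], [1, 1, 2, 3])"
  using pappus unfolding pappus_graph_def distance_regular_def by auto

lemma adj_sym: "adj u v \<Longrightarrow> adj v u"
  and adj_irrefl: "\<not> adj u u"
  using simple unfolding simple_graph_def by auto

lemma diam: "gdiameter adj = 4"
proof -
  have "length (fst (intersection_array adj)) = gdiameter adj"
    unfolding intersection_array_def by simp
  then show ?thesis
    by (simp add: arr)
qed

lemma d_le_4: "d u v \<le> 4"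
  using gdist_le_gdiameter[of adj u v] diam by simp

lemmas d_commute = gdist_commute[OF simple conn]
  and d_eq_0_iff = gdist_eq_0_iff[OF conn]
  and d_eq_1_iff = gdist_eq_1_iff[OF simple conn]

section \<open>Intersection numbers as counts of neighbors\<close>

lemma b_number:
  assumes "d y z < 4"
  shows "card {u. adj y u \<and> d z u = Suc (d y z)} = [3, 2, 2, 1] ! d y z"
proof -
  have "map (\<lambda>i. intersection_number adj i 1 (i + 1)) [0..<4] ! d y z = [3, 2, 2, 1] ! d y z"
    using arr unfolding intersection_array_def diam by simp
  then have "intersection_number adj (d y z) 1 (d y z + 1) = [3, 2, 2, 1] ! d y z"
    using assms by simp
  moreover have "{u. adj y u \<and> d z u = Suc (d y z)} = gsphere adj 1 y \<inter> gsphere adj (d y z + 1) z"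
    unfolding gsphere_def using d_eq_1_iff by auto
  ultimately show ?thesis
    using card_gsphere_Int[OF dr, of "d y z" 1 "d y z + 1" y z] assms diam by simp
qed

text \<open>Position \<open>h\<close> of the second list holds \<open>c_{h+1}\<close>, hence the
  distance \<open>Suc h\<close>.\<close>

lemma c_number:
  assumes "d y z = Suc h"
  shows "card {u. adj y u \<and> d z u = h} = [1, 1, 2, 3] ! h"
proof -
  have h: "h < 4"
    using assms d_le_4[of y z] by simp
  have "map (\<lambda>i. intersection_number adj i 1 (i - 1)) [1..<5] ! h = [1, 1, 2, 3] ! h"
    using arr unfolding intersection_array_def diam by simp
  then have "intersection_number adj (Suc h) 1 h = [1, 1, 2, 3] ! h"
    using h by (simp del: upt_Suc)
  moreover have "{u. adj y u \<and> d z u = h} = gsphere adj 1 y \<inter> gsphere adj h z"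
    unfolding gsphere_def using d_eq_1_iff by auto
  ultimately show ?thesis
    using card_gsphere_Int[OF dr, of "Suc h" 1 h y z] assms h diam by simp
qed

lemma degree: "card (N u) = 3"
  using b_number[of u u] d_eq_1_iff by simp

text \<open>The forward and backward counts at each level add up to the valency 3, with only
  \<open>b_0\<close> at distance 0 and only \<open>c_4\<close> at distance 4. So no neighbor of
  \<open>y\<close> keeps the distance from \<open>z\<close>: the graph is bipartite.\<close>

lemma d_step:
  assumes "adj y u"
  shows "d z u = Suc (d z y) \<or> d z y = Suc (d z u)"
proof -
  let ?h = "d z y"
  let ?B = "{u. adj y u \<and> d z u = Suc ?h}" and ?C = "{u. adj y u \<and> Suc (d z u) = ?h}"
  have "card (?B \<union> ?C) = card ?B + card ?C"
    by (intro card_Un_disjoint) auto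
  also have "\<dots> = 3"
  proof (cases "?h = 0")
    case True
    then show ?thesis
      using b_number[of y z] d_commute[of y z] by simp
  next
    case False
    then obtain k where k: "?h = Suc k"
      using not0_implies_Suc by blast
    have C: "card ?C = [1, 1, 2, 3] ! k"
      using c_number[of y z k] d_commute[of y z] k by simp
    show ?thesis
    proof (cases "?h < 4")
      case True
      then have "k = 0 \<or> k = 1 \<or> k = 2"
        using k by auto
      then show ?thesis
        using C b_number[of y z] d_commute[of y z] k True by auto
    next
      case False
      then have h: "?h = 4" "k = 3"
        using k d_le_4[of z y] by auto
      have "d z u \<noteq> Suc 4" for u
        using d_le_4[of z u] by simp
      then have "?B = {}"
        using h by auto
      then show ?thesis
        using C h by simp
    qed
  qed
  finally have "?B \<union> ?C = N y"
    using degree[of y] by (intro card_subset_eq) auto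
  then show ?thesis
    using assms by auto
qed

text \<open>\<open>c_2 = 1\<close> excludes 4-cycles: distinct vertices with a common neighbor are
  at distance 2, because distances from \<open>w\<close> change by exactly one along edges.\<close>

lemma common_neighbor_unique:
  assumes "adj y q" "adj y q'" "adj w q" "adj w q'" "w \<noteq> y"
  shows "q = q'"
proof (rule ccontr)
  assume "q \<noteq> q'"
  have w1: "d w q = 1" "d w q' = 1"
    using assms d_eq_1_iff by auto
  then have "d w y = 2"
    using d_step[of q y w] d_eq_0_iff[of w y] assms adj_sym by auto
  then have "card {u. adj y u \<and> d w u = 1} = 1"
    using c_number[of y w 1] d_commute[of y w] by simp
  moreover have "{q, q'} \<subseteq> {u. adj y u \<and> d w u = 1}"
    using assms w1 by auto
  then have "card {q, q'} \<le> card {u. adj y u \<and> d w u = 1}"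
    by (intro card_mono) auto
  ultimately show False
    using \<open>q \<noteq> q'\<close> by simp
qed

lemma N_eqI:
  assumes "adj u a" "adj u b" "adj u c" "a \<noteq> b" "a \<noteq> c" "b \<noteq> c"
  shows "N u = {a, b, c}"
proof -
  have "{a, b, c} = N u"
    using assms degree[of u] by (intro card_subset_eq) auto
  then show ?thesis ..
qed

end

section \<open>Labelling the graph from a base vertex\<close>

text \<open>In the hexagon \<open>y1, y3, y5, y2, y4, y6\<close> consecutive vertices are joined through
  \<open>q1, q2, q3, q4, q5, q6\<close> in this order; opposite vertices have a common neighbor among the
  \<open>p\<close>s.\<close>

locale pappus_labelled =
  fixes adj :: "'v::finite \<Rightarrow> 'v \<Rightarrow> bool"
    and x p1 p2 p3 y1 y2 y3 y4 y5 y6 q1 q2 q3 q4 q5 q6 w w' :: 'v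
  assumes distinct_vertices:
      "distinct [x, p1, p2, p3, y1, y2, y3, y4, y5, y6, q1, q2, q3, q4, q5, q6, w, w']"
    and all_vertices:
      "UNIV = set [x, p1, p2, p3, y1, y2, y3, y4, y5, y6, q1, q2, q3, q4, q5, q6, w, w']"
    and neighbors:
      "{v. adj x v} = {p1, p2, p3}"
      "{v. adj p1 v} = {x, y1, y2}" "{v. adj p2 v} = {x, y3, y4}" "{v. adj p3 v} = {x, y5, y6}"
      "{v. adj y1 v} = {p1, q6, q1}" "{v. adj y3 v} = {p2, q1, q2}" "{v. adj y5 v} = {p3, q2, q3}"
      "{v. adj y2 v} = {p1, q3, q4}" "{v. adj y4 v} = {p2, q4, q5}" "{v. adj y6 v} = {p3, q5, q6}"
      "{v. adj q1 v} = {y1, y3, w}" "{v. adj q2 v} = {y3, y5, w'}" "{v. adj q3 v} = {y5, y2, w}"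
      "{v. adj q4 v} = {y2, y4, w'}" "{v. adj q5 v} = {y4, y6, w}" "{v. adj q6 v} = {y6, y1, w'}"
      "{v. adj w v} = {q1, q3, q5}" "{v. adj w' v} = {q2, q4, q6}"
    and distances:
      "gdist adj x x = 0" "gdist adj x p1 = 1" "gdist adj x p2 = 1" "gdist adj x p3 = 1"
      "gdist adj x y1 = 2" "gdist adj x y2 = 2" "gdist adj x y3 = 2"
      "gdist adj x y4 = 2" "gdist adj x y5 = 2" "gdist adj x y6 = 2"
      "gdist adj x q1 = 3" "gdist adj x q2 = 3" "gdist adj x q3 = 3"
      "gdist adj x q4 = 3" "gdist adj x q5 = 3" "gdist adj x q6 = 3"
      "gdist adj x w = 4" "gdist adj x w' = 4"

context pappus
begin

abbreviation G :: "nat \<Rightarrow> 'v \<Rightarrow> 'v set" where "G i u \<equiv> gsphere adj i u"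

section \<open>Counts between consecutive spheres around the base vertex\<close>

lemma up_degree:
  assumes "d x y = h" "h < 4"
  shows "card {u. adj y u \<and> d x u = Suc h} = [3, 2, 2, 1] ! h"
  using b_number[of y x] assms d_commute[of y x] by simp

lemma down_degree:
  assumes "d x y = Suc h"
  shows "card {u. adj y u \<and> d x u = h} = [1, 1, 2, 3] ! h"
  using c_number[of y x h] assms d_commute[of y x] by simp

text \<open>The edges between two consecutive spheres are counted from both sides. Entry
  \<open>h\<close> of the list of \<open>c\<close> belongs to distance \<open>h + 1\<close>, entry
  \<open>h\<close> of the list of \<open>b\<close> to distance \<open>h\<close>.\<close>

lemma card_sphere_step:
  assumes "h < 4"
  shows "card (G (Suc h) x) * [1, 1, 2, 3] ! h = card (G h x) * [3, 2, 2, 1] ! h"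
proof -
  have "(\<Sum>y\<in>G h x. card {u \<in> G (Suc h) x. adj y u}) = [1, 1, 2, 3] ! h * card (G (Suc h) x)"
  proof (rule sum_multicount)
    show "\<forall>u\<in>G (Suc h) x. card {y \<in> G h x. adj y u} = [1, 1, 2, 3] ! h"
    proof
      fix u assume "u \<in> G (Suc h) x"
      moreover have "{y \<in> G h x. adj y u} = {y. adj u y \<and> d x y = h}"
        using adj_sym by (auto simp: gsphere_def)
      ultimately show "card {y \<in> G h x. adj y u} = [1, 1, 2, 3] ! h"
        using down_degree[of x u h] by (simp add: gsphere_def)
    qed
  qed auto
  moreover have "card {u \<in> G (Suc h) x. adj y u} = [3, 2, 2, 1] ! h" if "y \<in> G h x" for y
  proof -
    have "{u \<in> G (Suc h) x. adj y u} = {u. adj y u \<and> d x u = Suc h}"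
      by (auto simp: gsphere_def)
    then show ?thesis
      using up_degree[of x y h] that assms by (simp add: gsphere_def)
  qed
  ultimately show ?thesis
    by (simp add: mult.commute)
qed

lemma card_spheres:
  "card (G 1 x) = 3" "card (G 2 x) = 6" "card (G 3 x) = 6" "card (G 4 x) = 2"
proof -
  have "G 0 x = {x}"
    using d_eq_0_iff by (auto simp: gsphere_def)
  then have "card (G 0 x) = 1"
    by simp
  then show 1: "card (G 1 x) = 3"
    using card_sphere_step[of 0 x] by simp
  then show 2: "card (G 2 x) = 6"
    using card_sphere_step[of 1 x] by (simp add: numeral_2_eq_2)
  then show 3: "card (G 3 x) = 6"
    using card_sphere_step[of 2 x] by simp
  then show "card (G 4 x) = 2"
    using card_sphere_step[of 3 x] by simp
qed

lemma parent_unique: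
  assumes "d x y = 2" "d x p = 1" "d x p' = 1" "adj y p" "adj y p'"
  shows "p = p'"
proof -
  have "card {u. adj y u \<and> d x u = 1} = 1"
    using down_degree[of x y 1] assms(1) by simp
  then obtain a where "{u. adj y u \<and> d x u = 1} = {a}"
    by (rule card_1_singletonE)
  then have "p \<in> {a}" "p' \<in> {a}"
    using assms by blast+
  then show ?thesis
    by simp
qed

lemma children_eq:
  assumes "d x p = 1" "d x a = 2" "d x b = 2" "adj p a" "adj p b" "a \<noteq> b"
  shows "{u. adj p u \<and> d x u = 2} = {a, b}"
proof -
  have "card {u. adj p u \<and> d x u = 2} = 2"
    using up_degree[of x p 1] assms(1) by (simp add: numeral_2_eq_2)
  then have "{a, b} = {u. adj p u \<and> d x u = 2}"
    using assms by (intro card_subset_eq) auto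
  then show ?thesis ..
qed

lemma lower_neighbors_eq:
  assumes "d x q = 3" "d x a = 2" "d x b = 2" "adj q a" "adj q b" "a \<noteq> b"
  shows "{u. adj q u \<and> d x u = 2} = {a, b}"
proof -
  have "card {u. adj q u \<and> d x u = 2} = 2"
    using down_degree[of x q 2] assms(1) by simp
  then have "{a, b} = {u. adj q u \<and> d x u = 2}"
    using assms by (intro card_subset_eq) auto
  then show ?thesis ..
qed

lemma last_neighbor:
  assumes "d x q = 3"
  obtains w where "adj q w" "d x w = 4"
proof -
  have "card {u. adj q u \<and> d x u = 4} = 1"
    using up_degree[of x q 3] assms by simp
  then obtain a where "{u. adj q u \<and> d x u = 4} = {a}"
    by (rule card_1_singletonE)
  then show ?thesis
    using that by auto
qed

text \<open>The vertices \<open>p\<close> and \<open>q\<close> are the common neighbors that the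
  ordering promises. Sphere sizes and the valency show that these vertices and edges, together with
  \<open>w\<close> and \<open>w'\<close>, are all there are.\<close>

lemma labelling_exists:
  assumes "pappus_ordering2 adj x [y1, y2, y3, y4, y5, y6]"
  shows "\<exists>p1 p2 p3 q1 q2 q3 q4 q5 q6 w w'.
    pappus_labelled adj x p1 p2 p3 y1 y2 y3 y4 y5 y6 q1 q2 q3 q4 q5 q6 w w'"
proof -
  have ys: "distinct [y1, y2, y3, y4, y5, y6]" and G2: "G 2 x = {y1, y2, y3, y4, y5, y6}"
    using assms unfolding pappus_ordering2_def sphere_ordering_def by auto
  have dy: "d x y1 = 2" "d x y2 = 2" "d x y3 = 2" "d x y4 = 2" "d x y5 = 2" "d x y6 = 2"
    using G2 unfolding gsphere_def by auto
  obtain p1 p2 p3 where p: "d x p1 = 1" "d x p2 = 1" "d x p3 = 1"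
    "adj y1 p1" "adj y2 p1" "adj y3 p2" "adj y4 p2" "adj y5 p3" "adj y6 p3"
    using assms unfolding pappus_ordering2_def common_neighbor_in_def gsphere_def by auto
  obtain q1 q2 q3 q4 q5 q6 where
    q: "d x q1 = 3" "d x q2 = 3" "d x q3 = 3" "d x q4 = 3" "d x q5 = 3" "d x q6 = 3" and
    yq: "adj y1 q1" "adj y3 q1" "adj y3 q2" "adj y5 q2" "adj y5 q3" "adj y2 q3"
    "adj y2 q4" "adj y4 q4" "adj y4 q5" "adj y6 q5" "adj y6 q6" "adj y1 q6"
    using assms unfolding pappus_ordering2_def common_neighbor_in_def gsphere_def by auto
  note sym = p(4-9)[THEN adj_sym] yq[THEN adj_sym]
  have "{u. adj p1 u \<and> d x u = 2} = {y1, y2}" "{u. adj p2 u \<and> d x u = 2} = {y3, y4}"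
    "{u. adj p3 u \<and> d x u = 2} = {y5, y6}"
    by (rule children_eq; use ys in \<open>simp add: p dy sym\<close>)+
  \<comment> \<open>Equal parents would have equal sets of children.\<close>
  then have pd: "distinct [p1, p2, p3]"
    using ys by (auto simp: doubleton_eq_iff)
  have "{u. adj q1 u \<and> d x u = 2} = {y1, y3}" "{u. adj q2 u \<and> d x u = 2} = {y3, y5}"
    "{u. adj q3 u \<and> d x u = 2} = {y5, y2}" "{u. adj q4 u \<and> d x u = 2} = {y2, y4}"
    "{u. adj q5 u \<and> d x u = 2} = {y4, y6}" "{u. adj q6 u \<and> d x u = 2} = {y6, y1}"
    by (rule lower_neighbors_eq; use ys in \<open>simp add: q dy sym eq_commute\<close>)+
  then have qd: "distinct [q1, q2, q3, q4, q5, q6]"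
    using ys by (auto simp: doubleton_eq_iff)
  obtain w where w: "adj q1 w" "d x w = 4"
    using last_neighbor q by blast
  obtain w' where w': "adj q2 w'" "d x w' = 4"
    using last_neighbor q by blast
  \<comment> \<open>A vertex \<open>u\<close> at distance 4 adjacent to both \<open>a\<close> and
    \<open>b\<close> would close a 4-cycle with \<open>y\<close>, which differs from
    \<open>u\<close> because it lies at distance 2.\<close>
  have alternate: "\<not> (adj a u \<and> adj b u)"
    if "adj y a" "adj y b" "a \<noteq> b" "d x y = 2" "d x u = 4" for a b y u
    using common_neighbor_unique[of y a b u] that adj_sym by force
  have "w \<noteq> w'"
    using alternate[of y3 q1 q2 w] w w' yq dy qd by auto
  have "{w, w'} = G 4 x"
    using w w' \<open>w \<noteq> w'\<close> card_spheres(4)[of x] by (intro card_subset_eq) (auto simp: gsphere_def)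
  then have ww: "adj a w \<or> adj a w'" if "d x a = 3" for a
    using last_neighbor[OF that] unfolding gsphere_def by (metis (mono_tags) insertE mem_Collect_eq singletonD)
  have w'q: "adj q4 w'" "adj q6 w'" and wq: "adj q3 w" "adj q5 w"
  proof -
    \<comment> \<open>Around the hexagon, each \<open>q\<close> has \<open>w\<close> or
      \<open>w'\<close> as a neighbor, and not the one adjacent to its predecessor, so the two
      alternate.\<close>
    show "adj q3 w"
      using alternate[of y5 q2 q3 w'] ww[of q3] w' yq dy q qd by auto
    then show "adj q4 w'"
      using alternate[of y2 q3 q4 w] ww[of q4] w yq dy q qd by auto
    then show "adj q5 w"
      using alternate[of y4 q4 q5 w'] ww[of q5] w' yq dy q qd by auto
    then show "adj q6 w'"
      using alternate[of y6 q5 q6 w] ww[of q6] w yq dy q qd by auto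
  qed
  note sym' = w(1)[THEN adj_sym] w'(1)[THEN adj_sym] w'q[THEN adj_sym] wq[THEN adj_sym]
  have xp: "adj x p1" "adj x p2" "adj x p3"
    using p d_eq_1_iff by auto
  note adjs = sym sym' p yq w w' w'q wq xp xp[THEN adj_sym]
  have G1: "{p1, p2, p3} = G 1 x"
    using p pd card_spheres(1)[of x] by (intro card_subset_eq) (auto simp: gsphere_def)
  have G3: "{q1, q2, q3, q4, q5, q6} = G 3 x"
    using q qd card_spheres(3)[of x] by (intro card_subset_eq) (auto simp: gsphere_def)
  have "u = x \<or> u \<in> G 1 x \<or> u \<in> G 2 x \<or> u \<in> G 3 x \<or> u \<in> G 4 x" for u
  proof -
    have "d x u = 0 \<or> d x u = 1 \<or> d x u = 2 \<or> d x u = 3 \<or> d x u = 4"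
      using d_le_4[of x u] by linarith
    then show ?thesis
      using d_eq_0_iff[of x u] by (auto simp: gsphere_def)
  qed
  then have U: "u \<in> set [x, p1, p2, p3, y1, y2, y3, y4, y5, y6, q1, q2, q3, q4, q5, q6, w, w']" for u
    unfolding G2 G1[symmetric] G3[symmetric] \<open>{w, w'} = G 4 x\<close>[symmetric] by auto
  have far: "u \<noteq> v" if "d x u \<noteq> d x v" for u v
    using that by auto
  have D: "distinct [x, p1, p2, p3, y1, y2, y3, y4, y5, y6, q1, q2, q3, q4, q5, q6, w, w']"
    by (use pd ys qd \<open>w \<noteq> w'\<close> in simp) (intro conjI; rule far; simp add: p dy q w w')
  have neq: "p1 \<noteq> p2" "p1 \<noteq> p3" "p2 \<noteq> p3" "y1 \<noteq> y2" "y3 \<noteq> y4" "y5 \<noteq> y6"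
    "y1 \<noteq> y3" "y3 \<noteq> y5" "y5 \<noteq> y2" "y2 \<noteq> y4" "y4 \<noteq> y6" "y6 \<noteq> y1"
    "q1 \<noteq> q2" "q2 \<noteq> q3" "q3 \<noteq> q4" "q4 \<noteq> q5" "q5 \<noteq> q6" "q6 \<noteq> q1"
    "q1 \<noteq> q3" "q1 \<noteq> q5" "q3 \<noteq> q5" "q2 \<noteq> q4" "q2 \<noteq> q6" "q4 \<noteq> q6"
    using pd ys qd by auto
  have "pappus_labelled adj x p1 p2 p3 y1 y2 y3 y4 y5 y6 q1 q2 q3 q4 q5 q6 w w'"
  proof
    show "UNIV = set [x, p1, p2, p3, y1, y2, y3, y4, y5, y6, q1, q2, q3, q4, q5, q6, w, w']"
      using U by blast
  qed (fact D | rule N_eqI; (rule adjs neq | rule far, simp add: p dy q w w') | simp add: p dy q w w')+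
  then show ?thesis
    by blast
qed

text \<open>The vertex \<open>p\<close> is at distance 3 from \<open>y\<close>, and
  \<open>c_3 = 2\<close>: exactly two of its three neighbors \<open>x\<close>, \<open>a\<close>,
  \<open>b\<close> are at distance 2 from \<open>y\<close>. One of them is \<open>x\<close>.\<close>

lemma distance_2_exactly_one:
  assumes "d x y = 2" "d x p = 1" "\<not> adj y p" "{u. adj p u \<and> d x u = 2} = {a, b}" "a \<noteq> b"
  shows "d y a = 2 \<longleftrightarrow> d y b \<noteq> 2"
proof -
  have xp: "adj p x" "adj x p"
    using assms(2) d_eq_1_iff adj_sym by auto
  have ab: "adj p a" "adj p b" "d x a = 2" "d x b = 2"
    using assms(4) by blast+
  have "x \<noteq> a" "x \<noteq> b"
    using ab by auto
  then have Np: "N p = {x, a, b}"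
    using xp ab assms(5) by (intro N_eqI) auto
  have "d y x = 2" "d y p \<noteq> 1"
    using assms(1,3) d_commute[of y x] d_eq_1_iff[of y p] by simp_all
  then have "d y p = 3"
    using d_step[of x p y] xp by auto
  then have "card {u. adj p u \<and> d y u = 2} = 2"
    using c_number[of p y 2] d_commute[of p y] by simp
  moreover have "{u. adj p u \<and> d y u = 2} = {u \<in> {x, a, b}. d y u = 2}"
    using Np by auto
  moreover have "{u \<in> {x, a, b}. d y u = 2} =
      {x} \<union> (if d y a = 2 then {a} else {}) \<union> (if d y b = 2 then {b} else {})"
    using \<open>d y x = 2\<close> by auto
  ultimately show ?thesis
    using \<open>x \<noteq> a\<close> \<open>x \<noteq> b\<close> assms(5) by (auto split: if_splits)
qed

lemma common_neighbor_if_distance_2: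
  assumes "d y a = 2"
  obtains q where "adj y q" "adj a q"
proof -
  have "card {u. adj y u \<and> d a u = 1} = 1"
    using c_number[of y a 1] assms by simp
  then obtain q where "{u. adj y u \<and> d a u = 1} = {q}"
    by (rule card_1_singletonE)
  then show ?thesis
    using that d_eq_1_iff by blast
qed

text \<open>The common neighbor is not at distance 1 from \<open>x\<close>: it would be the unique
  parent \<open>p\<close> of \<open>a\<close>, which is not adjacent to \<open>y\<close>. By parity
  only distance 3 remains.\<close>

lemma common_neighbor_in_sphere_3:
  assumes "d x y = 2" "d x a = 2" "d y a = 2" "d x p = 1" "adj a p" "\<not> adj y p"
  obtains q where "d x q = 3" "adj y q" "adj a q"
proof -
  obtain q where q: "adj y q" "adj a q"
    using common_neighbor_if_distance_2 assms(3) by blast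
  have "d x q \<noteq> 1"
    using parent_unique[of x a p q] q assms by auto
  then have "d x q = 3"
    using d_step[of y q x] q assms by auto
  then show ?thesis
    using that q by blast
qed

text \<open>Call two vertices of the second sphere with different parents linked if they are at
  distance 2. Each vertex is linked to exactly one child of every other parent. Starting from
  \<open>y1\<close> with the linked \<open>y3\<close> and \<open>y6\<close>, all remaining links are
  forced once \<open>y3\<close> and \<open>y6\<close> are known not to be linked.\<close>

lemma ordering2_exists: "\<exists>ys. pappus_ordering2 adj x ys"
proof -
  obtain p1 p2 p3 where G1: "G 1 x = {p1, p2, p3}" and p: "p1 \<noteq> p2" "p2 \<noteq> p3" "p1 \<noteq> p3"
    using card_spheres(1)[of x] by (meson card_3_iff)
  have dp: "d x p1 = 1" "d x p2 = 1" "d x p3 = 1"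
    using G1 by (auto simp: gsphere_def)
  have two: "card {u. adj p u \<and> d x u = 2} = 2" if "d x p = 1" for p
    using up_degree[of x p 1] that by (simp add: numeral_2_eq_2)
  obtain y1 y2 where N1: "{u. adj p1 u \<and> d x u = 2} = {y1, y2}" "y1 \<noteq> y2"
    using two[OF dp(1)] unfolding card_2_iff by blast
  have y1: "d x y1 = 2" "adj p1 y1" and y2: "d x y2 = 2" "adj p1 y2"
    using N1 by blast+
  have no: "\<not> adj y p'" if "d x y = 2" "adj p y" "d x p = 1" "d x p' = 1" "p \<noteq> p'" for y p p'
    using parent_unique that adj_sym by blast
  \<comment> \<open>Of the two children of another parent, \<open>a\<close> denotes the one linked
    to \<open>y1\<close>.\<close>
  have split: "\<exists>a b. {u. adj p u \<and> d x u = 2} = {a, b} \<and> a \<noteq> b \<and> d y1 a = 2 \<and> d y1 b \<noteq> 2"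
    if dp': "d x p = 1" and "\<not> adj y1 p" for p
  proof -
    obtain a b where ab: "{u. adj p u \<and> d x u = 2} = {a, b}" "a \<noteq> b"
      using two[OF dp'] unfolding card_2_iff by blast
    show ?thesis
      using distance_2_exactly_one[OF y1(1) dp' \<open>\<not> adj y1 p\<close> ab] ab by (metis insert_commute)
  qed
  obtain y3 y4 where N2: "{u. adj p2 u \<and> d x u = 2} = {y3, y4}" "y3 \<noteq> y4" "d y1 y3 = 2" "d y1 y4 \<noteq> 2"
    using split[OF dp(2)] no[OF y1 dp(1,2) p(1)] by blast
  obtain y6 y5 where N3: "{u. adj p3 u \<and> d x u = 2} = {y6, y5}" "y6 \<noteq> y5" "d y1 y6 = 2" "d y1 y5 \<noteq> 2"
    using split[OF dp(3)] no[OF y1 dp(1,3) p(3)] by blast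
  have y3: "d x y3 = 2" "adj p2 y3" and y4: "d x y4 = 2" "adj p2 y4"
    and y5: "d x y5 = 2" "adj p3 y5" and y6: "d x y6 = 2" "adj p3 y6"
    using N2 N3 by blast+
  note yp = y1 y2 y3 y4 y5 y6
  \<comment> \<open>The link of \<open>y3\<close> into the pair \<open>y1\<close>, \<open>y2\<close>
    is already spent on \<open>y1\<close>, so \<open>y2\<close> must be linked to the other child of
    \<open>p2\<close>.\<close>
  have "d y3 y2 \<noteq> 2"
    using distance_2_exactly_one[OF y3(1) dp(1) no[OF y3 dp(2,1)] N1] N2(3) p d_commute[of y1 y3] by auto
  then have d24: "d y2 y4 = 2"
    using distance_2_exactly_one[OF y2(1) dp(2) no[OF y2 dp(1,2)] N2(1,2)] p d_commute[of y2 y3] by auto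
  have "d y6 y2 \<noteq> 2"
    using distance_2_exactly_one[OF y6(1) dp(1) no[OF y6 dp(3,1)] N1] N3(3) p d_commute[of y1 y6] by auto
  then have d25: "d y2 y5 = 2"
    using distance_2_exactly_one[OF y2(1) dp(3) no[OF y2 dp(1,3)] N3(1,2)] p d_commute[of y2 y6] by auto
  have distinct: "distinct [y1, y2, y3, y4, y5, y6]"
  proof -
    have "a \<noteq> b" if "adj p a" "adj p' b" "p \<noteq> p'" "d x a = 2" "d x p = 1" "d x p' = 1" for a b p p'
      using that no adj_sym by blast
    note neq = this[OF _ _ p(1) _ dp(1,2)] this[OF _ _ p(3) _ dp(1,3)] this[OF _ _ p(2) _ dp(2,3)]
    show ?thesis
      using N1(2) N2(2) N3(2) by (simp add: neq yp)
  qed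
  have nadj: "\<not> adj y1 p2" "\<not> adj y1 p3" "\<not> adj y2 p2" "\<not> adj y2 p3" "\<not> adj y3 p3" "\<not> adj y6 p2"
    by (rule no[OF y1 dp(1,2) p(1)] no[OF y1 dp(1,3) p(3)] no[OF y2 dp(1,2) p(1)]
        no[OF y2 dp(1,3) p(3)] no[OF y3 dp(2,3) p(2)] no[OF y6 dp(3,2) p(2)[symmetric]])+
  obtain r1 where r1: "d x r1 = 3" "adj y1 r1" "adj y3 r1"
    using common_neighbor_in_sphere_3[OF y1(1) y3(1) N2(3) dp(2) adj_sym[OF y3(2)] nadj(1)] by blast
  obtain r6 where r6: "d x r6 = 3" "adj y1 r6" "adj y6 r6"
    using common_neighbor_in_sphere_3[OF y1(1) y6(1) N3(3) dp(3) adj_sym[OF y6(2)] nadj(2)] by blast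
  obtain r4 where r4: "d x r4 = 3" "adj y2 r4" "adj y4 r4"
    using common_neighbor_in_sphere_3[OF y2(1) y4(1) d24 dp(2) adj_sym[OF y4(2)] nadj(3)] by blast
  obtain r3 where r3: "d x r3 = 3" "adj y2 r3" "adj y5 r3"
    using common_neighbor_in_sphere_3[OF y2(1) y5(1) d25 dp(3) adj_sym[OF y5(2)] nadj(4)] by blast
  have d36: "d y3 y6 \<noteq> 2"
  proof
    \<comment> \<open>Of the three common neighbors in a triangle, two are adjacent to the same vertex at
      distance 4 from x, which produces a 4-cycle.\<close>
    assume "d y3 y6 = 2"
    then obtain r where r: "d x r = 3" "adj y3 r" "adj y6 r"
      using common_neighbor_in_sphere_3[OF y3(1) y6(1) _ dp(3) adj_sym[OF y6(2)] nadj(5)] by blast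
    have "{u. adj r1 u \<and> d x u = 2} = {y1, y3}" "{u. adj r6 u \<and> d x u = 2} = {y1, y6}"
      "{u. adj r u \<and> d x u = 2} = {y3, y6}"
      by (rule lower_neighbors_eq; use distinct in \<open>simp add: r r1 r6 yp adj_sym\<close>)+
    then have ne: "r1 \<noteq> r6" "r1 \<noteq> r" "r6 \<noteq> r"
      using distinct by (auto simp: doubleton_eq_iff)
    obtain w w' where ww: "G 4 x = {w, w'}"
      using card_spheres(4)[of x] by (meson card_2_iff)
    have last: "adj w a \<or> adj w' a" if "d x a = 3" for a
      using last_neighbor[OF that] ww adj_sym unfolding gsphere_def
      by (metis (mono_tags) insertE mem_Collect_eq singletonD)
    have "d x w = 4" "d x w' = 4"
      using ww by (auto simp: gsphere_def)
    then have far: "w \<noteq> y1" "w' \<noteq> y1" "w \<noteq> y3" "w' \<noteq> y3" "w \<noteq> y6" "w' \<noteq> y6"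
      using yp by auto
    show False
      using last[OF r(1)] last[OF r1(1)] last[OF r6(1)] ne far
        common_neighbor_unique r r1 r6 by metis
  qed
  \<comment> \<open>Being linked to exactly one child of \<open>p3\<close>, \<open>y3\<close> is
    linked to \<open>y5\<close>; in the same way \<open>y6\<close> is linked to \<open>y4\<close>,
    which closes the hexagon.\<close>
  then have "d y3 y5 = 2"
    using distance_2_exactly_one[OF y3(1) dp(3) nadj(5) N3(1,2)] by blast
  then obtain r2 where r2: "d x r2 = 3" "adj y3 r2" "adj y5 r2"
    using common_neighbor_in_sphere_3[OF y3(1) y5(1) _ dp(3) adj_sym[OF y5(2)] nadj(5)] by blast
  have "d y6 y4 = 2"
    using distance_2_exactly_one[OF y6(1) dp(2) nadj(6) N2(1,2)] d36 d_commute[of y3 y6] by auto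
  then obtain r5 where r5: "d x r5 = 3" "adj y6 r5" "adj y4 r5"
    using common_neighbor_in_sphere_3[OF y6(1) y4(1) _ dp(2) adj_sym[OF y4(2)] nadj(6)] by blast
  have "{y1, y2, y3, y4, y5, y6} = G 2 x"
    using distinct yp card_spheres(2)[of x] by (intro card_subset_eq) (auto simp: gsphere_def)
  moreover have "common_neighbor_in adj (G 3 x) a b" if "d x r = 3" "adj a r" "adj b r" for a b r
    using that unfolding common_neighbor_in_def gsphere_def by auto
  moreover have "common_neighbor_in adj (G 1 x) a b" if "d x p = 1" "adj p a" "adj p b" for a b p
    using that adj_sym unfolding common_neighbor_in_def gsphere_def by auto
  ultimately have "pappus_ordering2 adj x [y1, y2, y3, y4, y5, y6]"
    unfolding pappus_ordering2_def sphere_ordering_def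
    using distinct yp dp r1 r2 r3 r4 r5 r6 by auto
  then show ?thesis ..
qed

lemma ordering1_exists: "\<exists>us. sphere_ordering adj x 1 us \<and> length us = 3"
proof -
  obtain us where "set us = G 1 x" "distinct us"
    using finite_distinct_list[of "G 1 x"] by auto
  then show ?thesis
    using card_spheres(1)[of x] distinct_card[of us] unfolding sphere_ordering_def by auto
qed

end

context pappus_labelled
begin

text \<open>Reduces an identity of vectors to 18 scalar equations that the simplifier can
  check.\<close>

lemma all_vertices_iff:
  "(\<forall>u. P u) \<longleftrightarrow> P x \<and> P p1 \<and> P p2 \<and> P p3 \<and> P y1 \<and> P y2 \<and> P y3 \<and> P y4 \<and> P y5 \<and>
    P y6 \<and> P q1 \<and> P q2 \<and> P q3 \<and> P q4 \<and> P q5 \<and> P q6 \<and> P w \<and> P w'"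
proof -
  have "(\<forall>u. P u) \<longleftrightarrow> (\<forall>u\<in>UNIV. P u)"
    by simp
  then show ?thesis
    by (simp only: all_vertices list.set ball_simps simp_thms)
qed

lemma spheres:
  "gsphere adj 1 x = {p1, p2, p3}" "gsphere adj 3 x = {q1, q2, q3, q4, q5, q6}"
  "gsphere adj 4 x = {w, w'}"
  unfolding gsphere_def set_eq_iff all_vertices_iff using distinct_vertices
  by (auto simp add: distances)

lemma ordering3_exists: "\<exists>zs. pappus_ordering3 adj x zs"
proof -
  have "w \<noteq> w' \<and> gsphere adj 4 x = {w, w'} \<and> {z. adj w z} = {q1, q3, q5} \<and> {z. adj w' z} = {q2, q4, q6}"
    using distinct_vertices by (simp add: spheres neighbors)
  \<comment> \<open>Positions 0, 3, 5 have to carry the neighbors \<open>q1\<close>,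
    \<open>q3\<close>, \<open>q5\<close> of \<open>w\<close>, and positions 1, 2, 4 those of
    \<open>w'\<close>.\<close>
  moreover have "distinct [q1, q2, q4, q3, q6, q5]" "set [q1, q2, q4, q3, q6, q5] = gsphere adj 3 x"
    using distinct_vertices by (auto simp: spheres)
  ultimately have "pappus_ordering3 adj x [q1, q2, q4, q3, q6, q5]"
    unfolding pappus_ordering3_def sphere_ordering_def
    by (intro conjI exI[of _ w] exI[of _ w']) simp_all
  then show ?thesis ..
qed

end

section \<open>Orthogonal families and matrices\<close>

text \<open>A subspace containing the other vectors contains their span. The criterion serves two
  vector spaces: for vectors, \<open>K\<close> is an orthogonal complement; for matrix units, the
  kernel of a matrix coefficient.\<close>

lemma (in vector_space) independent_if_separated:
  assumes "\<And>b. b \<in> B \<Longrightarrow> \<exists>K. subspace K \<and> B - {b} \<subseteq> K \<and> b \<notin> K"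
  shows "independent B"
  unfolding dependent_def using assms span_minimal by blast

lemma herm_inner_add_left: "herm_inner (u + u') v = herm_inner u v + herm_inner u' v"
  by (simp add: herm_inner_def algebra_simps sum.distrib)

lemma herm_inner_scale_left: "herm_inner (c *s u) v = c * herm_inner u v"
  by (simp add: herm_inner_def algebra_simps sum_distrib_left)

lemma herm_inner_zero_left [simp]: "herm_inner 0 v = 0"
  by (simp add: herm_inner_def)

lemma herm_inner_cnj: "herm_inner v u = cnj (herm_inner u v)"
  by (simp add: herm_inner_def mult.commute)

lemma herm_inner_commute_0: "herm_inner u u' = 0 \<Longrightarrow> herm_inner u' u = 0"
  using herm_inner_cnj[of u' u] by simp

lemma herm_inner_self_eq_0_iff: "herm_inner v v = 0 \<longleftrightarrow> v = (0 :: complex ^ 'v::finite)"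
proof -
  have "herm_inner v v = of_real (\<Sum>y\<in>UNIV. (norm (v $ y))\<^sup>2)"
    by (simp add: herm_inner_def complex_norm_square[symmetric])
  then have "herm_inner v v = 0 \<longleftrightarrow> (\<forall>y\<in>UNIV. (norm (v $ y))\<^sup>2 = 0)"
    by (simp only: of_real_eq_0_iff) (rule sum_nonneg_eq_0_iff, auto)
  then show ?thesis
    by (simp add: vec_eq_iff)
qed

lemma subspace_orthogonal: "vec.subspace {u :: complex ^ 'v::finite. herm_inner u v = 0}"
  by (rule vec.subspaceI) (auto simp: herm_inner_add_left herm_inner_scale_left)

lemma orthogonal_imp_independent:
  fixes g :: "'i \<Rightarrow> complex ^ 'v::finite"
  assumes "\<And>i. i \<in> J \<Longrightarrow> g i \<noteq> 0"
    and "\<And>i j. i \<in> J \<Longrightarrow> j \<in> J \<Longrightarrow> i \<noteq> j \<Longrightarrow> herm_inner (g i) (g j) = 0"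
  shows "inj_on g J" and "vec.independent (g ` J)"
proof -
  show "inj_on g J"
  proof (rule inj_onI)
    fix i j assume ij: "i \<in> J" "j \<in> J" "g i = g j"
    then have "herm_inner (g i) (g j) \<noteq> 0"
      by (simp add: assms(1) herm_inner_self_eq_0_iff)
    then show "i = j"
      using assms(2) ij by blast
  qed
  show "vec.independent (g ` J)"
  proof (rule vec.independent_if_separated)
    fix b assume "b \<in> g ` J"
    then obtain i where i: "i \<in> J" "b = g i"
      by auto
    then have "herm_inner b b \<noteq> 0"
      by (simp add: assms(1) herm_inner_self_eq_0_iff)
    moreover have "g ` J - {b} \<subseteq> {u. herm_inner u b = 0}"
      using i assms(2) by auto
    ultimately show "\<exists>K. vec.subspace K \<and> g ` J - {b} \<subseteq> K \<and> b \<notin> K"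
      using subspace_orthogonal[of b] by blast
  qed
qed

lemma orthogonal_span_UNIV:
  fixes g :: "'i \<Rightarrow> complex ^ 'v::finite"
  assumes "\<And>i. i \<in> J \<Longrightarrow> g i \<noteq> 0"
    and "\<And>i j. i \<in> J \<Longrightarrow> j \<in> J \<Longrightarrow> i \<noteq> j \<Longrightarrow> herm_inner (g i) (g j) = 0"
    and "card J = CARD('v)"
  shows "vec.span (g ` J) = UNIV"
proof -
  have ind: "inj_on g J" "vec.independent (g ` J)"
    by (rule orthogonal_imp_independent, fact assms(1), fact assms(2))+
  then have "card (g ` J) = CARD('v)"
    by (simp add: assms(3) card_image)
  then have "vec.dim (UNIV :: (complex ^ 'v) set) \<le> card (g ` J)"
    by (simp only: vec_dim_card)
  then have "UNIV \<subseteq> vec.span (g ` J)"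
    by (rule vec.card_ge_dim_independent[OF subset_UNIV ind(2)])
  then show ?thesis
    by auto
qed

lemma independent_family:
  fixes f :: "'i \<Rightarrow> complex ^ 'v::finite"
  assumes "finite J" "inj_on f J" "vec.independent (f ` J)" "(\<Sum>j\<in>J. c j *s f j) = 0" "j \<in> J"
  shows "c j = 0"
proof -
  \<comment> \<open>The coefficients are indexed by \<open>J\<close>, while independence of a set
    wants them attached to vectors; injectivity makes the transfer possible.\<close>
  let ?c = "c \<circ> the_inv_into J f"
  have "(\<Sum>b\<in>f ` J. ?c b *s b) = 0"
    using assms(2,4) by (simp add: sum.reindex the_inv_into_f_f)
  then have "?c (f j) = 0"
    using assms(3,5) unfolding vec.independent_explicit by blast
  then show ?thesis
    using assms(2,5) by (simp add: the_inv_into_f_f)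
qed

lemma span_family:
  fixes f :: "'i \<Rightarrow> complex ^ 'v::finite"
  assumes "finite J" "inj_on f J" "u \<in> vec.span (f ` J)"
  obtains c where "u = (\<Sum>j\<in>J. c j *s f j)"
proof -
  have "u \<in> range (\<lambda>c. \<Sum>b\<in>f ` J. c b *s b)"
    using assms(1,3) vec.span_finite[of "f ` J"] by auto
  then obtain c where "u = (\<Sum>b\<in>f ` J. c b *s b)"
    by blast
  then have "u = (\<Sum>j\<in>J. c (f j) *s f j)"
    using assms(2) by (simp add: sum.reindex)
  then show ?thesis
    by (rule that)
qed

lemma subspace_matrix_preimage:
  "vec.subspace W \<Longrightarrow> vec.subspace {v :: complex ^ 'v::finite. M *v v \<in> W}"
  by (rule vec.subspaceI)
    (auto simp: matrix_vector_right_distrib vector_scalar_commute vec.subspace_0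
      vec.subspace_add vec.subspace_scale)

lemma mat_scale_mult_vec: "mat_scale c M *v v = c *s (M *v v)"
  by (simp add: mat_scale_def map_matrix_def matrix_vector_mult_def vec_eq_iff sum_distrib_left
      mult.assoc)

lemma matrix_eq_on_spanning_set:
  fixes M N :: "complex ^ 'v::finite ^ 'v"
  assumes "vec.span B = UNIV" and "\<And>v. v \<in> B \<Longrightarrow> M *v v = N *v v"
  shows "M = N"
proof -
  have "vec.subspace {v. M *v v = N *v v}"
    by (rule vec.subspaceI) (auto simp: matrix_vector_right_distrib vector_scalar_commute)
  then have "vec.span B \<subseteq> {v. M *v v = N *v v}"
    using assms(2) by (intro vec.span_minimal) auto
  then show ?thesis
    using assms(1) by (auto simp: matrix_eq)
qed

lemma subalgebra_hull: "mat_subalgebra (mat_subalgebra hull G)"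
proof -
  have "mat_subalgebra (\<Inter>F)" if "\<forall>S\<in>F. mat_subalgebra S"
    for F :: "(complex ^ 'a ^ 'a) set set"
    using that unfolding mat_subalgebra_def by (auto intro!: cmat.subspace_Inter)
  then show ?thesis
    by (rule hull_in)
qed

section \<open>Decompositions described by matrix units\<close>

text \<open>A semisimple algebra in an adapted basis: \<open>s\<close> runs over the summands,
  \<open>ty s\<close> is an isomorphism type, and \<open>U t i j\<close> acts as the matrix unit at
  \<open>(i, j)\<close> on all summands of type \<open>t\<close> at once and as 0 on the others.
  Independence of the units will follow from their action.\<close>

locale matrix_units =
  fixes T :: "(complex ^ 'v::finite ^ 'v) set"
    and S :: "'s set" and ty :: "'s \<Rightarrow> 't" and I :: "'t \<Rightarrow> nat set"
    and v :: "'s \<Rightarrow> nat \<Rightarrow> complex ^ 'v"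
    and U :: "'t \<Rightarrow> nat \<Rightarrow> nat \<Rightarrow> complex ^ 'v ^ 'v"
  assumes finite_S: "finite S" and finite_I: "\<And>t. finite (I t)" and I_nonempty: "\<And>t. I t \<noteq> {}"
    and v_nonzero: "\<And>s i. s \<in> S \<Longrightarrow> i \<in> I (ty s) \<Longrightarrow> v s i \<noteq> 0"
    and v_orthogonal: "\<And>s i s' i'. s \<in> S \<Longrightarrow> i \<in> I (ty s) \<Longrightarrow> s' \<in> S \<Longrightarrow> i' \<in> I (ty s') \<Longrightarrow>
      (s, i) \<noteq> (s', i') \<Longrightarrow> herm_inner (v s i) (v s' i') = 0"
    and v_span: "vec.span {v s i | s i. s \<in> S \<and> i \<in> I (ty s)} = UNIV"
    and U_in: "\<And>t i j. t \<in> ty ` S \<Longrightarrow> i \<in> I t \<Longrightarrow> j \<in> I t \<Longrightarrow> U t i j \<in> T"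
    and U_act: "\<And>t i j s k. t \<in> ty ` S \<Longrightarrow> i \<in> I t \<Longrightarrow> j \<in> I t \<Longrightarrow> s \<in> S \<Longrightarrow> k \<in> I (ty s) \<Longrightarrow>
      U t i j *v v s k = (if t = ty s \<and> k = j then v s i else 0)"
    and T_span: "T \<subseteq> cmat.span {U t i j | t i j. t \<in> ty ` S \<and> i \<in> I t \<and> j \<in> I t}"
begin

abbreviation W :: "'s \<Rightarrow> (complex ^ 'v) set" where
  "W s \<equiv> vec.span (v s ` I (ty s))"

abbreviation units :: "(complex ^ 'v ^ 'v) set" where
  "units \<equiv> {U t i j | t i j. t \<in> ty ` S \<and> i \<in> I t \<and> j \<in> I t}"

section \<open>Irreducibility and orthogonality of the summands\<close>

lemma basis_orthogonal:
  assumes "s \<in> S"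
  shows "inj_on (v s) (I (ty s))" "vec.independent (v s ` I (ty s))"
  by (rule orthogonal_imp_independent; use assms v_nonzero v_orthogonal in blast)+

lemma dim_W: "s \<in> S \<Longrightarrow> vec.dim (W s) = card (I (ty s))"
  using basis_orthogonal[of s] by (simp add: vec.dim_eq_card_independent card_image)

text \<open>For a fixed \<open>u\<close> the matrices that send \<open>u\<close> into
  \<open>X\<close> form a subspace, so invariance passes from the units to their span, which
  contains \<open>T\<close>.\<close>

lemma is_module_if_units:
  assumes "vec.subspace X"
    and "\<And>t i j u. t \<in> ty ` S \<Longrightarrow> i \<in> I t \<Longrightarrow> j \<in> I t \<Longrightarrow> u \<in> X \<Longrightarrow> U t i j *v u \<in> X"
  shows "is_module T X"
  unfolding is_module_def
proof (intro conjI ballI)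
  fix B u assume "B \<in> T" "u \<in> X"
  have "cmat.subspace {B. B *v u \<in> X}"
    by (rule cmat.subspaceI)
      (auto simp: mat_scale_mult_vec matrix_vector_mult_add_rdistrib vec.subspace_0[OF assms(1)]
        vec.subspace_add[OF assms(1)] vec.subspace_scale[OF assms(1)])
  then have "cmat.span units \<subseteq> {B. B *v u \<in> X}"
    using assms(2) \<open>u \<in> X\<close> by (intro cmat.span_minimal) auto
  then show "B *v u \<in> X"
    using T_span \<open>B \<in> T\<close> by blast
qed (fact assms(1))

text \<open>The conditional span is the line of \<open>v s i\<close> for a matching type; otherwise
  it is \<open>{0}\<close>, as the span of the empty set.\<close>

lemma unit_W:
  assumes "s \<in> S" "t \<in> ty ` S" "i \<in> I t" "j \<in> I t" "u \<in> W s"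
  shows "U t i j *v u \<in> vec.span (if t = ty s then {v s i} else {})"
proof -
  let ?K = "vec.span (if t = ty s then {v s i} else {})"
  have "v s ` I (ty s) \<subseteq> {u. U t i j *v u \<in> ?K}"
    using assms by (auto simp: U_act vec.span_zero vec.span_base)
  then have "W s \<subseteq> {u. U t i j *v u \<in> ?K}"
    by (rule vec.span_minimal[OF _ subspace_matrix_preimage[OF vec.subspace_span]])
  then show ?thesis
    using assms(5) by blast
qed

lemma module_W:
  assumes "s \<in> S"
  shows "is_module T (W s)"
proof (rule is_module_if_units)
  fix t i j u assume *: "t \<in> ty ` S" "i \<in> I t" "j \<in> I t" "u \<in> W s"
  have "vec.span (if t = ty s then {v s i} else {}) \<subseteq> W s"
    using * by (intro vec.span_mono) auto
  then show "U t i j *v u \<in> W s"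
    using unit_W[OF assms *] by blast
qed (rule vec.subspace_span)

lemma W_expansion:
  assumes "s \<in> S" "u \<in> W s"
  obtains c where "u = (\<Sum>k\<in>I (ty s). c k *s v s k)"
  using span_family[OF finite_I basis_orthogonal(1)[OF assms(1)] assms(2)] that by blast

lemma unit_expansion:
  assumes "s \<in> S" "i \<in> I (ty s)" "j \<in> I (ty s)"
  shows "U (ty s) i j *v (\<Sum>k\<in>I (ty s). c k *s v s k) = c j *s v s i"
proof -
  have "U (ty s) i j *v (\<Sum>k\<in>I (ty s). c k *s v s k) =
      (\<Sum>k\<in>I (ty s). c k *s (U (ty s) i j *v v s k))"
    by (simp add: vec.linear_sum[OF matrix_vector_mul_linear_gen] vector_scalar_commute)
  also have "\<dots> = (\<Sum>k\<in>I (ty s). if k = j then c j *s v s i else 0)"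
    using assms by (intro sum.cong) (auto simp: U_act)
  finally show ?thesis
    using assms finite_I by simp
qed

text \<open>Pick a nonzero vector of the submodule and a nonzero coefficient \<open>c j\<close> of
  it. The unit at \<open>(i, j)\<close> turns the vector into \<open>c j *s v s i\<close>, so one
  vector already produces the whole basis.\<close>

lemma submodule_W:
  assumes "s \<in> S" "is_module T X" "X \<subseteq> W s" "X \<noteq> {0}"
  shows "X = W s"
proof -
  have X: "vec.subspace X"
    using assms(2) unfolding is_module_def by blast
  then obtain u where u: "u \<in> X" "u \<noteq> 0"
    using assms(4) vec.subspace_0 by blast
  then obtain c where c: "u = (\<Sum>k\<in>I (ty s). c k *s v s k)"
    using W_expansion assms by blast
  then obtain j where j: "j \<in> I (ty s)" "c j \<noteq> 0"
    using u(2) by (metis (mono_tags, lifting) sum.neutral vector_smult_lzero)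
  have "v s i \<in> X" if i: "i \<in> I (ty s)" for i
  proof -
    have "c j *s v s i \<in> X"
      using unit_expansion[OF assms(1) i j(1), of c] c U_in[of "ty s" i j] i j u(1) assms(1,2)
      unfolding is_module_def by (metis image_eqI)
    then have "inverse (c j) *s (c j *s v s i) \<in> X"
      using X vec.subspace_scale by blast
    then show ?thesis
      using j(2) by (simp add: vector_smult_assoc)
  qed
  then show ?thesis
    using assms(3) X by (intro equalityI vec.span_minimal) auto
qed

lemma irreducible_W:
  assumes "s \<in> S"
  shows "irreducible_module T (W s)"
proof -
  obtain i where "i \<in> I (ty s)"
    using I_nonempty by blast
  then have "v s i \<in> W s" "v s i \<noteq> 0"
    using assms v_nonzero by (auto intro: vec.span_base)
  then have "W s \<noteq> {0}"
    by blast
  then show ?thesis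
    unfolding irreducible_module_def using module_W submodule_W assms by blast
qed

lemma orthogonal_W:
  assumes "s \<in> S" "s' \<in> S" "s \<noteq> s'" "u \<in> W s" "u' \<in> W s'"
  shows "herm_inner u u' = 0"
proof -
  have "W s' \<subseteq> {u'. herm_inner u' (v s i) = 0}" if "i \<in> I (ty s)" for i
    using that assms v_orthogonal by (intro vec.span_minimal subspace_orthogonal) fastforce
  then have "herm_inner (v s i) u' = 0" if "i \<in> I (ty s)" for i
    using that assms(5) herm_inner_cnj[of "v s i" u'] by auto
  then have "W s \<subseteq> {u. herm_inner u u' = 0}"
    by (intro vec.span_minimal subspace_orthogonal) auto
  then show ?thesis
    using assms(4) by blast
qed

lemma decomposition_W:
  assumes "distinct ss" "set ss = S"
  shows "orthogonal_decomposition T (map W ss)"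
  unfolding orthogonal_decomposition_def
proof (intro conjI allI impI ballI)
  show "irreducible_module T X" if "X \<in> set (map W ss)" for X
    using that irreducible_W assms by auto
  show "herm_inner u u' = 0" if "i < length (map W ss)" "j < length (map W ss)" "i \<noteq> j"
    "u \<in> map W ss ! i" "u' \<in> map W ss ! j" for i j u u'
  proof (rule orthogonal_W)
    show "ss ! i \<in> S" "ss ! j \<in> S" "ss ! i \<noteq> ss ! j"
      using that assms by (auto simp: nth_eq_iff_index_eq)
  qed (use that in auto)
  have "{v s i | s i. s \<in> S \<and> i \<in> I (ty s)} \<subseteq> \<Union>(set (map W ss))"
    using assms by (auto intro!: bexI vec.span_base)
  then show "vec.span (\<Union>(set (map W ss))) = UNIV"
    using vec.span_mono v_span by blast
qed

text \<open>The modules isomorphic to \<open>W s\<close> are those on which a diagonal unit of its type acts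
  nontrivially.  The range of that unit is a line on each of them, and its total dimension does not
  depend on the decomposition.\<close>

lemma unit_mult:
  assumes "t \<in> ty ` S" "i \<in> I t" "l \<in> I t" "t' \<in> ty ` S" "k \<in> I t'" "j \<in> I t'"
  shows "U t i l ** U t' k j = (if t = t' \<and> l = k then U t i j else 0)"
proof (rule matrix_eq_on_spanning_set[OF v_span])
  fix b assume "b \<in> {v s i | s i. s \<in> S \<and> i \<in> I (ty s)}"
  then show "(U t i l ** U t' k j) *v b = (if t = t' \<and> l = k then U t i j else 0) *v b"
    using assms by (auto simp: U_act matrix_vector_mul_assoc[symmetric])
qed

text \<open>The map sending \<open>v s k\<close> to \<open>U (ty s) k j *v u\<close> commutes with
  all units by their multiplication table. Schur's argument does the rest: its kernel is a proper
  submodule of the irreducible \<open>W s\<close>, its image a nonzero submodule of the irreducible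
  \<open>X\<close>.\<close>

lemma iso_if_unit_nonzero:
  assumes s: "s \<in> S" and j: "j \<in> I (ty s)" and X: "irreducible_module T X"
    and u: "u \<in> X" "U (ty s) j j *v u = u" "u \<noteq> 0"
  shows "module_iso T (W s) X"
    and "u' \<in> X \<Longrightarrow> U (ty s) j j *v u' \<in> vec.span {u}"
proof -
  let ?t = "ty s"
  have t: "?t \<in> ty ` S"
    using s by blast
  \<comment> \<open>Linear extension prescribes values on vectors, so the index of a basis vector is
    recovered by \<open>the_inv_into\<close>.\<close>
  obtain f where lin: "Vector_Spaces.linear (*s) (*s) f"
    and "\<And>b. b \<in> v s ` I ?t \<Longrightarrow> f b = U ?t (the_inv_into (I ?t) (v s) b) j *v u"
    using vec.linear_independent_extend[OF basis_orthogonal(2)[OF s],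
        of "\<lambda>b. U ?t (the_inv_into (I ?t) (v s) b) j *v u"] by blast
  then have f_basis: "f (v s k) = U ?t k j *v u" if "k \<in> I ?t" for k
    using that by (simp add: the_inv_into_f_f basis_orthogonal(1)[OF s])
  have f_simps: "f (a + b) = f a + f b" "f (c *s a) = c *s f a" "f 0 = 0" for a b c
    using lin by (auto simp: vec.linear_add vec.linear_scale vec.linear_0)
  have subspace_X: "vec.subspace X"
    using X unfolding irreducible_module_def is_module_def by blast
  have mod_X: "B *v a \<in> X" if "B \<in> T" "a \<in> X" for B a
    using X that unfolding irreducible_module_def is_module_def by blast
  have commute_unit: "f (U t i l *v a) = U t i l *v f a"
    if "t \<in> ty ` S" "i \<in> I t" "l \<in> I t" "a \<in> W s" for t i l a
  proof -
    have "f (U t i l *v v s k) = U t i l *v f (v s k)" if k: "k \<in> I ?t" for k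
    proof -
      have "U t i l *v f (v s k) = (U t i l ** U ?t k j) *v u"
        using k by (simp add: f_basis matrix_vector_mul_assoc)
      also have "\<dots> = (if t = ?t \<and> l = k then U t i j *v u else 0)"
        using \<open>t \<in> ty ` S\<close> \<open>i \<in> I t\<close> \<open>l \<in> I t\<close> t k j by (simp add: unit_mult)
      also have "\<dots> = f (U t i l *v v s k)"
        using \<open>t \<in> ty ` S\<close> \<open>i \<in> I t\<close> \<open>l \<in> I t\<close> s k by (auto simp: U_act f_simps f_basis)
      finally show ?thesis ..
    qed
    moreover have "vec.subspace {a. f (U t i l *v a) = U t i l *v f a}"
      by (rule vec.subspaceI)
        (auto simp: f_simps matrix_vector_right_distrib vector_scalar_commute)
    ultimately have "W s \<subseteq> {a. f (U t i l *v a) = U t i l *v f a}"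
      by (intro vec.span_minimal) auto
    then show ?thesis
      using \<open>a \<in> W s\<close> by blast
  qed
  have commute: "f (B *v a) = B *v f a" if "B \<in> T" "a \<in> W s" for B a
  proof -
    have "cmat.subspace {B. f (B *v a) = B *v f a}"
      by (rule cmat.subspaceI)
        (auto simp: f_simps mat_scale_mult_vec matrix_vector_mult_add_rdistrib)
    then have "cmat.span units \<subseteq> {B. f (B *v a) = B *v f a}"
      using commute_unit that(2) by (intro cmat.span_minimal) auto
    then show ?thesis
      using T_span that(1) by blast
  qed
  have mod_W: "B *v a \<in> W s" if "B \<in> T" "a \<in> W s" for B a
    using module_W[OF s] that unfolding is_module_def by blast
  have "W s \<subseteq> {a. f a \<in> X}"
  proof (rule vec.span_minimal)
    show "v s ` I ?t \<subseteq> {a. f a \<in> X}"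
      using t j u(1) U_in mod_X by (auto simp: f_basis)
    show "vec.subspace {a. f a \<in> X}"
      by (rule vec.subspaceI) (auto simp: f_simps vec.subspace_0[OF subspace_X]
        vec.subspace_add[OF subspace_X] vec.subspace_scale[OF subspace_X])
  qed
  then have f_X: "f ` W s \<subseteq> X"
    by blast
  have v: "v s j \<in> W s" "f (v s j) = u"
    using j u(2) by (auto simp: f_basis intro: vec.span_base)
  have "is_module T {a \<in> W s. f a = 0}"
    unfolding is_module_def
    by (intro conjI vec.subspaceI)
      (auto simp: f_simps commute mod_W vec.span_zero vec.span_add vec.span_scale)
  then have kernel: "{a \<in> W s. f a = 0} = {0}"
    using submodule_W[OF s, of "{a \<in> W s. f a = 0}"] v u(3) by auto
  have "inj_on f (W s)"
  proof (rule inj_onI)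
    fix a b assume ab: "a \<in> W s" "b \<in> W s" "f a = f b"
    have "f (a + (-1) *s b) = 0"
      using ab(3) by (simp only: f_simps) simp
    moreover have "a + (-1) *s b \<in> W s"
      using ab by (intro vec.span_add vec.span_scale)
    ultimately have "a + (-1) *s b = 0"
      using kernel by blast
    then show "a = b"
      by (simp add: vec_eq_iff)
  qed
  have "is_module T (f ` W s)"
    unfolding is_module_def
  proof (intro conjI ballI)
    show "vec.subspace (f ` W s)"
      using vec.linear_subspace_image[OF lin] vec.subspace_span by blast
    show "B *v a \<in> f ` W s" if B: "B \<in> T" and "a \<in> f ` W s" for B a
    proof -
      obtain b where b: "b \<in> W s" "a = f b"
        using \<open>a \<in> f ` W s\<close> by blast
      then have "B *v a = f (B *v b)"
        using commute[OF B] by simp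
      then show ?thesis
        using mod_W[OF B b(1)] by blast
    qed
  qed
  moreover have "f ` W s \<noteq> {0}"
    using v u(3) by blast
  ultimately have image: "f ` W s = X"
    using X f_X unfolding irreducible_module_def by blast
  show "module_iso T (W s) X"
    unfolding module_iso_def bij_betw_def
    using \<open>inj_on f (W s)\<close> image f_simps commute by blast
  \<comment> \<open>On \<open>W s\<close> the unit has the line of \<open>v s j\<close> as its
    range, and the isomorphism carries this line to that of \<open>u\<close>.\<close>
  show "U (ty s) j j *v u' \<in> vec.span {u}" if u': "u' \<in> X"
  proof -
    obtain a where a: "a \<in> W s" "u' = f a"
      using u' image by blast
    obtain c where c: "U ?t j j *v a = c *s v s j"
      using unit_W[OF s t j j a(1)] by (auto simp: vec.span_singleton)
    have "U ?t j j *v u' = c *s u"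
      using commute_unit[OF t j j a(1)] a(2) c v(2) by (simp add: f_simps)
    then show ?thesis
      by (simp add: vec.span_base vec.span_scale)
  qed
qed

text \<open>The image of \<open>v s j\<close>, which the unit fixes, is the required vector.
  Linearity of the isomorphism is known only on \<open>W s\<close>, so its value at 0 is found by
  scaling with 0.\<close>

lemma iso_unit_nonzero:
  assumes s: "s \<in> S" and j: "j \<in> I (ty s)" and iso: "module_iso T (W s) X"
  obtains u where "u \<in> X" "U (ty s) j j *v u = u" "u \<noteq> 0"
proof -
  obtain f where f: "bij_betw f (W s) X" "\<And>c u. u \<in> W s \<Longrightarrow> f (c *s u) = c *s f u"
    "\<And>B u. B \<in> T \<Longrightarrow> u \<in> W s \<Longrightarrow> f (B *v u) = B *v f u"
    using iso unfolding module_iso_def by blast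
  have v: "v s j \<in> W s"
    using j by (auto intro: vec.span_base)
  have "f (v s j) \<in> X"
    using f(1) v by (auto simp: bij_betw_def)
  moreover have "U (ty s) j j *v f (v s j) = f (v s j)"
    using f(3)[OF U_in v, of "ty s" j j] s j by (simp add: U_act)
  moreover have "f (v s j) \<noteq> 0"
  proof
    assume "f (v s j) = 0"
    then have "f (v s j) = f 0"
      using f(2)[OF v, of 0] by simp
    then have "v s j = 0"
      using f(1) v vec.span_zero unfolding bij_betw_def by (blast dest: inj_onD)
    then show False
      using v_nonzero s j by blast
  qed
  ultimately show ?thesis
    by (rule that)
qed

lemma module_iso_iff:
  assumes "s \<in> S" "s' \<in> S"
  shows "module_iso T (W s) (W s') \<longleftrightarrow> ty s = ty s'"
proof -
  obtain j where j: "j \<in> I (ty s)"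
    using I_nonempty by blast
  show ?thesis
  proof
    assume "module_iso T (W s) (W s')"
    then obtain u where u: "u \<in> W s'" "U (ty s) j j *v u = u" "u \<noteq> 0"
      by (rule iso_unit_nonzero[OF assms(1) j])
    have "u \<in> vec.span (if ty s = ty s' then {v s' j} else {})"
      using unit_W[OF assms(2) _ j j u(1)] u(2) assms(1) by simp
    then show "ty s = ty s'"
      using u(3) by (auto split: if_splits)
  next
    assume eq: "ty s = ty s'"
    then have "U (ty s) j j *v v s' j = v s' j" "v s' j \<noteq> 0" "v s' j \<in> W s'"
      using j assms v_nonzero by (auto simp: U_act intro: vec.span_base)
    then show "module_iso T (W s) (W s')"
      by (intro iso_if_unit_nonzero(1)[OF assms(1) j irreducible_W[OF assms(2)]])
  qed
qed

lemma count_iso: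
  assumes s: "s \<in> S" and j: "j \<in> I (ty s)" and dec: "orthogonal_decomposition T Ws"
  shows "length (filter (module_iso T (W s)) Ws) = vec.dim (range ((*v) (U (ty s) j j)))"
proof -
  let ?P = "U (ty s) j j"
  let ?J = "{k. k < length Ws \<and> module_iso T (W s) (Ws ! k)}"
  have t: "ty s \<in> ty ` S"
    using s by blast
  have irr: "irreducible_module T (Ws ! k)" if "k < length Ws" for k
    using dec that unfolding orthogonal_decomposition_def by simp
  \<comment> \<open>One fixed vector of the unit is chosen in each summand isomorphic to
    \<open>W s\<close>; these vectors turn out to be a basis of the range.\<close>
  have "\<forall>k\<in>?J. \<exists>u. u \<in> Ws ! k \<and> ?P *v u = u \<and> u \<noteq> 0"
    using iso_unit_nonzero[OF s j] by blast
  then obtain g where g: "\<And>k. k \<in> ?J \<Longrightarrow> g k \<in> Ws ! k \<and> ?P *v g k = g k \<and> g k \<noteq> 0"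
    by metis
  have orth: "herm_inner (g k) (g l) = 0" if "k \<in> ?J" "l \<in> ?J" "k \<noteq> l" for k l
    using that g dec unfolding orthogonal_decomposition_def by blast
  have ind: "inj_on g ?J" "vec.independent (g ` ?J)"
    by (rule orthogonal_imp_independent; use g orth in blast)+
  have "?P *v u \<in> vec.span (g ` ?J)" if k: "k < length Ws" and u: "u \<in> Ws ! k" for k u
  proof (cases "module_iso T (W s) (Ws ! k)")
    case True
    then have "k \<in> ?J"
      using k by blast
    then have "?P *v u \<in> vec.span {g k}"
      using iso_if_unit_nonzero(2)[OF s j irr[OF k]] g u by blast
    also have "\<dots> \<subseteq> vec.span (g ` ?J)"
      using \<open>k \<in> ?J\<close> by (intro vec.span_mono) blast
    finally show ?thesis .
  next
    case False
    \<comment> \<open>The unit is idempotent, so \<open>?P *v u\<close> is fixed by it; were it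
      nonzero, the summand would be isomorphic to \<open>W s\<close>.\<close>
    have "?P *v u \<in> Ws ! k"
      using irr[OF k] u U_in[OF t j j] unfolding irreducible_module_def is_module_def by blast
    moreover have "?P *v (?P *v u) = ?P *v u"
      using t j by (simp add: matrix_vector_mul_assoc unit_mult)
    ultimately have "?P *v u = 0"
      using False iso_if_unit_nonzero(1)[OF s j irr[OF k]] by blast
    then show ?thesis
      by (simp add: vec.span_zero)
  qed
  then have "\<Union>(set Ws) \<subseteq> {u. ?P *v u \<in> vec.span (g ` ?J)}"
    by (auto simp: in_set_conv_nth)
  then have "vec.span (\<Union>(set Ws)) \<subseteq> {u. ?P *v u \<in> vec.span (g ` ?J)}"
    by (intro vec.span_minimal subspace_matrix_preimage vec.subspace_span)
  then have "range ((*v) ?P) \<subseteq> vec.span (g ` ?J)"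
    using dec unfolding orthogonal_decomposition_def by blast
  moreover have "g ` ?J \<subseteq> range ((*v) ?P)"
    using g by (metis (mono_tags, lifting) image_subsetI rangeI)
  ultimately have "vec.dim (range ((*v) ?P)) = card (g ` ?J)"
    using ind(2) by (intro vec.dim_unique[of "g ` ?J"]) auto
  also have "\<dots> = length (filter (module_iso T (W s)) Ws)"
    using ind(1) by (simp add: card_image length_filter_conv_card)
  finally show ?thesis ..
qed

lemma multiplicity_W:
  assumes s: "s \<in> S"
  shows "module_multiplicity T (W s) = card {s' \<in> S. ty s' = ty s}"
proof -
  obtain j where j: "j \<in> I (ty s)"
    using I_nonempty by blast
  obtain ss where ss: "distinct ss" "set ss = S"
    using finite_distinct_list[OF finite_S] by blast
  note dec = decomposition_W[OF ss]
  \<comment> \<open>The decomposition at hand gives existence, and the rank of the unit gives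
    uniqueness of the number described by \<open>THE\<close>.\<close>
  have "module_multiplicity T (W s) = vec.dim (range ((*v) (U (ty s) j j)))"
    unfolding module_multiplicity_def
    using dec count_iso[OF s j] by (intro the_equality) metis+
  also have "\<dots> = length (filter (module_iso T (W s)) (map W ss))"
    using count_iso[OF s j dec] ..
  also have "\<dots> = length (filter (\<lambda>s'. ty s' = ty s) ss)"
  proof -
    have "filter (module_iso T (W s) \<circ> W) ss = filter (\<lambda>s'. ty s' = ty s) ss"
      using s ss(2) by (intro filter_cong) (auto simp: module_iso_iff)
    then show ?thesis
      by (simp add: filter_map)
  qed
  also have "\<dots> = card {s' \<in> S. ty s' = ty s}"
    using ss by (metis distinct_card distinct_filter set_filter)
  finally show ?thesis .
qed

lemma dim_T:
  assumes "cmat.subspace T"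
  shows "cmat.dim T = (\<Sum>t\<in>ty ` S. (card (I t))\<^sup>2)"
proof -
  let ?J = "SIGMA t:ty ` S. I t \<times> I t"
  let ?U = "\<lambda>(t, i, j). U t i j"
  have *: "\<exists>K. cmat.subspace K \<and> (\<forall>b\<in>?J - {a}. ?U b \<in> K) \<and> ?U a \<notin> K" if "a \<in> ?J" for a
  proof -
    obtain s i j where a: "a = (ty s, i, j)" "s \<in> S" "i \<in> I (ty s)" "j \<in> I (ty s)"
      using \<open>a \<in> ?J\<close> by auto
    \<comment> \<open>This matrix coefficient vanishes on all units except
      \<open>U (ty s) i j\<close>: any other one maps \<open>v s j\<close> to 0 or to a basis vector
      orthogonal to \<open>v s i\<close>.\<close>
    let ?K = "{M. herm_inner (M *v v s j) (v s i) = 0}"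
    have "cmat.subspace ?K"
      by (rule cmat.subspaceI)
        (auto simp: mat_scale_mult_vec matrix_vector_mult_add_rdistrib herm_inner_add_left
          herm_inner_scale_left)
    moreover have "?U b \<in> ?K" if "b \<in> ?J - {a}" for b
      using that a by (auto simp: U_act split: if_splits intro!: v_orthogonal)
    moreover have "?U a \<notin> ?K"
      using a by (simp add: U_act v_nonzero herm_inner_self_eq_0_iff)
    ultimately show ?thesis
      by blast
  qed
  have inj: "inj_on ?U ?J"
  proof (rule inj_onI)
    fix a b assume ab: "a \<in> ?J" "b \<in> ?J" "?U a = ?U b"
    obtain K where K: "\<forall>b\<in>?J - {a}. ?U b \<in> K" "?U a \<notin> K"
      using *[OF ab(1)] by blast
    show "a = b"
    proof (rule ccontr)
      assume "a \<noteq> b"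
      then have "?U b \<in> K"
        using K(1) ab(2) by blast
      then show False
        using K(2) ab(3) by metis
    qed
  qed
  have ind: "cmat.independent (?U ` ?J)"
  proof (rule cmat.independent_if_separated)
    fix b assume "b \<in> ?U ` ?J"
    then obtain a where a: "a \<in> ?J" "b = ?U a"
      by blast
    obtain K where K: "cmat.subspace K" "\<forall>b\<in>?J - {a}. ?U b \<in> K" "?U a \<notin> K"
      using *[OF a(1)] by blast
    have "?U ` ?J - {b} \<subseteq> ?U ` (?J - {a})"
      unfolding a(2) by (rule image_diff_subset[of ?U ?J "{a}", simplified image_insert image_empty])
    also have "\<dots> \<subseteq> K"
      using K(2) unfolding image_subset_iff .
    finally have "?U ` ?J - {b} \<subseteq> K" .
    moreover have "b \<notin> K"
      unfolding a(2) by (rule K(3))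
    ultimately show "\<exists>K. cmat.subspace K \<and> ?U ` ?J - {b} \<subseteq> K \<and> b \<notin> K"
      by (intro exI[of _ K] conjI K(1))
  qed
  have units: "units = ?U ` ?J"
    by force
  have "cmat.span units \<subseteq> T"
    using assms U_in by (intro cmat.span_minimal) auto
  then have "T = cmat.span (?U ` ?J)"
    using T_span unfolding units by (intro equalityI)
  then have "cmat.dim T = card (?U ` ?J)"
    by (simp only: cmat.dim_span_eq_card_independent[OF ind])
  also have "\<dots> = card ?J"
    using inj by (rule card_image)
  also have "\<dots> = (\<Sum>t\<in>ty ` S. (card (I t))\<^sup>2)"
    using finite_S finite_I by (simp add: card_cartesian_product power2_eq_square)
  finally show ?thesis .
qed

end

section \<open>Thin modules\<close>

lemma sum_matrix_vector_mult:
  "(\<Sum>a\<in>A. M a) *v u = (\<Sum>a\<in>A. M a *v (u :: complex ^ 'v::finite))"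
  by (induction A rule: infinite_finite_induct) (auto simp: matrix_vector_mult_add_rdistrib)

lemma matrix_vector_mult_sum:
  "M *v (\<Sum>a\<in>A. u a) = (\<Sum>a\<in>A. M *v (u a :: complex ^ 'v::finite))"
  by (induction A rule: infinite_finite_induct) (auto simp: matrix_vector_right_distrib)

lemma Estar_nth: "(Estar adj x i *v u) $ y = (if gdist adj x y = i then u $ y else 0)"
  by (simp add: Estar_def matrix_vector_mult_def if_distrib[of "\<lambda>a. a * _"] sum.delta cong: if_cong)

lemma herm_inner_layers:
  assumes "Estar adj x i *v u = u" "Estar adj x j *v u' = u'" "i \<noteq> j"
  shows "herm_inner u u' = 0"
proof -
  have "u $ y * cnj (u' $ y) = 0" for y
    using assms Estar_nth[of adj x i u y] Estar_nth[of adj x j u' y] by (auto split: if_splits)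
  then show ?thesis
    by (simp add: herm_inner_def)
qed

text \<open>Spreads a known unit over the layers of its type. The starting layer is the first one
  for type II and the last one for types IV and V, so both directions occur.\<close>

lemma interval_propagation:
  assumes "i \<in> {l..h::nat}" "P i"
    and "\<And>a b. P a \<Longrightarrow> a \<in> {l..h} \<Longrightarrow> b \<in> {l..h} \<Longrightarrow> b = Suc a \<or> a = Suc b \<Longrightarrow> P b"
    and "j \<in> {l..h}"
  shows "P j"
proof (cases "i \<le> j")
  case True
  then show ?thesis
    using assms(4)
  proof (induction j rule: dec_induct)
    case (step n)
    then show ?case
      using assms(1) assms(3)[of n "Suc n"] by auto
  qed (use assms(2) in simp)
next
  case False
  then have "j \<le> i"
    by simp
  then show ?thesis
    using assms(4)
  proof (induction j rule: inc_induct)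
    case (step n)
    then show ?case
      using assms(1) assms(3)[of "Suc n" n] by auto
  qed (use assms(2) in simp)
qed

text \<open>\<open>v s i\<close> spans layer \<open>i\<close> of summand \<open>s\<close>, and \<open>rank\<close> orders the types so that
  each of them has a layer in which it is the only one of maximal rank.\<close>

locale thin_modules =
  fixes adj :: "'v::finite \<Rightarrow> 'v \<Rightarrow> bool" and x :: 'v
    and S :: "'s set" and ty :: "'s \<Rightarrow> 't" and lo hi :: "'t \<Rightarrow> nat"
    and v :: "'s \<Rightarrow> nat \<Rightarrow> complex ^ 'v" and up dn :: "'t \<Rightarrow> nat \<Rightarrow> complex"
    and rank :: "'t \<Rightarrow> nat"
  assumes finite_S: "finite S" and lo_le_hi: "\<And>t. lo t \<le> hi t"
    and hi_le: "\<And>s. s \<in> S \<Longrightarrow> hi (ty s) \<le> gdiameter adj"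
    and v_nonzero: "\<And>s i. s \<in> S \<Longrightarrow> i \<in> {lo (ty s)..hi (ty s)} \<Longrightarrow> v s i \<noteq> 0"
    and v_pure: "\<And>s i. s \<in> S \<Longrightarrow> i \<in> {lo (ty s)..hi (ty s)} \<Longrightarrow> Estar adj x i *v v s i = v s i"
    and v_orthogonal: "\<And>s s' i. s \<in> S \<Longrightarrow> s' \<in> S \<Longrightarrow> s \<noteq> s' \<Longrightarrow>
      i \<in> {lo (ty s)..hi (ty s)} \<Longrightarrow> i \<in> {lo (ty s')..hi (ty s')} \<Longrightarrow> herm_inner (v s i) (v s' i) = 0"
    and card_vertices: "CARD('v) = (\<Sum>s\<in>S. Suc (hi (ty s) - lo (ty s)))"
    and A_act: "\<And>s i. s \<in> S \<Longrightarrow> i \<in> {lo (ty s)..hi (ty s)} \<Longrightarrow>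
      adjacency_matrix adj *v v s i = up (ty s) i *s v s (Suc i) + dn (ty s) i *s v s (i - 1)"
    and up_hi: "\<And>t. up t (hi t) = 0" and dn_lo: "\<And>t. dn t (lo t) = 0"
    and up_nonzero: "\<And>t i. t \<in> ty ` S \<Longrightarrow> lo t \<le> i \<Longrightarrow> i < hi t \<Longrightarrow> up t i \<noteq> 0"
    and dn_nonzero: "\<And>t i. t \<in> ty ` S \<Longrightarrow> lo t < i \<Longrightarrow> i \<le> hi t \<Longrightarrow> dn t i \<noteq> 0"
    and separated: "\<And>t. t \<in> ty ` S \<Longrightarrow>
      \<exists>i\<in>{lo t..hi t}. \<forall>t'\<in>ty ` S. t' \<noteq> t \<longrightarrow> i \<in> {lo t'..hi t'} \<longrightarrow> rank t' < rank t"
begin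

abbreviation I :: "'t \<Rightarrow> nat set" where "I t \<equiv> {lo t..hi t}"

abbreviation A :: "complex ^ 'v ^ 'v" where "A \<equiv> adjacency_matrix adj"

abbreviation E :: "nat \<Rightarrow> complex ^ 'v ^ 'v" where "E \<equiv> Estar adj x"

abbreviation T :: "(complex ^ 'v ^ 'v) set" where "T \<equiv> terwilliger adj x"

lemma T_subalgebra: "mat_subalgebra T"
  unfolding terwilliger_def by (rule subalgebra_hull)

lemma T_mult: "M \<in> T \<Longrightarrow> M' \<in> T \<Longrightarrow> M ** M' \<in> T"
  and T_subspace: "cmat.subspace T"
  using T_subalgebra unfolding mat_subalgebra_def by auto

lemma A_in_T: "A \<in> T"
  unfolding terwilliger_def by (auto intro: hull_inc)

lemma E_in_T: "i \<le> gdiameter adj \<Longrightarrow> E i \<in> T"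
  unfolding terwilliger_def by (auto intro: hull_inc)

lemma E_act:
  assumes "s \<in> S" "i \<in> I (ty s)"
  shows "E j *v v s i = (if i = j then v s i else 0)"
proof (cases "i = j")
  case False
  have "(E j *v (E i *v v s i)) = 0"
    using False by (simp add: vec_eq_iff Estar_nth)
  then show ?thesis
    using False v_pure[OF assms] by simp
qed (use v_pure assms in simp)

lemma v_orth:
  assumes "s \<in> S" "i \<in> I (ty s)" "s' \<in> S" "i' \<in> I (ty s')" "(s, i) \<noteq> (s', i')"
  shows "herm_inner (v s i) (v s' i') = 0"
  using assms v_orthogonal herm_inner_layers v_pure by (cases "i = i'") blast+

lemma v_span: "vec.span {v s i | s i. s \<in> S \<and> i \<in> I (ty s)} = UNIV"
proof -
  let ?J = "SIGMA s:S. I (ty s)"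
  have "card ?J = CARD('v)"
    using finite_S lo_le_hi by (simp add: card_vertices Suc_diff_le)
  then have "vec.span ((\<lambda>(s, i). v s i) ` ?J) = UNIV"
    by (intro orthogonal_span_UNIV) (auto simp: v_nonzero intro!: v_orth)
  moreover have "(\<lambda>(s, i). v s i) ` ?J = {v s i | s i. s \<in> S \<and> i \<in> I (ty s)}"
    by force
  ultimately show ?thesis
    by simp
qed

text \<open>A predicate, because the matrix must first be found inside \<open>T\<close>. Its action
  determines it, as the vectors \<open>v s k\<close> span the whole space.\<close>

definition is_unit :: "'t \<Rightarrow> nat \<Rightarrow> nat \<Rightarrow> complex ^ 'v ^ 'v \<Rightarrow> bool" where
  "is_unit t i j M \<longleftrightarrow> M \<in> T \<and>
     (\<forall>s\<in>S. \<forall>k\<in>I (ty s). M *v v s k = (if t = ty s \<and> k = j then v s i else 0))"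

lemma is_unit_scaled:
  assumes "M \<in> T" "c \<noteq> 0"
    and "\<And>s k. s \<in> S \<Longrightarrow> k \<in> I (ty s) \<Longrightarrow> M *v v s k = (if t = ty s \<and> k = j then c *s v s i else 0)"
  shows "is_unit t i j (mat_scale (inverse c) M)"
  using assms cmat.subspace_scale[OF T_subspace]
  by (auto simp: is_unit_def mat_scale_mult_vec vector_smult_assoc)

text \<open>\<open>A\<close> moves \<open>v s i\<close> to its two neighbors in the chain and
  \<open>E i'\<close> keeps one of them, with a nonzero scalar that is divided out.\<close>

lemma unit_left_step:
  assumes t: "t \<in> ty ` S" and M: "is_unit t i j M" and i: "i \<in> I t" and i': "i' \<in> I t"
    and step: "i' = Suc i \<or> i = Suc i'"
  shows "\<exists>M. is_unit t i' j M"
proof -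
  let ?c = "if i' = Suc i then up t i else dn t i"
  have "i' \<le> gdiameter adj"
    using hi_le t i' by fastforce
  then have "E i' ** (A ** M) \<in> T"
    using M unfolding is_unit_def by (intro T_mult E_in_T A_in_T) auto
  moreover have "?c \<noteq> 0"
    using step up_nonzero[OF t, of i] dn_nonzero[OF t, of i] i i' by auto
  moreover have "(E i' ** (A ** M)) *v v s k = (if t = ty s \<and> k = j then ?c *s v s i' else 0)"
    if s: "s \<in> S" "k \<in> I (ty s)" for s k
  proof (cases "t = ty s \<and> k = j")
    case True
    \<comment> \<open>At the ends of a chain the index leaves the interval, where nothing is known
      about \<open>v\<close>; there the coefficient is 0.\<close>
    have upper: "up t i *s (E i' *v v s (Suc i)) = (if i' = Suc i then up t i *s v s i' else 0)"
      using E_act[OF s(1), of "Suc i" i'] True i up_hi[of t] by (cases "i = hi t") auto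
    have lower: "dn t i *s (E i' *v v s (i - 1)) = (if i = Suc i' then dn t i *s v s i' else 0)"
    proof (cases "i = lo t")
      case True
      then show ?thesis
        using dn_lo[of t] i' by auto
    next
      case False
      then have "i - 1 \<in> I (ty s)" "i = Suc i' \<longleftrightarrow> i - 1 = i'"
        using True i by auto
      then show ?thesis
        using E_act[OF s(1), of "i - 1" i'] by simp
    qed
    have "(E i' ** (A ** M)) *v v s k = E i' *v (A *v v s i)"
      using M s True unfolding is_unit_def by (simp add: matrix_vector_mul_assoc[symmetric])
    also have "\<dots> = up t i *s (E i' *v v s (Suc i)) + dn t i *s (E i' *v v s (i - 1))"
      using A_act[OF s(1), of i] i True
      by (simp add: matrix_vector_right_distrib vector_scalar_commute)
    also have "\<dots> = ?c *s v s i'"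
      unfolding upper lower using step by auto
    finally show ?thesis
      using True by simp
  next
    case False
    then show ?thesis
      using M s unfolding is_unit_def by (auto simp: matrix_vector_mul_assoc[symmetric])
  qed
  ultimately show ?thesis
    using is_unit_scaled[of "E i' ** (A ** M)" ?c t j i'] by blast
qed

text \<open>\<open>A\<close> is applied before \<open>M\<close>, so the scalar is a coefficient at
  the new index \<open>j'\<close>: from there, one step down or up leads back to
  \<open>j\<close>.\<close>

lemma unit_right_step:
  assumes t: "t \<in> ty ` S" and M: "is_unit t i j M" and j: "j \<in> I t" and j': "j' \<in> I t"
    and step: "j' = Suc j \<or> j = Suc j'"
  shows "\<exists>M. is_unit t i j' M"
proof -
  let ?c = "if j' = Suc j then dn t j' else up t j'"
  have "j' \<le> gdiameter adj"
    using hi_le t j' by fastforce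
  then have "M ** (A ** E j') \<in> T"
    using M unfolding is_unit_def by (intro T_mult E_in_T A_in_T) auto
  moreover have "?c \<noteq> 0"
    using step up_nonzero[OF t, of j'] dn_nonzero[OF t, of j'] j j' by auto
  moreover have "(M ** (A ** E j')) *v v s k = (if t = ty s \<and> k = j' then ?c *s v s i else 0)"
    if s: "s \<in> S" "k \<in> I (ty s)" for s k
  proof (cases "k = j'")
    case True
    have M_act: "M *v v s l = (if t = ty s \<and> l = j then v s i else 0)" if "l \<in> I (ty s)" for l
      using M s(1) that unfolding is_unit_def by blast
    have upper: "up (ty s) j' *s (M *v v s (Suc j')) =
        (if t = ty s \<and> j = Suc j' then up (ty s) j' *s v s i else 0)"
      using M_act[of "Suc j'"] True s(2) j up_hi[of "ty s"] by (cases "j' = hi (ty s)") auto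
    have lower: "dn (ty s) j' *s (M *v v s (j' - 1)) =
        (if t = ty s \<and> j' = Suc j then dn (ty s) j' *s v s i else 0)"
    proof (cases "j' = lo (ty s)")
      case True
      then show ?thesis
        using dn_lo[of "ty s"] j by auto
    next
      case False
      then have "j' - 1 \<in> I (ty s)" "j' = Suc j \<longleftrightarrow> j' - 1 = j"
        using True s(2) by auto
      then show ?thesis
        using M_act[of "j' - 1"] by simp
    qed
    have "(M ** (A ** E j')) *v v s k = M *v (A *v v s j')"
      using E_act[OF s, of j'] True by (simp add: matrix_vector_mul_assoc[symmetric])
    also have "\<dots> = up (ty s) j' *s (M *v v s (Suc j')) + dn (ty s) j' *s (M *v v s (j' - 1))"
      using A_act[OF s] True by (simp add: matrix_vector_right_distrib vector_scalar_commute)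
    also have "\<dots> = (if t = ty s then ?c *s v s i else 0)"
      unfolding upper lower using step by auto
    finally show ?thesis
      using True by simp
  next
    case False
    then show ?thesis
      using E_act[OF s, of j'] by (simp add: matrix_vector_mul_assoc[symmetric])
  qed
  ultimately show ?thesis
    using is_unit_scaled[of "M ** (A ** E j')" ?c t j' i] by blast
qed

lemma units_from_diagonal:
  assumes "t \<in> ty ` S" "l \<in> I t" "is_unit t l l M" "i \<in> I t" "j \<in> I t"
  shows "\<exists>M. is_unit t i j M"
proof -
  have "\<exists>M. is_unit t i l M"
    by (rule interval_propagation[OF assms(2), where P = "\<lambda>i. \<exists>M. is_unit t i l M"])
      (use assms unit_left_step[OF assms(1)] in blast)+
  then show ?thesis
    by (rule interval_propagation[OF assms(2), where P = "\<lambda>j. \<exists>M. is_unit t i j M"])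
      (use assms unit_right_step[OF assms(1)] in blast)+
qed

text \<open>A diagonal unit of a type is what remains of \<open>E i\<close> after subtracting the units of the
  other types meeting layer \<open>i\<close>.\<close>

lemma units_exist:
  assumes "t \<in> ty ` S" "i \<in> I t" "j \<in> I t"
  shows "\<exists>M. is_unit t i j M"
  using assms
proof (induction "rank t" arbitrary: t i j rule: less_induct)
  case less
  obtain l where l: "l \<in> I t"
    and rank: "\<And>t'. t' \<in> ty ` S \<Longrightarrow> t' \<noteq> t \<Longrightarrow> l \<in> I t' \<Longrightarrow> rank t' < rank t"
    using separated[OF less.prems(1)] by blast
  let ?R = "{t' \<in> ty ` S. t' \<noteq> t \<and> l \<in> I t'}"
  \<comment> \<open>All other types in layer \<open>l\<close> have smaller rank, so their units are
    available by induction.\<close>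
  have "\<forall>t'\<in>?R. \<exists>M. is_unit t' l l M"
    using less.hyps rank by blast
  then obtain P where P: "\<forall>t'\<in>?R. is_unit t' l l (P t')"
    by (rule bchoice[THEN exE])
  let ?M = "E l - (\<Sum>t'\<in>?R. P t')"
  have "l \<le> gdiameter adj"
    using hi_le less.prems(1) l by fastforce
  then have "?M \<in> T"
    using P unfolding is_unit_def
    by (intro cmat.subspace_diff[OF T_subspace] cmat.subspace_sum[OF T_subspace] E_in_T) auto
  moreover have "?M *v v s k = (if t = ty s \<and> k = l then v s l else 0)"
    if s: "s \<in> S" "k \<in> I (ty s)" for s k
  proof -
    have "(\<Sum>t'\<in>?R. P t') *v v s k = (\<Sum>t'\<in>?R. P t' *v v s k)"
      by (rule sum_matrix_vector_mult)
    also have "\<dots> = (\<Sum>t'\<in>?R. if t' = ty s then (if k = l then v s l else 0) else 0)"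
      using P s unfolding is_unit_def by (intro sum.cong) auto
    also have "\<dots> = (if ty s \<in> ?R \<and> k = l then v s l else 0)"
      using finite_S by (simp add: sum.delta)
    finally show ?thesis
      using E_act[OF s, of l] s by (auto simp: matrix_vector_mult_diff_rdistrib)
  qed
  ultimately have "is_unit t l l ?M"
    unfolding is_unit_def by blast
  then show ?case
    using units_from_diagonal[OF less.prems(1) l] less.prems by blast
qed

definition U :: "'t \<Rightarrow> nat \<Rightarrow> nat \<Rightarrow> complex ^ 'v ^ 'v" where
  "U t i j = (SOME M. is_unit t i j M)"

lemma is_unit_U: "t \<in> ty ` S \<Longrightarrow> i \<in> I t \<Longrightarrow> j \<in> I t \<Longrightarrow> is_unit t i j (U t i j)"
  unfolding U_def by (rule someI_ex) (rule units_exist)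

text \<open>An upper bound for \<open>T\<close>: the generators lie here, with coefficients
  depending on the type alone, and so does everything they generate. The units give the lower
  bound.\<close>

definition blockwise :: "(complex ^ 'v ^ 'v) set" where
  "blockwise = {M. \<exists>m. \<forall>s\<in>S. \<forall>k\<in>I (ty s). M *v v s k = (\<Sum>i\<in>I (ty s). m (ty s) i k *s v s i)}"

lemma blockwiseI:
  assumes "\<And>s k. s \<in> S \<Longrightarrow> k \<in> I (ty s) \<Longrightarrow> M *v v s k = (\<Sum>i\<in>I (ty s). m (ty s) i k *s v s i)"
  shows "M \<in> blockwise"
  using assms unfolding blockwise_def by blast

lemma blockwiseE:
  assumes "M \<in> blockwise"
  obtains m where "\<And>s k. s \<in> S \<Longrightarrow> k \<in> I (ty s) \<Longrightarrow>
    M *v v s k = (\<Sum>i\<in>I (ty s). m (ty s) i k *s v s i)"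
  using assms unfolding blockwise_def by blast

lemma blockwise_subalgebra: "mat_subalgebra blockwise"
  unfolding mat_subalgebra_def
proof (intro conjI ballI cmat.subspaceI)
  show "0 \<in> blockwise"
    by (rule blockwiseI[where m = "\<lambda>_ _ _. 0"]) simp
  show "M + N \<in> blockwise" if M: "M \<in> blockwise" and N: "N \<in> blockwise" for M N
  proof -
    obtain m where m: "\<And>s k. s \<in> S \<Longrightarrow> k \<in> I (ty s) \<Longrightarrow> M *v v s k = (\<Sum>i\<in>I (ty s). m (ty s) i k *s v s i)"
      using blockwiseE[OF M] by blast
    obtain n where n: "\<And>s k. s \<in> S \<Longrightarrow> k \<in> I (ty s) \<Longrightarrow> N *v v s k = (\<Sum>i\<in>I (ty s). n (ty s) i k *s v s i)"
      using blockwiseE[OF N] by blast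
    show ?thesis
      by (rule blockwiseI[where m = "\<lambda>t i k. m t i k + n t i k"])
        (simp add: m n matrix_vector_mult_add_rdistrib vector_sadd_rdistrib sum.distrib)
  qed
  show "mat_scale c M \<in> blockwise" if M: "M \<in> blockwise" for c M
  proof -
    obtain m where m: "\<And>s k. s \<in> S \<Longrightarrow> k \<in> I (ty s) \<Longrightarrow> M *v v s k = (\<Sum>i\<in>I (ty s). m (ty s) i k *s v s i)"
      using blockwiseE[OF M] by blast
    show ?thesis
      by (rule blockwiseI[where m = "\<lambda>t i k. c * m t i k"])
        (simp add: m mat_scale_mult_vec vec.scale_sum_right)
  qed
  show "mat 1 \<in> blockwise"
    by (rule blockwiseI[where m = "\<lambda>t i k. if i = k then 1 else 0"])
      (simp add: if_distrib[of "\<lambda>c. c *s _"] cong: if_cong)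
  show "M ** N \<in> blockwise" if M: "M \<in> blockwise" and N: "N \<in> blockwise" for M N
  proof -
    obtain m where m: "\<And>s k. s \<in> S \<Longrightarrow> k \<in> I (ty s) \<Longrightarrow> M *v v s k = (\<Sum>i\<in>I (ty s). m (ty s) i k *s v s i)"
      using blockwiseE[OF M] by blast
    obtain n where n: "\<And>s k. s \<in> S \<Longrightarrow> k \<in> I (ty s) \<Longrightarrow> N *v v s k = (\<Sum>i\<in>I (ty s). n (ty s) i k *s v s i)"
      using blockwiseE[OF N] by blast
    show ?thesis
    proof (rule blockwiseI[where m = "\<lambda>t i k. \<Sum>l\<in>I t. m t i l * n t l k"])
      fix s k assume s: "s \<in> S" "k \<in> I (ty s)"
      have "(M ** N) *v v s k = (\<Sum>l\<in>I (ty s). n (ty s) l k *s (M *v v s l))"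
        using s by (simp add: n matrix_vector_mul_assoc[symmetric] matrix_vector_mult_sum
            vector_scalar_commute)
      also have "\<dots> = (\<Sum>l\<in>I (ty s). \<Sum>i\<in>I (ty s). (m (ty s) i l * n (ty s) l k) *s v s i)"
        using s by (intro sum.cong refl) (simp add: m vec.scale_sum_right mult.commute)
      also have "\<dots> = (\<Sum>i\<in>I (ty s). (\<Sum>l\<in>I (ty s). m (ty s) i l * n (ty s) l k) *s v s i)"
        by (subst sum.swap) (simp add: vec.scale_sum_left)
      finally show "(M ** N) *v v s k = \<dots>" .
    qed
  qed
qed

lemma A_blockwise: "A \<in> blockwise"
\<comment> \<open>The block is tridiagonal. The condition \<open>Suc i = k\<close> is safer than
  \<open>i = k - 1\<close>, which would also hold for \<open>i = k = 0\<close>.\<close>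
proof (rule blockwiseI[where m = "\<lambda>t i k. (if i = Suc k then up t k else 0) + (if Suc i = k then dn t k else 0)"])
  fix s k assume s: "s \<in> S" "k \<in> I (ty s)"
  have "(\<Sum>i\<in>I (ty s). (if i = Suc k then up (ty s) k else 0) *s v s i) = up (ty s) k *s v s (Suc k)"
    using s(2) up_hi[of "ty s"] by (cases "k = hi (ty s)") (auto simp: if_distrib[of "\<lambda>c. c *s _"] cong: if_cong)
  moreover have "(\<Sum>i\<in>I (ty s). (if Suc i = k then dn (ty s) k else 0) *s v s i) = dn (ty s) k *s v s (k - 1)"
  proof (cases "k = lo (ty s)")
    case True
    then show ?thesis
      using dn_lo[of "ty s"] by (auto intro!: sum.neutral)
  next
    case False
    then have "Suc i = k \<longleftrightarrow> i = k - 1" for i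
      using s(2) by auto
    then show ?thesis
      using False s(2) by (auto simp: if_distrib[of "\<lambda>c. c *s _"] cong: if_cong)
  qed
  ultimately show "A *v v s k = (\<Sum>i\<in>I (ty s). ((if i = Suc k then up (ty s) k else 0) +
      (if Suc i = k then dn (ty s) k else 0)) *s v s i)"
    by (simp only: A_act[OF s] vector_sadd_rdistrib sum.distrib)
qed

lemma E_blockwise: "E j \<in> blockwise"
  by (rule blockwiseI[where m = "\<lambda>t i k. if i = k then (if k = j then 1 else 0) else 0"])
    (simp add: E_act if_distrib[of "\<lambda>c. c *s _"] cong: if_cong)

lemma T_blockwise: "T \<subseteq> blockwise"
  unfolding terwilliger_def using A_blockwise E_blockwise blockwise_subalgebra
  by (intro hull_minimal) auto

text \<open>A block matrix is the combination of the units with its own entries as coefficients;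
  both agree on the spanning vectors \<open>v s k\<close>.\<close>

lemma blockwise_span: "blockwise \<subseteq> cmat.span {U t i j | t i j. t \<in> ty ` S \<and> i \<in> I t \<and> j \<in> I t}"
proof
  fix M assume M: "M \<in> blockwise"
  obtain m where m: "\<And>s k. s \<in> S \<Longrightarrow> k \<in> I (ty s) \<Longrightarrow> M *v v s k = (\<Sum>i\<in>I (ty s). m (ty s) i k *s v s i)"
    using blockwiseE[OF M] by blast
  let ?N = "\<Sum>t\<in>ty ` S. \<Sum>i\<in>I t. \<Sum>j\<in>I t. mat_scale (m t i j) (U t i j)"
  have "M = ?N"
  proof (rule matrix_eq_on_spanning_set[OF v_span])
    fix b assume "b \<in> {v s i | s i. s \<in> S \<and> i \<in> I (ty s)}"
    then obtain s k where s: "s \<in> S" "k \<in> I (ty s)" "b = v s k"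
      by blast
    have "?N *v b = (\<Sum>t\<in>ty ` S. \<Sum>i\<in>I t. \<Sum>j\<in>I t. m t i j *s (U t i j *v v s k))"
      by (simp add: s(3) sum_matrix_vector_mult mat_scale_mult_vec)
    also have "\<dots> = (\<Sum>t\<in>ty ` S. if t = ty s then \<Sum>i\<in>I t. m t i k *s v s i else 0)"
    proof (rule sum.cong)
      fix t assume t: "t \<in> ty ` S"
      have "(\<Sum>j\<in>I t. m t i j *s (U t i j *v v s k)) = (if t = ty s then m t i k *s v s i else 0)"
        if i: "i \<in> I t" for i
      proof -
        have "(\<Sum>j\<in>I t. m t i j *s (U t i j *v v s k)) =
            (\<Sum>j\<in>I t. if j = k then (if t = ty s then m t i k *s v s i else 0) else 0)"
          using is_unit_U[OF t i] s(1,2) unfolding is_unit_def by (intro sum.cong) auto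
        then show ?thesis
          using s(2) by (simp add: sum.delta)
      qed
      then show "(\<Sum>i\<in>I t. \<Sum>j\<in>I t. m t i j *s (U t i j *v v s k)) =
          (if t = ty s then \<Sum>i\<in>I t. m t i k *s v s i else 0)"
        by simp
    qed simp
    also have "\<dots> = M *v b"
      using finite_S s m by (simp add: sum.delta)
    finally show "M *v b = ?N *v b" ..
  qed
  also have "\<dots> \<in> cmat.span {U t i j | t i j. t \<in> ty ` S \<and> i \<in> I t \<and> j \<in> I t}"
    by (intro cmat.span_sum cmat.span_scale cmat.span_base) blast
  finally show "M \<in> cmat.span {U t i j | t i j. t \<in> ty ` S \<and> i \<in> I t \<and> j \<in> I t}" .
qed

sublocale matrix_units T S ty I v U
proof
  show "vec.span {v s i |s i. s \<in> S \<and> i \<in> I (ty s)} = UNIV"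
    by (rule v_span)
  show "T \<subseteq> cmat.span {U t i j |t i j. t \<in> ty ` S \<and> i \<in> I t \<and> j \<in> I t}"
    using T_blockwise blockwise_span by blast
  show "U t i j \<in> T" if "t \<in> ty ` S" "i \<in> I t" "j \<in> I t" for t i j
    using is_unit_U[OF that] unfolding is_unit_def by blast
  show "U t i j *v v s k = (if t = ty s \<and> k = j then v s i else 0)"
    if "t \<in> ty ` S" "i \<in> I t" "j \<in> I t" "s \<in> S" "k \<in> I (ty s)" for t i j s k
    using is_unit_U[OF that(1-3)] that(4,5) unfolding is_unit_def by blast
  show "I t \<noteq> {}" for t
    using lo_le_hi by simp
qed (use finite_S v_nonzero v_orth in auto)

section \<open>Endpoint, diameter, shape and pure bases\<close>

lemma layer_W:
  assumes "s \<in> S"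
  shows "layer adj x (W s) i = vec.span (if i \<in> I (ty s) then {v s i} else {})"
proof -
  have "layer adj x (W s) i = vec.span ((*v) (E i) ` v s ` I (ty s))"
    unfolding layer_def by (rule vec.linear_span_image[OF matrix_vector_mul_linear_gen, symmetric])
  also have "(*v) (E i) ` v s ` I (ty s) = (\<lambda>k. if k = i then v s i else 0) ` I (ty s)"
    using E_act[OF assms] by (auto simp: image_image intro!: image_cong)
  also have "vec.span \<dots> = vec.span (\<dots> - {0})"
    by (simp add: vec.span_delete_0)
  also have "(\<lambda>k. if k = i then v s i else 0) ` I (ty s) - {0} = (if i \<in> I (ty s) then {v s i} else {})"
    using v_nonzero[OF assms] by auto
  finally show ?thesis .
qed

lemma support_W:
  assumes "s \<in> S"
  shows "module_support adj x (W s) = I (ty s)"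
proof -
  have "layer adj x (W s) i \<noteq> {0} \<longleftrightarrow> i \<in> I (ty s)" for i
    using layer_W[OF assms, of i] v_nonzero[OF assms, of i] vec.span_base[of "v s i" "{v s i}"] by auto
  then show ?thesis
    using hi_le[OF assms] unfolding module_support_def by auto
qed

lemma endpoint_W: "s \<in> S \<Longrightarrow> endpoint adj x (W s) = lo (ty s)"
  using lo_le_hi[of "ty s"] unfolding endpoint_def by (simp add: support_W Min_eq_iff)

lemma diameter_W: "s \<in> S \<Longrightarrow> module_diameter adj x (W s) = hi (ty s) - lo (ty s)"
  using lo_le_hi[of "ty s"] unfolding module_diameter_def by (simp add: support_W)

lemma dim_layer_W:
  assumes "s \<in> S" "i \<in> I (ty s)"
  shows "vec.dim (layer adj x (W s) i) = 1"
proof -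
  have "vec.independent {v s i}"
    using v_nonzero[OF assms] by simp
  then show ?thesis
    using layer_W[OF assms(1), of i] assms(2) vec.dim_span_eq_card_independent[of "{v s i}"] by simp
qed

lemma shape_W:
  assumes "s \<in> S"
  shows "module_shape adj x (W s) = replicate (Suc (hi (ty s) - lo (ty s))) 1"
proof -
  have "module_shape adj x (W s) = map (\<lambda>i. 1) [lo (ty s)..<Suc (hi (ty s))]"
    using lo_le_hi[of "ty s"] dim_layer_W[OF assms]
    unfolding module_shape_def endpoint_W[OF assms] diameter_W[OF assms] by (simp del: upt_Suc)
  then show ?thesis
    using lo_le_hi[of "ty s"] by (simp add: map_replicate_const Suc_diff_le del: upt_Suc)
qed

lemma pure_vector_v:
  assumes "s \<in> S" "i \<in> I (ty s)"
  shows "pure_vector adj x i (v s i)"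
  using v_nonzero[OF assms] v_pure[OF assms] unfolding pure_vector_def layer_def
  by (metis UNIV_I image_eqI)

lemma pure_basis_W:
  assumes "s \<in> S"
  shows "pure_basis adj x (W s) (map (v s) [lo (ty s)..<Suc (hi (ty s))])"
proof -
  have I: "set [lo (ty s)..<Suc (hi (ty s))] = I (ty s)"
    by auto
  have "ordered_basis (W s) (map (v s) [lo (ty s)..<Suc (hi (ty s))])"
    unfolding ordered_basis_def using basis_orthogonal[OF assms]
    by (simp only: set_map I distinct_map distinct_upt) simp
  moreover have "list_all2 (pure_vector adj x) [lo (ty s)..<Suc (hi (ty s))]
      (map (v s) [lo (ty s)..<Suc (hi (ty s))])"
    using pure_vector_v[OF assms] by (auto simp: list_all2_conv_all_nth simp del: upt_Suc)
  ultimately show ?thesis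
    unfolding pure_basis_def using sorted_upt by blast
qed

end

section \<open>Eigenbases and the spectra of the small matrices\<close>

text \<open>An eigenvector for \<open>\<theta>\<close> expands in the eigenbasis with coefficients
  satisfying \<open>c j * (\<mu> j - \<theta>) = 0\<close>, so only the basis vectors of eigenvalue
  \<open>\<theta>\<close> occur.\<close>

lemma has_spectrum_orthogonal_eigenbasis:
  fixes M :: "complex ^ 'v::finite ^ 'v" and f :: "'i \<Rightarrow> complex ^ 'v"
  assumes finite: "finite J" and nz: "\<And>j. j \<in> J \<Longrightarrow> f j \<noteq> 0"
    and orth: "\<And>i j. i \<in> J \<Longrightarrow> j \<in> J \<Longrightarrow> i \<noteq> j \<Longrightarrow> herm_inner (f i) (f j) = 0"
    and card: "card J = CARD('v)"
    and eigen: "\<And>j. j \<in> J \<Longrightarrow> M *v f j = \<mu> j *s f j"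
    and "distinct (map fst ps)" "set (map fst ps) = \<mu> ` J"
    and mult: "\<And>\<theta> m. (\<theta>, m) \<in> set ps \<Longrightarrow> card {j \<in> J. \<mu> j = \<theta>} = m"
  shows "has_spectrum M ps"
proof -
  have span: "vec.span (f ` J) = UNIV"
    by (rule orthogonal_span_UNIV[OF nz orth card])
  have ind: "inj_on f J" "vec.independent (f ` J)"
    by (rule orthogonal_imp_independent[OF nz orth]; assumption)+
  have espace: "eigenspace M \<theta> = vec.span (f ` {j \<in> J. \<mu> j = \<theta>})" for \<theta>
  proof
    show "vec.span (f ` {j \<in> J. \<mu> j = \<theta>}) \<subseteq> eigenspace M \<theta>"
    proof (rule vec.span_minimal)
      show "vec.subspace (eigenspace M \<theta>)"
        unfolding eigenspace_def
        by (rule vec.subspaceI)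
          (auto simp: matrix_vector_right_distrib vector_scalar_commute vector_add_ldistrib
            vector_smult_assoc mult.commute)
    qed (auto simp: eigenspace_def eigen)
    show "eigenspace M \<theta> \<subseteq> vec.span (f ` {j \<in> J. \<mu> j = \<theta>})"
    proof
      fix u assume u: "u \<in> eigenspace M \<theta>"
      have "u \<in> vec.span (f ` J)"
        by (simp add: span)
      then obtain c where c: "u = (\<Sum>j\<in>J. c j *s f j)"
        using span_family[OF finite ind(1)] by blast
      have "(\<Sum>j\<in>J. (c j * (\<mu> j - \<theta>)) *s f j) = M *v u - \<theta> *s u"
        unfolding c matrix_vector_mult_sum vec.scale_sum_right sum_subtractf[symmetric]
      proof (rule sum.cong)
        fix j assume "j \<in> J"
        then show "(c j * (\<mu> j - \<theta>)) *s f j = M *v (c j *s f j) - \<theta> *s (c j *s f j)"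
          by (simp add: vector_scalar_commute eigen vec_eq_iff algebra_simps)
      qed simp
      also have "\<dots> = 0"
        using u by (simp add: eigenspace_def)
      finally have zero: "(\<Sum>j\<in>J. (c j * (\<mu> j - \<theta>)) *s f j) = 0" .
      have "c j *s f j \<in> vec.span (f ` {j \<in> J. \<mu> j = \<theta>})" if "j \<in> J" for j
        using that independent_family[OF finite ind zero that]
        by (cases "\<mu> j = \<theta>") (auto intro: vec.span_scale vec.span_base simp: vec.span_zero)
      then show "u \<in> vec.span (f ` {j \<in> J. \<mu> j = \<theta>})"
        unfolding c by (rule vec.span_sum)
    qed
  qed
  have dim: "vec.dim (eigenspace M \<theta>) = card {j \<in> J. \<mu> j = \<theta>}" for \<theta>
  proof -
    have sub: "f ` {j \<in> J. \<mu> j = \<theta>} \<subseteq> f ` J" "inj_on f {j \<in> J. \<mu> j = \<theta>}"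
      using ind(1) by (auto intro: inj_on_subset)
    then have "vec.independent (f ` {j \<in> J. \<mu> j = \<theta>})"
      using ind(2) vec.independent_mono by blast
    then show ?thesis
      using sub by (simp add: espace vec.dim_eq_card_independent card_image)
  qed
  have "eigenspace M \<theta> \<noteq> {0} \<longleftrightarrow> \<theta> \<in> \<mu> ` J" for \<theta>
  proof
    assume "eigenspace M \<theta> \<noteq> {0}"
    then have "{j \<in> J. \<mu> j = \<theta>} \<noteq> {}"
      unfolding espace by (metis image_empty vec.span_empty)
    then show "\<theta> \<in> \<mu> ` J"
      by blast
  next
    assume "\<theta> \<in> \<mu> ` J"
    then show "eigenspace M \<theta> \<noteq> {0}"
      using nz eigen unfolding eigenspace_def by fastforce
  qed
  then show ?thesis
    unfolding has_spectrum_def using assms(6,7) mult dim by auto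
qed

text \<open>An eigenvector of the small matrix is the coordinate vector of an eigenvector of
  \<open>M\<close>; independence of the basis keeps it nonzero. In this way eigenvectors of the
  adjacency matrix are obtained without being written down.\<close>

lemma eigenvector_if_represents:
  assumes rep: "represents M vs B" and vs: "ordered_basis X vs" and \<theta>: "\<theta> \<in> spectrum B"
  shows "\<exists>u\<in>X. u \<noteq> 0 \<and> M *v u = \<theta> *s u"
proof -
  let ?n = "length vs"
  have B: "B \<in> carrier_mat ?n ?n"
    and M: "\<And>j. j < ?n \<Longrightarrow> M *v (vs ! j) = (\<Sum>i<?n. (B $$ (i, j)) *s (vs ! i))"
    using rep unfolding represents_def by auto
  obtain a where a: "a \<in> carrier_vec ?n" "a \<noteq> 0\<^sub>v ?n" "B *\<^sub>v a = \<theta> \<cdot>\<^sub>v a"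
    using \<theta> B unfolding spectrum_def eigenvalue_def eigenvector_def by auto
  let ?u = "\<Sum>j<?n. vec_index a j *s (vs ! j)"
  have X: "X = vec.span (set vs)" and ind: "vec.independent (set vs)"
    and inj: "inj_on ((!) vs) {..<?n}" and img: "(!) vs ` {..<?n} = set vs"
    using vs unfolding ordered_basis_def by (auto simp: inj_on_nth set_conv_nth)
  have "?u \<in> X"
    unfolding X by (intro vec.span_sum vec.span_scale vec.span_base) simp
  moreover have "?u \<noteq> 0"
  proof
    assume u0: "?u = 0"
    have "vec_index a j = 0" if "j < ?n" for j
      using independent_family[OF _ inj _ u0] ind that unfolding img by simp
    then show False
      using a by (auto intro: eq_vecI)
  qed
  moreover have "M *v ?u = \<theta> *s ?u"
  proof -
    have "M *v ?u = (\<Sum>j<?n. \<Sum>i<?n. (B $$ (i, j) * vec_index a j) *s (vs ! i))"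
      by (simp add: matrix_vector_mult_sum vector_scalar_commute M vec.scale_sum_right mult.commute)
    also have "\<dots> = (\<Sum>i<?n. vec_index (B *\<^sub>v a) i *s (vs ! i))"
      using B a(1) by (subst sum.swap)
        (simp add: vec.scale_sum_left[symmetric] scalar_prod_def lessThan_atLeast0)
    also have "\<dots> = \<theta> *s ?u"
      using a(1) by (simp add: a(3) vec.scale_sum_right)
    finally show ?thesis .
  qed
  ultimately show ?thesis
    by blast
qed

text \<open>Turns the eigenvalue problem into scalar equations for a function on indices, which can
  be solved by elimination.\<close>

lemma spectrum_mat_of_rows_list:
  fixes rs :: "complex list list"
  assumes "length rs = n"
  shows "\<theta> \<in> spectrum (mat_of_rows_list n rs) \<longleftrightarrow>
    (\<exists>a. (\<exists>i<n. a i \<noteq> 0) \<and> (\<forall>i<n. (\<Sum>j<n. rs ! i ! j * a j) = \<theta> * a i))"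
proof -
  let ?B = "mat_of_rows_list n rs"
  have B: "?B \<in> carrier_mat n n" "\<And>i j. i < n \<Longrightarrow> j < n \<Longrightarrow> ?B $$ (i, j) = rs ! i ! j"
    using assms by (auto simp: mat_of_rows_list_def)
  have mult: "?B *\<^sub>v a = \<theta> \<cdot>\<^sub>v a \<longleftrightarrow>
      (\<forall>i<n. (\<Sum>j<n. rs ! i ! j * vec_index a j) = \<theta> * vec_index a i)" if "a \<in> carrier_vec n" for a
  proof -
    have "?B *\<^sub>v a = \<theta> \<cdot>\<^sub>v a \<longleftrightarrow> (\<forall>i<n. vec_index (?B *\<^sub>v a) i = vec_index (\<theta> \<cdot>\<^sub>v a) i)"
      using B(1) that by (subst Matrix.vec_eq_iff) simp
    also have "\<dots> \<longleftrightarrow> (\<forall>i<n. (\<Sum>j<n. rs ! i ! j * vec_index a j) = \<theta> * vec_index a i)"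
      using B that by (auto simp: scalar_prod_def lessThan_atLeast0)
    finally show ?thesis .
  qed
  have nz: "a \<noteq> 0\<^sub>v n \<longleftrightarrow> (\<exists>i<n. vec_index a i \<noteq> 0)" if "a \<in> carrier_vec n" for a :: "complex Matrix.vec"
    using that by (auto intro: eq_vecI)
  have "\<theta> \<in> spectrum ?B \<longleftrightarrow> (\<exists>a\<in>carrier_vec n. (\<exists>i<n. vec_index a i \<noteq> 0) \<and>
      (\<forall>i<n. (\<Sum>j<n. rs ! i ! j * vec_index a j) = \<theta> * vec_index a i))"
    using B(1) mult nz unfolding spectrum_def eigenvalue_def eigenvector_def by auto
  also have "\<dots> \<longleftrightarrow> (\<exists>a. (\<exists>i<n. a i \<noteq> 0) \<and> (\<forall>i<n. (\<Sum>j<n. rs ! i ! j * a j) = \<theta> * a i))"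
  proof
    assume "\<exists>a. (\<exists>i<n. a i \<noteq> 0) \<and> (\<forall>i<n. (\<Sum>j<n. rs ! i ! j * a j) = \<theta> * a i)"
    then obtain a where "\<exists>i<n. a i \<noteq> 0" "\<forall>i<n. (\<Sum>j<n. rs ! i ! j * a j) = \<theta> * a i"
      by blast
    then show "\<exists>a\<in>carrier_vec n. (\<exists>i<n. vec_index a i \<noteq> 0) \<and>
        (\<forall>i<n. (\<Sum>j<n. rs ! i ! j * vec_index a j) = \<theta> * vec_index a i)"
      by (intro bexI[of _ "Matrix.vec n a"]) auto
  next
    assume "\<exists>a\<in>carrier_vec n. (\<exists>i<n. vec_index a i \<noteq> 0) \<and>
        (\<forall>i<n. (\<Sum>j<n. rs ! i ! j * vec_index a j) = \<theta> * vec_index a i)"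
    then show "\<exists>a. (\<exists>i<n. a i \<noteq> 0) \<and> (\<forall>i<n. (\<Sum>j<n. rs ! i ! j * a j) = \<theta> * a i)"
      by (elim bexE) (rule exI)
  qed
  finally show ?thesis .
qed

lemma spectrum_mat_of_rows_listE:
  fixes rs :: "complex list list"
  assumes "\<theta> \<in> spectrum (mat_of_rows_list n rs)" "length rs = n"
  obtains a where "\<exists>i<n. a i \<noteq> 0" "\<forall>i<n. (\<Sum>j<n. rs ! i ! j * a j) = \<theta> * a i"
  using assms(1) unfolding spectrum_mat_of_rows_list[OF assms(2)] by blast

section \<open>Eigenvalues of the four different blocks\<close>

lemma sqrt3_square: "complex_of_real (sqrt 3) * complex_of_real (sqrt 3) = 3"
  by (simp flip: of_real_mult)

lemma square_eq_3_iff: "\<theta> * \<theta> = 3 \<longleftrightarrow> \<theta> = complex_of_real (sqrt 3) \<or> \<theta> = - complex_of_real (sqrt 3)"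
  using square_eq_iff[of \<theta> "complex_of_real (sqrt 3)"] by (simp add: sqrt3_square)

lemma square_eq_9_iff: "\<theta> * \<theta> = 9 \<longleftrightarrow> \<theta> = 3 \<or> \<theta> = (- 3 :: complex)"
  using square_eq_iff[of \<theta> 3] by simp

lemma spectrum_1: "spectrum (mat_of_rows_list 1 [[0 :: complex]]) = {0}"
proof -
  have "\<theta> \<in> spectrum (mat_of_rows_list 1 [[0 :: complex]]) \<longleftrightarrow> (\<exists>a :: nat \<Rightarrow> complex. a 0 \<noteq> 0 \<and> \<theta> * a 0 = 0)" for \<theta>
    by (subst spectrum_mat_of_rows_list) auto
  then show ?thesis
    by (auto intro: exI[of _ "\<lambda>_. 1"])
qed

lemma spectrum_2:
  "spectrum (mat_of_rows_list 2 [[0, 3], [1, 0 :: complex]])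
    = {complex_of_real (sqrt 3), - complex_of_real (sqrt 3)}"
proof -
  have "\<theta> \<in> spectrum (mat_of_rows_list 2 [[0, 3], [1, 0 :: complex]]) \<longleftrightarrow> \<theta> * \<theta> = 3" for \<theta>
  proof
    assume "\<theta> \<in> spectrum (mat_of_rows_list 2 [[0, 3], [1, 0 :: complex]])"
    then obtain a where "\<exists>i<2. a i \<noteq> 0" "\<forall>i<2. (\<Sum>j<2. [[0, 3], [1, 0 :: complex]] ! i ! j * a j) = \<theta> * a i"
      by (rule spectrum_mat_of_rows_listE) simp
    then have a: "a 0 \<noteq> 0 \<or> a 1 \<noteq> 0" "3 * a 1 = \<theta> * a 0" "a 0 = \<theta> * a 1"
      by (auto simp: numeral_eq_Suc All_less_Suc Ex_less_Suc)
    then have "(\<theta> * \<theta> - 3) * a 1 = 0" "a 1 \<noteq> 0"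
      by (auto simp: algebra_simps)
    then show "\<theta> * \<theta> = 3"
      by simp
  next
    assume "\<theta> * \<theta> = 3"
    then show "\<theta> \<in> spectrum (mat_of_rows_list 2 [[0, 3], [1, 0 :: complex]])"
      by (subst spectrum_mat_of_rows_list)
        (auto simp: numeral_eq_Suc All_less_Suc Ex_less_Suc intro!: exI[of _ "\<lambda>i. [\<theta>, 1] ! i"])
  qed
  then show ?thesis
    using square_eq_3_iff by blast
qed

lemma spectrum_3:
  "spectrum (mat_of_rows_list 3 [[0, 2, 0], [1, 0, 1], [0, 1, 0 :: complex]])
    = {complex_of_real (sqrt 3), 0, - complex_of_real (sqrt 3)}"
proof -
  let ?B = "mat_of_rows_list 3 [[0, 2, 0], [1, 0, 1], [0, 1, 0 :: complex]]"
  have "\<theta> \<in> spectrum ?B \<longleftrightarrow> \<theta> = 0 \<or> \<theta> * \<theta> = 3" for \<theta>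
  proof
    assume "\<theta> \<in> spectrum ?B"
    then obtain a where "\<exists>i<3. a i \<noteq> 0" "\<forall>i<3. (\<Sum>j<3. [[0, 2, 0], [1, 0, 1], [0, 1, 0 :: complex]] ! i ! j * a j) = \<theta> * a i"
      by (rule spectrum_mat_of_rows_listE) simp
    then have a: "a 0 \<noteq> 0 \<or> a 1 \<noteq> 0 \<or> a 2 \<noteq> 0"
      "2 * a 1 = \<theta> * a 0" "a 0 + a 2 = \<theta> * a 1" "a 1 = \<theta> * a 2"
      by (auto simp: numeral_eq_Suc All_less_Suc Ex_less_Suc)
    have a0: "a 0 = (\<theta> * \<theta> - 1) * a 2"
      using a(3) unfolding a(4) by (simp add: algebra_simps)
    then have "a 2 \<noteq> 0"
      using a(1,4) by auto
    moreover have "\<theta> * (\<theta> * \<theta> - 3) * a 2 = 0"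
      using a(2) unfolding a0 a(4) by (simp add: algebra_simps)
    ultimately show "\<theta> = 0 \<or> \<theta> * \<theta> = 3"
      by simp
  next
    assume *: "\<theta> = 0 \<or> \<theta> * \<theta> = 3"
    then have "\<theta> * (\<theta> * \<theta>) = 3 * \<theta>"
      by auto
    \<comment> \<open>The witness solves the last two equations with last entry 1; the first
      equation then becomes the characteristic equation.\<close>
    then show "\<theta> \<in> spectrum ?B"
      by (subst spectrum_mat_of_rows_list)
        (auto simp: numeral_eq_Suc All_less_Suc Ex_less_Suc algebra_simps
          intro!: exI[of _ "\<lambda>i. [\<theta> * \<theta> - 1, \<theta>, 1] ! i"])
  qed
  then show ?thesis
    using square_eq_3_iff by blast
qed

lemma spectrum_5:
  "spectrum (mat_of_rows_list 5 [[0, 3, 0, 0, 0], [1, 0, 2, 0, 0], [0, 1, 0, 2, 0], [0, 0, 2, 0, 1],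
      [0, 0, 0, 3, 0 :: complex]])
    = {3, complex_of_real (sqrt 3), 0, - complex_of_real (sqrt 3), -3}"
proof -
  let ?B = "mat_of_rows_list 5 [[0, 3, 0, 0, 0], [1, 0, 2, 0, 0], [0, 1, 0, 2, 0], [0, 0, 2, 0, 1],
      [0, 0, 0, 3, 0 :: complex]]"
  have "\<theta> \<in> spectrum ?B \<longleftrightarrow> \<theta> = 0 \<or> \<theta> * \<theta> = 3 \<or> \<theta> * \<theta> = 9" for \<theta>
  proof
    assume "\<theta> \<in> spectrum ?B"
    then obtain a where "\<exists>i<5. a i \<noteq> 0" "\<forall>i<5. (\<Sum>j<5. [[0, 3, 0, 0, 0], [1, 0, 2, 0, 0], [0, 1, 0, 2, 0], [0, 0, 2, 0, 1],
      [0, 0, 0, 3, 0 :: complex]] ! i ! j * a j) = \<theta> * a i"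
      by (rule spectrum_mat_of_rows_listE) simp
    then have a: "a 0 \<noteq> 0 \<or> a 1 \<noteq> 0 \<or> a 2 \<noteq> 0 \<or> a 3 \<noteq> 0 \<or> a 4 \<noteq> 0"
      "3 * a 1 = \<theta> * a 0" "a 0 + 2 * a 2 = \<theta> * a 1" "a 1 + 2 * a 3 = \<theta> * a 2"
      "2 * a 2 + a 4 = \<theta> * a 3" "3 * a 3 = \<theta> * a 4"
      by (auto simp: numeral_eq_Suc All_less_Suc Ex_less_Suc)
    \<comment> \<open>Solving from the top row down expresses all entries by \<open>a 0\<close>. The
      factor 1/6 clears the denominators up to \<open>a 2\<close>, and doubling does so for
      \<open>a 3\<close> and \<open>a 4\<close>. The last row becomes the characteristic equation
      \<open>\<theta> * (\<theta> * \<theta> - 3) * (\<theta> * \<theta> - 9) = 0\<close>.\<close>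
    define b where "b = a 0 / 6"
    have a0: "a 0 = 6 * b" and a1: "a 1 = 2 * \<theta> * b"
      using a(2) by (simp_all add: b_def field_simps)
    have a2: "a 2 = (\<theta> * \<theta> - 3) * b"
    proof -
      have "2 * a 2 = 2 * ((\<theta> * \<theta> - 3) * b)"
        using a(3) unfolding a0 a1 by (simp add: algebra_simps)
      then show ?thesis
        by simp
    qed
    have a3: "2 * a 3 = \<theta> * (\<theta> * \<theta> - 5) * b"
      using a(4) unfolding a1 a2 by (simp add: algebra_simps)
    have a4: "2 * a 4 = (\<theta> * \<theta> * (\<theta> * \<theta> - 5) - 4 * (\<theta> * \<theta> - 3)) * b"
    proof -
      have "2 * a 4 = 2 * (\<theta> * a 3) - 4 * a 2"
        unfolding a(5)[symmetric] by simp
      then have "2 * a 4 = \<theta> * (2 * a 3) - 4 * a 2"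
        by simp
      then show ?thesis
        unfolding a3 a2 by (simp add: algebra_simps)
    qed
    have "b \<noteq> 0"
      using a(1) a0 a1 a2 a3 a4 by auto
    moreover have "\<theta> * (\<theta> * \<theta> - 3) * (\<theta> * \<theta> - 9) * b = 0"
    proof -
      have "3 * (2 * a 3) = \<theta> * (2 * a 4)"
        using a(6) by (simp add: algebra_simps)
      then show ?thesis
        unfolding a3 a4 by (simp add: algebra_simps)
    qed
    ultimately show "\<theta> = 0 \<or> \<theta> * \<theta> = 3 \<or> \<theta> * \<theta> = 9"
      by auto
  next
    assume "\<theta> = 0 \<or> \<theta> * \<theta> = 3 \<or> \<theta> * \<theta> = 9"
    then consider "\<theta> = 0" | "\<theta> * \<theta> = 3" | "\<theta> * \<theta> = 9"
      by blast
    \<comment> \<open>The three witnesses are the entries computed above, for \<open>b\<close> equal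
      to 1/3, 1/2 and 1/2.\<close>
    then show "\<theta> \<in> spectrum ?B"
    proof cases
      case 1
      then show ?thesis
        by (subst spectrum_mat_of_rows_list)
          (auto simp: numeral_eq_Suc All_less_Suc Ex_less_Suc
            intro!: exI[of _ "\<lambda>i. [2, 0, - 1, 0, 2] ! i"])
    next
      case 2
      then show ?thesis
        by (subst spectrum_mat_of_rows_list)
          (auto simp: numeral_eq_Suc All_less_Suc Ex_less_Suc
            intro!: exI[of _ "\<lambda>i. [3, \<theta>, 0, - \<theta> / 2, - 3 / 2] ! i"])
    next
      case 3
      then show ?thesis
        by (subst spectrum_mat_of_rows_list)
          (auto simp: numeral_eq_Suc All_less_Suc Ex_less_Suc
            intro!: exI[of _ "\<lambda>i. [3, \<theta>, 3, \<theta>, 3] ! i"])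
    qed
  qed
  then show ?thesis
    using square_eq_3_iff square_eq_9_iff by auto
qed

section \<open>The irreducible modules\<close>

lemma adjacency_mult_nth: "(adjacency_matrix adj *v u) $ y = (\<Sum>z | adj y z. u $ z)"
  by (simp add: adjacency_matrix_def matrix_vector_mult_def if_distrib[of "\<lambda>a. a * _"] sum.If_cases
      cong: if_cong)

lemma estar_nth: "estar adj x i $ y = (if gdist adj x y = i then 1 else 0)"
  by (simp add: estar_def)

locale pappus_frame =
  pappus adj + pappus_labelled adj x p1 p2 p3 y1 y2 y3 y4 y5 y6 q1 q2 q3 q4 q5 q6 w w'
  for adj :: "'v::finite \<Rightarrow> 'v \<Rightarrow> bool"
    and x p1 p2 p3 y1 y2 y3 y4 y5 y6 q1 q2 q3 q4 q5 q6 w w'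
begin

abbreviation A :: "complex ^ 'v ^ 'v" where "A \<equiv> adjacency_matrix adj"

abbreviation E :: "nat \<Rightarrow> complex ^ 'v ^ 'v" where "E \<equiv> Estar adj x"

text \<open>The reversed list yields the disequalities in the other orientation, for evaluating sums
  over the explicit neighbor sets.\<close>

lemma vertices_neq:
  "distinct [x, p1, p2, p3, y1, y2, y3, y4, y5, y6, q1, q2, q3, q4, q5, q6, w, w']"
  "distinct (rev [x, p1, p2, p3, y1, y2, y3, y4, y5, y6, q1, q2, q3, q4, q5, q6, w, w'])"
  using distinct_vertices by (simp_all only: distinct_rev)

lemma A_nth:
  "(A *v u) $ x = u $ p1 + u $ p2 + u $ p3"
  "(A *v u) $ p1 = u $ x + u $ y1 + u $ y2"
  "(A *v u) $ p2 = u $ x + u $ y3 + u $ y4"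
  "(A *v u) $ p3 = u $ x + u $ y5 + u $ y6"
  "(A *v u) $ y1 = u $ p1 + u $ q6 + u $ q1"
  "(A *v u) $ y3 = u $ p2 + u $ q1 + u $ q2"
  "(A *v u) $ y5 = u $ p3 + u $ q2 + u $ q3"
  "(A *v u) $ y2 = u $ p1 + u $ q3 + u $ q4"
  "(A *v u) $ y4 = u $ p2 + u $ q4 + u $ q5"
  "(A *v u) $ y6 = u $ p3 + u $ q5 + u $ q6"
  "(A *v u) $ q1 = u $ y1 + u $ y3 + u $ w"
  "(A *v u) $ q2 = u $ y3 + u $ y5 + u $ w'"
  "(A *v u) $ q3 = u $ y5 + u $ y2 + u $ w"
  "(A *v u) $ q4 = u $ y2 + u $ y4 + u $ w'"
  "(A *v u) $ q5 = u $ y4 + u $ y6 + u $ w"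
  "(A *v u) $ q6 = u $ y6 + u $ y1 + u $ w'"
  "(A *v u) $ w = u $ q1 + u $ q3 + u $ q5"
  "(A *v u) $ w' = u $ q2 + u $ q4 + u $ q6"
  unfolding adjacency_mult_nth neighbors
  by (insert vertices_neq, simp_all add: add.assoc)

lemma sum_vertices:
  "sum g UNIV = g x + g p1 + g p2 + g p3 + g y1 + g y2 + g y3 + g y4 + g y5 + g y6 +
    g q1 + g q2 + g q3 + g q4 + g q5 + g q6 + g w + (g w' :: complex)"
proof -
  have "sum g UNIV = sum_list (map g [x, p1, p2, p3, y1, y2, y3, y4, y5, y6, q1, q2, q3, q4, q5, q6, w, w'])"
    unfolding all_vertices by (rule sum.distinct_set_conv_list[OF distinct_vertices])
  then show ?thesis
    by (simp add: add.assoc)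
qed

lemmas vec_eq_vertices = vec_eq_iff[where 'b = 'v, unfolded all_vertices_iff]

lemmas herm_inner_vertices = herm_inner_def[where 'v = 'v, unfolded sum_vertices]

lemma estar_action: "A *v estar adj x 0 = estar adj x 1"
  "A *v estar adj x 1 = 3 *s estar adj x 0 + estar adj x 2"
  "A *v estar adj x 2 = 2 *s estar adj x 1 + 2 *s estar adj x 3"
  "A *v estar adj x 3 = 2 *s estar adj x 2 + 3 *s estar adj x 4"
  "A *v estar adj x 4 = estar adj x 3"
  by (simp_all add: vec_eq_vertices A_nth estar_nth distances)

lemma E_estar: "E i *v estar adj x i = estar adj x i"
  by (simp add: vec_eq_iff Estar_nth estar_nth)

lemma estar_nonzero: "estar adj x 0 \<noteq> 0" "estar adj x 1 \<noteq> 0" "estar adj x 2 \<noteq> 0"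
  "estar adj x 3 \<noteq> 0" "estar adj x 4 \<noteq> 0"
  by (simp_all add: vec_eq_vertices estar_nth distances)

text \<open>The first sphere may be ordered independently of \<open>p1\<close>, \<open>p2\<close>,
  \<open>p3\<close>, so the coordinates of the seeds at these vertices are unknown. Support and zero
  sum describe the seeds without reference to an order.\<close>

definition type_II :: "complex ^ 'v \<Rightarrow> bool" where
  "type_II n \<longleftrightarrow> n \<noteq> 0 \<and> E 1 *v n = n \<and> n $ p1 + n $ p2 + n $ p3 = 0"

definition type_II_end :: "complex ^ 'v \<Rightarrow> complex ^ 'v" where
  "type_II_end n = E 3 *v ((A ** A) *v n)"

lemma supported_nth: "E i *v n = n \<Longrightarrow> gdist adj x y \<noteq> i \<Longrightarrow> n $ y = 0"
  using Estar_nth[of adj x i n y] by auto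

lemma type_II_coords:
  assumes "type_II n"
  shows "n $ p3 = - n $ p1 - n $ p2" "gdist adj x y \<noteq> 1 \<Longrightarrow> n $ y = 0"
  using assms supported_nth[of 1 n y] unfolding type_II_def by (auto simp: algebra_simps add_eq_0_iff)

text \<open>Both children of a vertex \<open>p\<close> copy its value, which gives the factor 2. A
  vertex \<open>q\<close> adds the values of two different parents, so it carries minus the value of
  the third; hence the sum over the neighbors of \<open>w\<close> or \<open>w'\<close>
  vanishes.\<close>

lemma type_II_chain:
  assumes n: "type_II n"
  shows "E 2 *v (A *v n) = A *v n" "E 3 *v type_II_end n = type_II_end n"
    "A *v (A *v n) = 2 *s n + type_II_end n" "A *v type_II_end n = A *v n"
  by (simp_all add: vec_eq_vertices type_II_end_def A_nth Estar_nth distances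
      matrix_vector_mul_assoc[symmetric] type_II_coords[OF n])

lemma type_II_nonzero:
  assumes n: "type_II n"
  shows "A *v n \<noteq> 0" "type_II_end n \<noteq> 0"
proof -
  show "A *v n \<noteq> 0"
    using n unfolding type_II_def
    by (auto simp add: vec_eq_vertices A_nth Estar_nth distances)
  then show "type_II_end n \<noteq> 0"
    using type_II_chain(4)[OF n] by auto
qed

text \<open>Each value on the first sphere reappears, up to sign, at exactly two vertices of layer 2
  and of layer 3, so inner products are doubled.\<close>

lemma type_II_orthogonal:
  assumes n: "type_II n" and m: "type_II m" and nm: "herm_inner n m = 0"
  shows "herm_inner (A *v n) (A *v m) = 0" "herm_inner (type_II_end n) (type_II_end m) = 0"
proof -
  have "herm_inner (A *v n) (A *v m) = 2 * herm_inner n m"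
    "herm_inner (type_II_end n) (type_II_end m) = 2 * herm_inner n m"
    by (simp_all add: herm_inner_vertices type_II_end_def A_nth Estar_nth distances
        matrix_vector_mul_assoc[symmetric] type_II_coords[OF n] type_II_coords[OF m] algebra_simps)
  then show "herm_inner (A *v n) (A *v m) = 0" "herm_inner (type_II_end n) (type_II_end m) = 0"
    using nm by simp_all
qed

lemma type_II_estar:
  assumes n: "type_II n"
  shows "herm_inner (estar adj x 1) n = 0" "herm_inner (estar adj x 2) (A *v n) = 0"
    "herm_inner (estar adj x 3) (type_II_end n) = 0"
  by (simp_all add: herm_inner_vertices type_II_end_def A_nth Estar_nth estar_nth distances
      matrix_vector_mul_assoc[symmetric] type_II_coords[OF n])

end

datatype summand_type = Type_I | Type_II | Type_III | Type_IV | Type_V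

definition summand_types :: "summand_type list" where
  "summand_types = [Type_I, Type_II, Type_II, Type_III, Type_IV, Type_IV, Type_V]"

primrec first_layer :: "summand_type \<Rightarrow> nat" where
  "first_layer Type_I = 0"
| "first_layer Type_II = 1"
| "first_layer Type_III = 2"
| "first_layer Type_IV = 2"
| "first_layer Type_V = 3"

primrec last_layer :: "summand_type \<Rightarrow> nat" where
  "last_layer Type_I = 4"
| "last_layer Type_II = 3"
| "last_layer Type_III = 2"
| "last_layer Type_IV = 3"
| "last_layer Type_V = 4"

text \<open>For type I the entries are \<open>c_{i+1}\<close>: a vertex at distance
  \<open>i + 1\<close> has that many neighbors in the sphere below. Accordingly
  \<open>lowering\<close> lists \<open>b_{i-1}\<close>. The zeros at the ends stop the
  chains.\<close>

primrec raising :: "summand_type \<Rightarrow> nat \<Rightarrow> complex" where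
  "raising Type_I i = [1, 1, 2, 3, 0] ! i"
| "raising Type_II i = [1, 1, 0] ! (i - 1)"
| "raising Type_III i = 0"
| "raising Type_IV i = [1, 0] ! (i - 2)"
| "raising Type_V i = [1, 0] ! (i - 3)"

primrec lowering :: "summand_type \<Rightarrow> nat \<Rightarrow> complex" where
  "lowering Type_I i = [0, 3, 2, 2, 1] ! i"
| "lowering Type_II i = [0, 2, 1] ! (i - 1)"
| "lowering Type_III i = 0"
| "lowering Type_IV i = [0, 3] ! (i - 2)"
| "lowering Type_V i = [0, 3] ! (i - 3)"

text \<open>The separating layers are 0, 1, 2, 3, 4 for types I to V. Layer 0 meets only type I,
  layers 1 and 4 add types II and V respectively, layer 3 meets all types but III, and layer 2 all
  but V, so type III comes last.\<close>

primrec separation_rank :: "summand_type \<Rightarrow> nat" where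
  "separation_rank Type_I = 0"
| "separation_rank Type_II = 1"
| "separation_rank Type_V = 1"
| "separation_rank Type_IV = 2"
| "separation_rank Type_III = 3"

primrec block :: "summand_type \<Rightarrow> complex mat" where
  "block Type_I = mat_of_rows_list 5
    [[0, 3, 0, 0, 0], [1, 0, 2, 0, 0], [0, 1, 0, 2, 0], [0, 0, 2, 0, 1], [0, 0, 0, 3, 0]]"
| "block Type_II = mat_of_rows_list 3 [[0, 2, 0], [1, 0, 1], [0, 1, 0]]"
| "block Type_III = mat_of_rows_list 1 [[0]]"
| "block Type_IV = mat_of_rows_list 2 [[0, 3], [1, 0]]"
| "block Type_V = mat_of_rows_list 2 [[0, 3], [1, 0]]"

abbreviation (input) sqrt3 :: complex where "sqrt3 \<equiv> complex_of_real (sqrt 3)"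

primrec block_spectrum :: "summand_type \<Rightarrow> complex set" where
  "block_spectrum Type_I = {3, sqrt3, 0, - sqrt3, - 3}"
| "block_spectrum Type_II = {sqrt3, 0, - sqrt3}"
| "block_spectrum Type_III = {0}"
| "block_spectrum Type_IV = {sqrt3, - sqrt3}"
| "block_spectrum Type_V = {sqrt3, - sqrt3}"

lemma spectrum_block: "spectrum (block t) = block_spectrum t"
  by (cases t) (simp_all only: block.simps block_spectrum.simps spectrum_5 spectrum_3 spectrum_2 spectrum_1)

lemma sqrt3_neq:
  "sqrt3 \<noteq> 0" "sqrt3 \<noteq> 3" "sqrt3 \<noteq> - 3" "sqrt3 \<noteq> - sqrt3"
proof -
  show "sqrt3 \<noteq> 0"
    using sqrt3_square by auto
  then show "sqrt3 \<noteq> - sqrt3"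
    by (simp add: eq_neg_iff_add_eq_0)
  have "sqrt3 * sqrt3 \<noteq> 3 * 3" "sqrt3 * sqrt3 \<noteq> (- 3) * (- 3)"
    by (simp_all add: sqrt3_square)
  then show "sqrt3 \<noteq> 3" "sqrt3 \<noteq> - 3"
    by auto
qed

lemma sqrt3_neq':
  "3 \<noteq> sqrt3" "- 3 \<noteq> sqrt3" "- sqrt3 \<noteq> sqrt3" "- sqrt3 \<noteq> 3" "3 \<noteq> - sqrt3" "- sqrt3 \<noteq> - 3" "- 3 \<noteq> - sqrt3"
proof -
  show "- sqrt3 \<noteq> 3"
    using not_sym[OF sqrt3_neq(3)] minus_equation_iff[of sqrt3 3] by blast
  then show "3 \<noteq> - sqrt3"
    by (rule not_sym)
qed (simp_all only: neg_equal_iff_equal sqrt3_neq sqrt3_neq[THEN not_sym] not_False_eq_True)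

lemma adjacency_self_adjoint:
  assumes "simple_graph adj"
  shows "herm_inner (adjacency_matrix adj *v u) u' = herm_inner u (adjacency_matrix adj *v u')"
proof -
  let ?a = "\<lambda>y z. if adj y z then 1 else 0 :: complex"
  have sym: "?a y z = ?a z y" for y z
    using assms unfolding simple_graph_def by auto
  have "herm_inner (adjacency_matrix adj *v u) u' = (\<Sum>y\<in>UNIV. \<Sum>z\<in>UNIV. ?a y z * u $ z * cnj (u' $ y))"
    by (simp add: herm_inner_def adjacency_matrix_def matrix_vector_mult_def sum_distrib_right)
  also have "\<dots> = (\<Sum>z\<in>UNIV. \<Sum>y\<in>UNIV. ?a z y * u $ z * cnj (u' $ y))"
    by (subst sum.swap) (simp only: sym)
  also have "\<dots> = (\<Sum>z\<in>UNIV. \<Sum>y\<in>UNIV. u $ z * (?a z y * cnj (u' $ y)))"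
    by (simp only: mult.assoc mult.left_commute)
  also have "\<dots> = herm_inner u (adjacency_matrix adj *v u')"
    by (simp add: herm_inner_def adjacency_matrix_def matrix_vector_mult_def sum_distrib_left
        if_distrib[of cnj] cong: if_cong)
  finally show ?thesis .
qed

lemma card_filter_sum: "finite A \<Longrightarrow> card {a \<in> A. P a} = (\<Sum>a\<in>A. if P a then 1 else 0)"
  by (simp add: sum.inter_filter[symmetric])

lemma all_summands: "(\<forall>s\<in>{..<7}. P s) \<longleftrightarrow> P 0 \<and> P 1 \<and> P 2 \<and> P 3 \<and> P 4 \<and> P 5 \<and> P (6::nat)"
  by (auto simp: numeral_eq_Suc less_Suc_eq)

lemma all_layers: "(\<forall>i\<in>{l..h}. P i) \<longleftrightarrow> (0 \<in> {l..h} \<longrightarrow> P 0) \<and> (1 \<in> {l..h} \<longrightarrow> P 1) \<and>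
    (2 \<in> {l..h} \<longrightarrow> P 2) \<and> (3 \<in> {l..h} \<longrightarrow> P 3) \<and> (4 \<in> {l..h} \<longrightarrow> P 4)" if "h \<le> 4" for l h :: nat
proof -
  have "i = 0 \<or> i = 1 \<or> i = 2 \<or> i = 3 \<or> i = 4" if "i \<le> h" for i
    using that \<open>h \<le> 4\<close> by linarith
  then show ?thesis
    by fastforce
qed

text \<open>The scalar \<open>e\<close> leaves open which of \<open>w\<close> and \<open>w'\<close>
  belongs to the first triple of the third sphere. In the cyclic order of the hexagon the seeds
  \<open>n2a\<close>, \<open>n2b\<close>, \<open>n2c\<close> read -1, 1, -1, 1, -1, 1, then 1, 0,
  -1, -1, 0, 1, and 1, 2, 1, -1, -2, -1.\<close>

locale pappus_seeds =
  pappus_frame adj x p1 p2 p3 y1 y2 y3 y4 y5 y6 q1 q2 q3 q4 q5 q6 w w'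
  for adj :: "'v::finite \<Rightarrow> 'v \<Rightarrow> bool"
    and x p1 p2 p3 y1 y2 y3 y4 y5 y6 q1 q2 q3 q4 q5 q6 w w' +
  fixes n1a n1b n2a n2b n2c n3 :: "complex ^ 'v" and e :: complex
  assumes n1: "type_II n1a" "type_II n1b" "herm_inner n1a n1b = 0"
    and n2: "E 2 *v n2a = n2a" "E 2 *v n2b = n2b" "E 2 *v n2c = n2c"
      "essential_part [y1, y2, y3, y4, y5, y6] n2a = [-1, 1, 1, -1, -1, 1]"
      "essential_part [y1, y2, y3, y4, y5, y6] n2b = [1, -1, 0, 0, -1, 1]"
      "essential_part [y1, y2, y3, y4, y5, y6] n2c = [1, -1, 2, -2, 1, -1]"
    and n3: "E 3 *v n3 = n3" "essential_part [q1, q2, q3, q4, q5, q6] n3 = [e, -e, e, -e, e, -e]"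
    and e: "e \<noteq> 0"
begin

lemma seed_nth:
  "n2a $ y1 = -1" "n2a $ y2 = 1" "n2a $ y3 = 1" "n2a $ y4 = -1" "n2a $ y5 = -1" "n2a $ y6 = 1"
  "n2b $ y1 = 1" "n2b $ y2 = -1" "n2b $ y3 = 0" "n2b $ y4 = 0" "n2b $ y5 = -1" "n2b $ y6 = 1"
  "n2c $ y1 = 1" "n2c $ y2 = -1" "n2c $ y3 = 2" "n2c $ y4 = -2" "n2c $ y5 = 1" "n2c $ y6 = -1"
  "n3 $ q1 = e" "n3 $ q2 = -e" "n3 $ q3 = e" "n3 $ q4 = -e" "n3 $ q5 = e" "n3 $ q6 = -e"
  "gdist adj x y \<noteq> 2 \<Longrightarrow> n2a $ y = 0" "gdist adj x y \<noteq> 2 \<Longrightarrow> n2b $ y = 0"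
  "gdist adj x y \<noteq> 2 \<Longrightarrow> n2c $ y = 0" "gdist adj x y \<noteq> 3 \<Longrightarrow> n3 $ y = 0"
  using n2 n3 supported_nth by (simp_all add: essential_part_def)

lemmas coords = A_nth Estar_nth estar_nth distances seed_nth matrix_vector_mul_assoc[symmetric]
  type_II_end_def type_II_coords[OF n1(1)] type_II_coords[OF n1(2)]

text \<open>Each seed cancels in the layer below: opposite vertices of the hexagon share their
  \<open>p\<close>, and the two \<open>q\<close> next to a vertex of the hexagon carry opposite
  signs in \<open>n3\<close>. The alternating \<open>n2a\<close> also cancels at every
  \<open>q\<close>. The factor 3 for \<open>n3\<close> counts the neighbors of \<open>w\<close> and
  of \<open>w'\<close>.\<close>

lemma seed_chains:
  "A *v n2a = 0"
  "E 3 *v (A *v n2b) = A *v n2b" "A *v (A *v n2b) = 3 *s n2b"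
  "E 3 *v (A *v n2c) = A *v n2c" "A *v (A *v n2c) = 3 *s n2c"
  "E 4 *v (A *v n3) = A *v n3" "A *v (A *v n3) = 3 *s n3"
  by (simp_all add: vec_eq_vertices coords)

lemma seeds_nonzero:
  "n2a \<noteq> 0" "n2b \<noteq> 0" "n2c \<noteq> 0" "n3 \<noteq> 0" "A *v n2b \<noteq> 0" "A *v n2c \<noteq> 0" "A *v n3 \<noteq> 0"
  by (simp_all add: vec_eq_vertices coords e)

lemma orthogonal_2:
  "herm_inner (estar adj x 2) n2a = 0" "herm_inner (estar adj x 2) n2b = 0"
  "herm_inner (estar adj x 2) n2c = 0"
  "herm_inner (A *v n1a) n2a = 0" "herm_inner (A *v n1a) n2b = 0" "herm_inner (A *v n1a) n2c = 0"
  "herm_inner (A *v n1b) n2a = 0" "herm_inner (A *v n1b) n2b = 0" "herm_inner (A *v n1b) n2c = 0"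
  "herm_inner n2a n2b = 0" "herm_inner n2a n2c = 0" "herm_inner n2b n2c = 0"
  by (simp_all add: herm_inner_vertices coords)

lemma orthogonal_3:
  "herm_inner (estar adj x 3) (A *v n2b) = 0" "herm_inner (estar adj x 3) (A *v n2c) = 0"
  "herm_inner (estar adj x 3) n3 = 0"
  "herm_inner (type_II_end n1a) (A *v n2b) = 0" "herm_inner (type_II_end n1a) (A *v n2c) = 0"
  "herm_inner (type_II_end n1a) n3 = 0"
  "herm_inner (type_II_end n1b) (A *v n2b) = 0" "herm_inner (type_II_end n1b) (A *v n2c) = 0"
  "herm_inner (type_II_end n1b) n3 = 0"
  "herm_inner (A *v n2b) (A *v n2c) = 0" "herm_inner (A *v n2b) n3 = 0" "herm_inner (A *v n2c) n3 = 0"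
  by (simp_all add: herm_inner_vertices coords)

lemma orthogonal_4: "herm_inner (estar adj x 4) (A *v n3) = 0"
  by (simp add: herm_inner_vertices coords)

definition chains :: "(complex ^ 'v) list list" where
  "chains =
    [[estar adj x 0, estar adj x 1, estar adj x 2, estar adj x 3, estar adj x 4],
     [n1a, A *v n1a, type_II_end n1a], [n1b, A *v n1b, type_II_end n1b],
     [n2a], [n2b, A *v n2b], [n2c, A *v n2c], [n3, A *v n3]]"

abbreviation ty :: "nat \<Rightarrow> summand_type" where "ty s \<equiv> summand_types ! s"

definition v :: "nat \<Rightarrow> nat \<Rightarrow> complex ^ 'v" where
  "v s i = chains ! s ! (i - first_layer (ty s))"

lemma all_chains: "(\<forall>s\<in>{..<7}. \<forall>i\<in>{first_layer (ty s)..last_layer (ty s)}. P s i) \<longleftrightarrow>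
  P 0 0 \<and> P 0 1 \<and> P 0 2 \<and> P 0 3 \<and> P 0 4 \<and> P 1 1 \<and> P 1 2 \<and> P 1 3 \<and> P 2 1 \<and> P 2 2 \<and> P 2 3 \<and>
  P 3 2 \<and> P 4 2 \<and> P 4 3 \<and> P 5 2 \<and> P 5 3 \<and> P 6 3 \<and> P 6 4"
  unfolding all_summands by (simp add: all_layers summand_types_def)

text \<open>Several spellings of the indices, because the simplifier may turn 1 into
  \<open>Suc 0\<close>.\<close>

lemma v_simps:
  "v 0 0 = estar adj x 0" "v 0 1 = estar adj x 1" "v 0 (Suc 0) = estar adj x 1" "v 0 2 = estar adj x 2"
  "v 0 3 = estar adj x 3" "v 0 4 = estar adj x 4"
  "v 1 1 = n1a" "v 1 (Suc 0) = n1a" "v (Suc 0) (Suc 0) = n1a" "v 1 2 = A *v n1a" "v (Suc 0) 2 = A *v n1a"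
  "v 1 3 = type_II_end n1a" "v (Suc 0) 3 = type_II_end n1a"
  "v 2 1 = n1b" "v 2 (Suc 0) = n1b" "v 2 2 = A *v n1b" "v 2 3 = type_II_end n1b"
  "v 3 2 = n2a" "v 4 2 = n2b" "v 4 3 = A *v n2b" "v 5 2 = n2c" "v 5 3 = A *v n2c"
  "v 6 3 = n3" "v 6 4 = A *v n3"
  by (simp_all add: v_def chains_def summand_types_def)

lemma seeds_II: "n1a \<noteq> 0" "n1b \<noteq> 0" "E 1 *v n1a = n1a" "E 1 *v n1b = n1b"
  using n1(1,2) unfolding type_II_def by blast+

lemma chain_nonzero: "\<forall>s\<in>{..<7}. \<forall>i\<in>{first_layer (ty s)..last_layer (ty s)}. v s i \<noteq> 0"
  unfolding all_chains v_simps
  by (simp add: estar_nonzero n1 type_II_nonzero seeds_nonzero seeds_II del: One_nat_def)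

lemma chain_pure: "\<forall>s\<in>{..<7}. \<forall>i\<in>{first_layer (ty s)..last_layer (ty s)}. E i *v v s i = v s i"
  unfolding all_chains v_simps
  by (simp add: E_estar n1 n2 n3 type_II_chain seed_chains seeds_II del: One_nat_def)

lemma chain_action: "\<forall>s\<in>{..<7}. \<forall>i\<in>{first_layer (ty s)..last_layer (ty s)}.
    A *v v s i = raising (ty s) i *s v s (Suc i) + lowering (ty s) i *s v s (i - 1)"
  unfolding all_chains
  by (simp add: summand_types_def estar_action n1 type_II_chain seed_chains v_simps add.commute
      del: One_nat_def)

text \<open>Vectors of different layers have disjoint supports, so only pairs in one layer are
  compared; conjugate symmetry allows the restriction to \<open>s < s'\<close>.\<close>

lemma chain_orthogonal: "\<forall>s'\<in>{..<7}. \<forall>s\<in>{..<7}. \<forall>i\<in>{first_layer (ty s)..last_layer (ty s)}.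
    i \<in> {first_layer (ty s')..last_layer (ty s')} \<longrightarrow> s < s' \<longrightarrow> herm_inner (v s i) (v s' i) = 0"
  unfolding all_chains unfolding all_summands
  by (simp add: summand_types_def v_simps type_II_estar n1 type_II_orthogonal orthogonal_2 orthogonal_3
      orthogonal_4 del: One_nat_def)

sublocale thin: thin_modules adj x "{..<7}" ty first_layer last_layer v raising lowering separation_rank
proof
  show "first_layer t \<le> last_layer t" for t
    by (cases t) simp_all
  show "last_layer (ty s) \<le> gdiameter adj" if "s \<in> {..<7}" for s
    unfolding diam by (cases "ty s") simp_all
  show "v s i \<noteq> 0" if "s \<in> {..<7}" "i \<in> {first_layer (ty s)..last_layer (ty s)}" for s i
    using chain_nonzero that by blast
  show "E i *v v s i = v s i" if "s \<in> {..<7}" "i \<in> {first_layer (ty s)..last_layer (ty s)}" for s i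
    using chain_pure that by blast
  show "A *v v s i = raising (ty s) i *s v s (Suc i) + lowering (ty s) i *s v s (i - 1)"
    if "s \<in> {..<7}" "i \<in> {first_layer (ty s)..last_layer (ty s)}" for s i
    using chain_action that by blast
  show "herm_inner (v s i) (v s' i) = 0"
    if "s \<in> {..<7}" "s' \<in> {..<7}" "s \<noteq> s'" "i \<in> {first_layer (ty s)..last_layer (ty s)}"
      "i \<in> {first_layer (ty s')..last_layer (ty s')}" for s s' i
    using that chain_orthogonal herm_inner_commute_0 by (metis linorder_neqE_nat)
  \<comment> \<open>The chain lengths 5, 3, 3, 1, 2, 2, 2 add up to 18.\<close>
  show "CARD('v) = (\<Sum>s\<in>{..<7}. Suc (last_layer (ty s) - first_layer (ty s)))"
  proof -
    have "CARD('v) = 18"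
      using pappus unfolding pappus_graph_def by blast
    then show ?thesis
      by (simp add: summand_types_def numeral_eq_Suc)
  qed
  show "raising t (last_layer t) = 0" "lowering t (first_layer t) = 0" for t
    by (cases t; simp)+
  have layer_cases: "i = 0 \<or> i = 1 \<or> i = 2 \<or> i = 3 \<or> i = 4" if "i \<le> last_layer t" for i t
    using that by (cases t) auto
  show "raising t i \<noteq> 0" if "first_layer t \<le> i" "i < last_layer t" for t i
    using that layer_cases[of i t] by (cases t) auto
  show "lowering t i \<noteq> 0" if "first_layer t < i" "i \<le> last_layer t" for t i
    using that layer_cases[of i t] by (cases t) auto
  show "\<exists>i\<in>{first_layer t..last_layer t}. \<forall>t'\<in>ty ` {..<7}. t' \<noteq> t \<longrightarrow>
      i \<in> {first_layer t'..last_layer t'} \<longrightarrow> separation_rank t' < separation_rank t" for t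
  proof -
    let ?i = "case t of Type_I \<Rightarrow> 0 | Type_II \<Rightarrow> 1 | Type_III \<Rightarrow> 2 | Type_IV \<Rightarrow> 3 | Type_V \<Rightarrow> 4"
    have "?i \<in> {first_layer t..last_layer t}"
      by (cases t) simp_all
    moreover have "separation_rank t' < separation_rank t"
      if "t' \<noteq> t" "?i \<in> {first_layer t'..last_layer t'}" for t'
      using that by (cases t; cases t') simp_all
    ultimately show ?thesis
      by blast
  qed
qed simp

section \<open>Data of the seven summands\<close>

lemma chain_eq:
  assumes "s < 7"
  shows "map (v s) [first_layer (ty s)..<Suc (last_layer (ty s))] = chains ! s"
proof -
  have "\<forall>s\<in>{..<7}. length (chains ! s) = Suc (last_layer (ty s) - first_layer (ty s))"
    unfolding all_summands by (simp add: summand_types_def chains_def)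
  then have "length (chains ! s) = Suc (last_layer (ty s)) - first_layer (ty s)"
    using assms thin.lo_le_hi[of "ty s"] by (simp add: Suc_diff_le)
  then show ?thesis
    by (intro nth_equalityI) (simp_all add: v_def del: upt_Suc)
qed

lemma block_represents:
  assumes "s < 7"
  shows "represents A (chains ! s) (block (ty s))"
proof -
  have "\<forall>s\<in>{..<7}. represents A (chains ! s) (block (ty s))"
    unfolding all_summands
    by (simp add: represents_def summand_types_def chains_def mat_of_rows_list_def
        numeral_eq_Suc All_less_Suc)
      (simp add: One_nat_def[symmetric] estar_action n1 type_II_chain seed_chains add.commute
        del: One_nat_def)
  then show ?thesis
    using assms by blast
qed

lemma summand:
  assumes "s < 7"
  shows "summand_data adj x (thin.W s) (first_layer (ty s)) (length (filter ((=) (ty s)) summand_types))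
    (Suc (last_layer (ty s) - first_layer (ty s))) (last_layer (ty s) - first_layer (ty s))
    (replicate (Suc (last_layer (ty s) - first_layer (ty s))) 1) (chains ! s) (block (ty s))"
proof -
  have s: "s \<in> {..<7}"
    using assms by simp
  have "card {s' \<in> {..<7}. ty s' = ty s} = length (filter ((=) (ty s)) summand_types)"
    unfolding length_filter_conv_card
    by (intro arg_cong[of _ _ card]) (auto simp: summand_types_def)
  then show ?thesis
    unfolding summand_data_def
    using thin.endpoint_W[OF s] thin.multiplicity_W[OF s] thin.dim_W[OF s] thin.diameter_W[OF s]
      thin.shape_W[OF s] thin.pure_basis_W[OF s] block_represents[OF assms] thin.lo_le_hi[of "ty s"]
    by (simp add: chain_eq[OF assms] Suc_diff_le del: upt_Suc)
qed

lemma seed: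
  assumes "s < 7" "essential_part os (v s (first_layer (ty s))) = cs"
  shows "seed_vector adj x (thin.W s) os cs (v s (first_layer (ty s)))"
proof -
  have s: "s \<in> {..<7}" and first: "first_layer (ty s) \<in> {first_layer (ty s)..last_layer (ty s)}"
    using assms(1) thin.lo_le_hi by simp_all
  show ?thesis
    unfolding seed_vector_def thin.endpoint_W[OF s]
    using thin.pure_vector_v[OF s first] assms(2) thin.layer_W[OF s] thin.dim_layer_W[OF s first] first
    by simp
qed

lemma decomposition:
  "orthogonal_decomposition (terwilliger adj x)
    [thin.W 0, thin.W 1, thin.W 2, thin.W 3, thin.W 4, thin.W 5, thin.W 6]"
  using thin.decomposition_W[of "[0, 1, 2, 3, 4, 5, 6]"] by (auto simp: numeral_eq_Suc lessThan_Suc)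

lemma isomorphism_classes:
  assumes "i < 7" "j < 7"
  shows "module_iso (terwilliger adj x) (thin.W i) (thin.W j) \<longleftrightarrow> ty i = ty j"
  using thin.module_iso_iff assms by simp

lemma dim_terwilliger: "cmat.dim (terwilliger adj x) = 43"
proof -
  have "ty ` {..<7} = set summand_types"
    by (auto simp: summand_types_def set_conv_nth)
  then show ?thesis
    using thin.dim_T[OF thin.T_subspace] by (simp add: summand_types_def power2_eq_square)
qed

text \<open>Every block has as many distinct eigenvalues as rows, so one eigenvector per summand and
  eigenvalue makes 18 in all. The multiplicity of an eigenvalue is the number of summands whose
  block has it.\<close>

lemma adjacency_spectrum:
  "has_spectrum A [(3, 1), (sqrt3, 6), (0, 4), (- sqrt3, 6), (-3, 1)]"
proof -
  let ?J = "SIGMA s:{..<7}. block_spectrum (ty s)"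
  have "\<forall>j\<in>?J. \<exists>u. u \<in> thin.W (fst j) \<and> u \<noteq> 0 \<and> A *v u = snd j *s u"
  proof
    fix j assume "j \<in> ?J"
    then have s: "fst j < 7" "snd j \<in> spectrum (block (ty (fst j)))"
      by (auto simp: spectrum_block)
    have "ordered_basis (thin.W (fst j)) (chains ! fst j)"
      using thin.pure_basis_W[of "fst j"] s(1) unfolding pure_basis_def chain_eq[OF s(1)] by simp
    then show "\<exists>u. u \<in> thin.W (fst j) \<and> u \<noteq> 0 \<and> A *v u = snd j *s u"
      using eigenvector_if_represents[OF block_represents[OF s(1)] _ s(2)] by blast
  qed
  then obtain f where f: "\<forall>j\<in>?J. f j \<in> thin.W (fst j) \<and> f j \<noteq> 0 \<and> A *v f j = snd j *s f j"
    by (rule bchoice[THEN exE])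
  have real: "cnj \<theta> = \<theta>" if "\<theta> \<in> block_spectrum t" for \<theta> t
    using that by (cases t) auto
  \<comment> \<open>Different vectors from one summand have different real eigenvalues, so
    self-adjointness of \<open>A\<close> makes them orthogonal; distinct summands are orthogonal
    already.\<close>
  have orth: "herm_inner (f i) (f j) = 0" if "i \<in> ?J" "j \<in> ?J" "i \<noteq> j" for i j
  proof (cases "fst i = fst j")
    case True
    have eigen: "A *v f i = snd i *s f i" "A *v f j = snd j *s f j"
      using f that by blast+
    have "snd i * herm_inner (f i) (f j) = herm_inner (A *v f i) (f j)"
      by (simp add: eigen herm_inner_scale_left)
    also have "\<dots> = herm_inner (f i) (A *v f j)"
      by (rule adjacency_self_adjoint[OF simple])
    also have "\<dots> = cnj (snd j) * herm_inner (f i) (f j)"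
      by (simp add: eigen herm_inner_cnj[of "f i"] herm_inner_scale_left)
    also have "cnj (snd j) = snd j"
      using that(2) real by auto
    finally have "(snd i - snd j) * herm_inner (f i) (f j) = 0"
      by (simp add: algebra_simps)
    then show ?thesis
      using that(3) True by (auto simp: prod_eq_iff)
  next
    case False
    have "fst i \<in> {..<7}" "fst j \<in> {..<7}"
      using that by auto
    moreover have "f i \<in> thin.W (fst i)" "f j \<in> thin.W (fst j)"
      using f that by blast+
    ultimately show ?thesis
      using False by (intro thin.orthogonal_W)
  qed
  have card: "card {j \<in> ?J. snd j = \<theta>} = (\<Sum>s<7. if \<theta> \<in> block_spectrum (ty s) then 1 else 0)" for \<theta>
  proof -
    have "{j \<in> ?J. snd j = \<theta>} = (\<lambda>s. (s, \<theta>)) ` {s \<in> {..<7}. \<theta> \<in> block_spectrum (ty s)}"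
      by auto
    then have "card {j \<in> ?J. snd j = \<theta>} = card {s \<in> {..<7}. \<theta> \<in> block_spectrum (ty s)}"
      by (simp add: card_image inj_on_def)
    then show ?thesis
      by (simp only: card_filter_sum[OF finite_lessThan])
  qed
  have finite: "finite (block_spectrum t)" for t
    by (cases t) simp_all
  show ?thesis
  proof (rule has_spectrum_orthogonal_eigenbasis[where f = f and \<mu> = snd and J = ?J])
    show "finite ?J"
      using finite by simp
    show "f j \<noteq> 0" "A *v f j = snd j *s f j" if "j \<in> ?J" for j
      using f that by blast+
    show "herm_inner (f i) (f j) = 0" if "i \<in> ?J" "j \<in> ?J" "i \<noteq> j" for i j
      using orth that .
    have "card ?J = (\<Sum>s<7. card (block_spectrum (ty s)))"
      using finite by simp
    also have "\<dots> = 18"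
      by (simp add: summand_types_def eval_nat_numeral sqrt3_neq sqrt3_neq' )
    finally show "card ?J = CARD('v)"
      using pappus unfolding pappus_graph_def by simp
    show "distinct (map fst [(3, 1), (sqrt3, 6), (0, 4), (- sqrt3, 6), (-3, 1)])"
      by (simp add: sqrt3_neq sqrt3_neq')
    have "\<theta> \<in> snd ` ?J" if "\<theta> \<in> block_spectrum Type_I" for \<theta>
      using that by (intro image_eqI[of _ _ "(0, \<theta>)"]) (simp_all add: summand_types_def)
    moreover have "\<theta> \<in> block_spectrum Type_I" if \<theta>: "\<theta> \<in> snd ` ?J" for \<theta>
    proof -
      obtain s where s: "\<theta> \<in> block_spectrum (ty s)"
        using \<theta> by auto
      have "block_spectrum t \<subseteq> block_spectrum Type_I" for t
        by (cases t) auto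
      then show ?thesis
        using s by blast
    qed
    ultimately have "snd ` ?J = block_spectrum Type_I"
      by blast
    then show "set (map fst [(3, 1), (sqrt3, 6), (0, 4), (- sqrt3, 6), (-3, 1)]) = snd ` ?J"
      by simp
    show "card {j \<in> ?J. snd j = \<theta>} = m"
      if "(\<theta>, m) \<in> set [(3, 1), (sqrt3, 6), (0, 4), (- sqrt3, 6), (-3, 1)]" for \<theta> m
      using that unfolding card
      by (auto simp: summand_types_def lessThan_Suc eval_nat_numeral sqrt3_neq sqrt3_neq')
  qed
qed

end

section \<open>Seed vectors\<close>

definition vector_on :: "'v list \<Rightarrow> complex list \<Rightarrow> complex ^ 'v" where
  "vector_on os cs = (\<chi> y. case map_of (zip os cs) y of Some c \<Rightarrow> c | None \<Rightarrow> 0)"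

lemma vector_on_nth:
  assumes "distinct os" "length os = length cs" "i < length os"
  shows "vector_on os cs $ (os ! i) = cs ! i"
  using assms by (simp add: vector_on_def map_of_zip_nth)

lemma vector_on_outside: "y \<notin> set os \<Longrightarrow> length os = length cs \<Longrightarrow> vector_on os cs $ y = 0"
  by (simp add: vector_on_def map_of_zip_is_None[THEN iffD2])

lemma essential_part_vector_on:
  assumes "distinct os" "length os = length cs"
  shows "essential_part os (vector_on os cs) = cs"
  using assms by (intro nth_equalityI) (simp_all add: essential_part_def vector_on_nth)

lemma Estar_vector_on:
  assumes "sphere_ordering adj x i os" "length os = length cs"
  shows "Estar adj x i *v vector_on os cs = vector_on os cs"
  using assms vector_on_outside[of _ os cs]
  by (auto simp: vec_eq_iff Estar_nth sphere_ordering_def gsphere_def)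

text \<open>The list \<open>us\<close> is an unknown permutation of the three \<open>p\<close>, so
  sums are taken over \<open>set us\<close>, where the order does not matter.\<close>

lemma (in pappus_frame) type_II_vector_on:
  assumes "sphere_ordering adj x 1 us" "length us = 3"
  shows "type_II (vector_on us [1, -1, 0])" "type_II (vector_on us [1, 1, -2])"
    "herm_inner (vector_on us [1, -1, 0]) (vector_on us [1, 1, -2]) = 0"
proof -
  obtain a b c where us: "us = [a, b, c]"
    using assms(2) by (auto simp: length_Suc_conv numeral_eq_Suc)
  have d: "distinct us" and set: "set us = {p1, p2, p3}"
    using assms(1) spheres(1) unfolding sphere_ordering_def by auto
  have nth: "vector_on us [s, t, r] $ a = s" "vector_on us [s, t, r] $ b = t"
    "vector_on us [s, t, r] $ c = r" for s t r
    using vector_on_nth[OF d, of "[s, t, r]" 0] vector_on_nth[OF d, of "[s, t, r]" 1]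
      vector_on_nth[OF d, of "[s, t, r]" 2] by (simp_all add: us)
  have type_II: "type_II (vector_on us [s, t, r])" if "s \<noteq> 0" "s + t + r = 0" for s t r
    unfolding type_II_def
  proof (intro conjI)
    let ?n = "vector_on us [s, t, r]"
    show "?n \<noteq> 0"
      using nth(1)[of s t r] that(1) by auto
    show "E 1 *v ?n = ?n"
      using assms by (intro Estar_vector_on) simp_all
    have "?n $ p1 + ?n $ p2 + ?n $ p3 = sum (($) ?n) {p1, p2, p3}"
      using distinct_vertices by (simp add: add.assoc)
    also have "\<dots> = sum (($) ?n) (set us)"
      by (simp only: set)
    also have "\<dots> = sum_list (map (($) ?n) us)"
      by (rule sum.distinct_set_conv_list[OF d])
    also have "\<dots> = 0"
      using that(2) by (simp add: us nth[unfolded us] add.assoc)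
    finally show "?n $ p1 + ?n $ p2 + ?n $ p3 = 0" .
  qed
  show "type_II (vector_on us [1, -1, 0])" "type_II (vector_on us [1, 1, -2])"
    by (rule type_II; simp)+
  let ?n = "vector_on us [1, -1, 0]" and ?m = "vector_on us [1, 1, -2]"
  have "herm_inner ?n ?m = (\<Sum>y\<in>set us. ?n $ y * cnj (?m $ y))"
    unfolding herm_inner_def
    by (rule sum.mono_neutral_right) (use vector_on_outside[of _ us "[1, -1, 0]"] assms(2) in auto)
  also have "\<dots> = sum_list (map (\<lambda>y. ?n $ y * cnj (?m $ y)) us)"
    by (rule sum.distinct_set_conv_list[OF d])
  also have "\<dots> = 0"
    by (simp add: us nth[unfolded us])
  finally show "herm_inner ?n ?m = 0" .
qed

text \<open>The two triples of \<open>zs\<close> are the neighbor sets of \<open>w\<close> and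
  \<open>w'\<close> in one of two ways; \<open>e\<close> is 1 or -1 accordingly.\<close>

lemma (in pappus_frame) type_V_vector_on:
  assumes "pappus_ordering3 adj x zs"
  obtains e where "e \<noteq> 0"
    "essential_part [q1, q2, q3, q4, q5, q6] (vector_on zs [1, -1, -1, 1, -1, 1]) = [e, -e, e, -e, e, -e]"
proof -
  let ?n = "vector_on zs [1, -1, -1, 1, -1, 1] :: complex ^ 'v"
  have zs: "distinct zs" "length zs = 6"
    using assms unfolding pappus_ordering3_def sphere_ordering_def by auto
  obtain u u' where u: "{w, w'} = {u, u'}" "u \<noteq> u'"
    "{z. adj u z} = {zs ! 0, zs ! 3, zs ! 5}" "{z. adj u' z} = {zs ! 1, zs ! 2, zs ! 4}"
    using assms spheres(3) unfolding pappus_ordering3_def by auto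
  have nth: "?n $ (zs ! 0) = 1" "?n $ (zs ! 1) = -1" "?n $ (zs ! 2) = -1"
    "?n $ (zs ! 3) = 1" "?n $ (zs ! 4) = -1" "?n $ (zs ! 5) = 1"
    using zs by (simp_all add: vector_on_nth)
  have on_neighbors: "\<forall>z\<in>{z. adj u z}. ?n $ z = 1" "\<forall>z\<in>{z. adj u' z}. ?n $ z = -1"
    unfolding u(3,4) using nth by auto
  have "u = w \<and> u' = w' \<or> u = w' \<and> u' = w"
    using u(1) by (auto simp: doubleton_eq_iff)
  then show ?thesis
  proof
    assume "u = w \<and> u' = w'"
    then have "essential_part [q1, q2, q3, q4, q5, q6] ?n = [1, -1, 1, -1, 1, -1]"
      using on_neighbors neighbors(17,18) by (simp add: essential_part_def)
    then show ?thesis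
      by (intro that[of 1]) simp_all
  next
    assume "u = w' \<and> u' = w"
    then have "essential_part [q1, q2, q3, q4, q5, q6] ?n = [-1, 1, -1, 1, -1, 1]"
      using on_neighbors neighbors(17,18) by (simp add: essential_part_def)
    then show ?thesis
      by (intro that[of "-1"]) simp_all
  qed
qed

context pappus_seeds
begin

lemma summands:
  "summand_data adj x (thin.W 0) 0 1 5 4 [1, 1, 1, 1, 1]
    [estar adj x 0, estar adj x 1, estar adj x 2, estar adj x 3, estar adj x 4] (block Type_I)"
  "summand_data adj x (thin.W 1) 1 2 3 2 [1, 1, 1] [n1a, A *v n1a, E 3 *v ((A ** A) *v n1a)] (block Type_II)"
  "summand_data adj x (thin.W 2) 1 2 3 2 [1, 1, 1] [n1b, A *v n1b, E 3 *v ((A ** A) *v n1b)] (block Type_II)"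
  "summand_data adj x (thin.W 3) 2 1 1 0 [1] [n2a] (block Type_III)"
  "summand_data adj x (thin.W 4) 2 2 2 1 [1, 1] [n2b, A *v n2b] (block Type_IV)"
  "summand_data adj x (thin.W 5) 2 2 2 1 [1, 1] [n2c, A *v n2c] (block Type_IV)"
  "summand_data adj x (thin.W 6) 3 1 2 1 [1, 1] [n3, A *v n3] (block Type_V)"
  using summand[of 0] summand[of 1] summand[of 2] summand[of 3] summand[of 4] summand[of 5] summand[of 6]
  by (simp_all add: summand_types_def chains_def numeral_eq_Suc type_II_end_def del: block.simps)

lemma seeds:
  "essential_part os n1a = cs \<Longrightarrow> seed_vector adj x (thin.W 1) os cs n1a"
  "essential_part os n1b = cs \<Longrightarrow> seed_vector adj x (thin.W 2) os cs n1b"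
  "essential_part os n2a = cs \<Longrightarrow> seed_vector adj x (thin.W 3) os cs n2a"
  "essential_part os n2b = cs \<Longrightarrow> seed_vector adj x (thin.W 4) os cs n2b"
  "essential_part os n2c = cs \<Longrightarrow> seed_vector adj x (thin.W 5) os cs n2c"
  "essential_part os n3 = cs \<Longrightarrow> seed_vector adj x (thin.W 6) os cs n3"
  using seed[of 1 os cs] seed[of 2 os cs] seed[of 3 os cs] seed[of 4 os cs] seed[of 5 os cs] seed[of 6 os cs]
  by (simp_all add: summand_types_def v_simps)

lemma isomorphism_types:
  "\<forall>i<7. \<forall>j<7. module_iso (terwilliger adj x)
      ([thin.W 0, thin.W 1, thin.W 2, thin.W 3, thin.W 4, thin.W 5, thin.W 6] ! i)
      ([thin.W 0, thin.W 1, thin.W 2, thin.W 3, thin.W 4, thin.W 5, thin.W 6] ! j)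
    \<longleftrightarrow> [1, 2, 2, 3, 4, 4, 5 :: nat] ! i = [1, 2, 2, 3, 4, 4, 5] ! j"
proof (intro allI impI)
  fix i j :: nat assume ij: "i < 7" "j < 7"
  have W: "[thin.W 0, thin.W 1, thin.W 2, thin.W 3, thin.W 4, thin.W 5, thin.W 6] ! k = thin.W k" if "k < 7" for k
  proof -
    have "\<forall>k\<in>{..<7}. [thin.W 0, thin.W 1, thin.W 2, thin.W 3, thin.W 4, thin.W 5, thin.W 6] ! k = thin.W k"
      unfolding all_summands by simp
    then show ?thesis
      using that by blast
  qed
  have "\<forall>i\<in>{..<7}. \<forall>j\<in>{..<7}. ty i = ty j \<longleftrightarrow>
      [1, 2, 2, 3, 4, 4, 5 :: nat] ! i = [1, 2, 2, 3, 4, 4, 5] ! j"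
    unfolding all_summands by (simp add: summand_types_def)
  then have "ty i = ty j \<longleftrightarrow> [1, 2, 2, 3, 4, 4, 5 :: nat] ! i = [1, 2, 2, 3, 4, 4, 5] ! j"
    using ij by blast
  then show "module_iso (terwilliger adj x)
      ([thin.W 0, thin.W 1, thin.W 2, thin.W 3, thin.W 4, thin.W 5, thin.W 6] ! i)
      ([thin.W 0, thin.W 1, thin.W 2, thin.W 3, thin.W 4, thin.W 5, thin.W 6] ! j)
    \<longleftrightarrow> [1, 2, 2, 3, 4, 4, 5 :: nat] ! i = [1, 2, 2, 3, 4, 4, 5] ! j"
    unfolding W[OF ij(1)] W[OF ij(2)] isomorphism_classes[OF ij] .
qed

end

text \<open>The labels \<open>y1\<close> to \<open>y6\<close> are read off from \<open>ys\<close>,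
  and the other labels are derived from them. The lists \<open>us\<close> and \<open>zs\<close>
  enter through the seed vectors only.\<close>

lemma (in pappus) seeds_exist:
  assumes us: "sphere_ordering adj x 1 us" "length us = 3"
    and ys: "pappus_ordering2 adj x ys" and zs: "pappus_ordering3 adj x zs"
  shows "\<exists>p1 p2 p3 y1 y2 y3 y4 y5 y6 q1 q2 q3 q4 q5 q6 w w' e.
    pappus_seeds adj x p1 p2 p3 y1 y2 y3 y4 y5 y6 q1 q2 q3 q4 q5 q6 w w'
      (vector_on us [1, -1, 0]) (vector_on us [1, 1, -2]) (vector_on ys [-1, 1, 1, -1, -1, 1])
      (vector_on ys [1, -1, 0, 0, -1, 1]) (vector_on ys [1, -1, 2, -2, 1, -1])
      (vector_on zs [1, -1, -1, 1, -1, 1]) e"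
proof -
  have len: "length ys = 6" "length zs = 6" and "distinct ys"
    and ordered: "sphere_ordering adj x 2 ys" "sphere_ordering adj x 3 zs"
    using ys zs unfolding pappus_ordering2_def pappus_ordering3_def sphere_ordering_def by blast+
  obtain y1 y2 y3 y4 y5 y6 where list: "ys = [y1, y2, y3, y4, y5, y6]"
    using len(1) by (auto simp: length_Suc_conv numeral_eq_Suc)
  obtain p1 p2 p3 q1 q2 q3 q4 q5 q6 w w' where
    "pappus_labelled adj x p1 p2 p3 y1 y2 y3 y4 y5 y6 q1 q2 q3 q4 q5 q6 w w'"
    using labelling_exists[OF ys[unfolded list]] by (elim exE) (rule that)
  then interpret pappus_frame adj x p1 p2 p3 y1 y2 y3 y4 y5 y6 q1 q2 q3 q4 q5 q6 w w'
    by (intro pappus_frame.intro pappus_axioms)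
  obtain e where e: "e \<noteq> 0"
    "essential_part [q1, q2, q3, q4, q5, q6] (vector_on zs [1, -1, -1, 1, -1, 1]) = [e, -e, e, -e, e, -e]"
    using type_V_vector_on[OF zs] by blast
  have part: "essential_part [y1, y2, y3, y4, y5, y6] (vector_on ys cs) = cs" if "length cs = 6" for cs
    using essential_part_vector_on[OF \<open>distinct ys\<close>, of cs] that unfolding list by simp
  have "pappus_seeds adj x p1 p2 p3 y1 y2 y3 y4 y5 y6 q1 q2 q3 q4 q5 q6 w w'
      (vector_on us [1, -1, 0]) (vector_on us [1, 1, -2]) (vector_on ys [-1, 1, 1, -1, -1, 1])
      (vector_on ys [1, -1, 0, 0, -1, 1]) (vector_on ys [1, -1, 2, -2, 1, -1])
      (vector_on zs [1, -1, -1, 1, -1, 1]) e"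
    by unfold_locales
      (simp_all add: type_II_vector_on[OF us] Estar_vector_on[OF ordered(1)] Estar_vector_on[OF ordered(2)]
        len part e)
  then show ?thesis
    by blast
qed

lemma (in pappus) orderings_exist:
  "\<exists>us ys zs. sphere_ordering adj x 1 us \<and> length us = 3 \<and>
    pappus_ordering2 adj x ys \<and> pappus_ordering3 adj x zs"
proof -
  obtain ys where ys: "pappus_ordering2 adj x ys"
    using ordering2_exists by blast
  then have "length ys = 6"
    unfolding pappus_ordering2_def by blast
  then obtain y1 y2 y3 y4 y5 y6 where list: "ys = [y1, y2, y3, y4, y5, y6]"
    by (auto simp: length_Suc_conv numeral_eq_Suc)
  obtain p1 p2 p3 q1 q2 q3 q4 q5 q6 w w' where
    "pappus_labelled adj x p1 p2 p3 y1 y2 y3 y4 y5 y6 q1 q2 q3 q4 q5 q6 w w'"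
    using labelling_exists[OF ys[unfolded list]] by (elim exE) (rule that)
  then have "\<exists>zs. pappus_ordering3 adj x zs"
    by (rule pappus_labelled.ordering3_exists)
  then show ?thesis
    using ys ordering1_exists by blast
qed

theorem mainTheorem6:
  fixes adj :: "'v::finite \<Rightarrow> 'v \<Rightarrow> bool" and x :: 'v
  assumes pappus: "pappus_graph adj"
  shows "has_spectrum (adjacency_matrix adj)
           [(3, 1), (complex_of_real (sqrt 3), 6), (0, 4), (- complex_of_real (sqrt 3), 6), (-3, 1)]
    \<and> (\<exists>us ys zs. sphere_ordering adj x 1 us \<and> length us = 3 \<and>
          pappus_ordering2 adj x ys \<and> pappus_ordering3 adj x zs)
    \<and> (\<forall>us ys zs. sphere_ordering adj x 1 us \<longrightarrow> length us = 3 \<longrightarrow>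
          pappus_ordering2 adj x ys \<longrightarrow> pappus_ordering3 adj x zs \<longrightarrow>
        (\<exists>W0 W1a W1b W2a W2b W2c W3 \<nu>1a \<nu>1b \<nu>2a \<nu>2b \<nu>2c \<nu>3.
          \<comment> \<open>decomposition and isomorphism classes\<close>
          orthogonal_decomposition (terwilliger adj x) [W0, W1a, W1b, W2a, W2b, W2c, W3] \<and>
          (\<forall>i<7. \<forall>j<7.
             module_iso (terwilliger adj x)
               ([W0, W1a, W1b, W2a, W2b, W2c, W3] ! i) ([W0, W1a, W1b, W2a, W2b, W2c, W3] ! j)
             \<longleftrightarrow> [1, 2, 2, 3, 4, 4, 5 :: nat] ! i = [1, 2, 2, 3, 4, 4, 5] ! j) \<and>
          \<comment> \<open>seed vectors\<close>
          seed_vector adj x W1a us [1, -1, 0] \<nu>1a \<and>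
          seed_vector adj x W1b us [1, 1, -2] \<nu>1b \<and>
          seed_vector adj x W2a ys [-1, 1, 1, -1, -1, 1] \<nu>2a \<and>
          seed_vector adj x W2b ys [1, -1, 0, 0, -1, 1] \<nu>2b \<and>
          seed_vector adj x W2c ys [1, -1, 2, -2, 1, -1] \<nu>2c \<and>
          seed_vector adj x W3 zs [1, -1, -1, 1, -1, 1] \<nu>3 \<and>
          \<comment> \<open>Type I\<close>
          summand_data adj x W0 0 1 5 4 [1, 1, 1, 1, 1]
            [estar adj x 0, estar adj x 1, estar adj x 2, estar adj x 3, estar adj x 4]
            (mat_of_rows_list 5
              [[0, 3, 0, 0, 0],
               [1, 0, 2, 0, 0],
               [0, 1, 0, 2, 0],
               [0, 0, 2, 0, 1],
               [0, 0, 0, 3, 0]]) \<and>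
          \<comment> \<open>Type II\<close>
          (\<forall>(W, \<nu>) \<in> {(W1a, \<nu>1a), (W1b, \<nu>1b)}.
             adjacency_matrix adj *v \<nu> = Estar adj x 2 *v (adjacency_matrix adj *v \<nu>) \<and>
             summand_data adj x W 1 2 3 2 [1, 1, 1]
               [\<nu>, adjacency_matrix adj *v \<nu>,
                Estar adj x 3 *v ((adjacency_matrix adj ** adjacency_matrix adj) *v \<nu>)]
               (mat_of_rows_list 3
                 [[0, 2, 0],
                  [1, 0, 1],
                  [0, 1, 0]])) \<and>
          \<comment> \<open>Type III\<close>
          summand_data adj x W2a 2 1 1 0 [1] [\<nu>2a] (mat_of_rows_list 1 [[0]]) \<and>
          \<comment> \<open>Type IV\<close>
          (\<forall>(W, \<nu>) \<in> {(W2b, \<nu>2b), (W2c, \<nu>2c)}.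
             adjacency_matrix adj *v \<nu> = Estar adj x 3 *v (adjacency_matrix adj *v \<nu>) \<and>
             summand_data adj x W 2 2 2 1 [1, 1] [\<nu>, adjacency_matrix adj *v \<nu>]
               (mat_of_rows_list 2
                 [[0, 3],
                  [1, 0]])) \<and>
          \<comment> \<open>Type V\<close>
          adjacency_matrix adj *v \<nu>3 = Estar adj x 4 *v (adjacency_matrix adj *v \<nu>3) \<and>
          summand_data adj x W3 3 1 2 1 [1, 1] [\<nu>3, adjacency_matrix adj *v \<nu>3]
            (mat_of_rows_list 2
              [[0, 3],
               [1, 0]])))
    \<and> spectrum (mat_of_rows_list 5
              [[0, 3, 0, 0, 0],
               [1, 0, 2, 0, 0],
               [0, 1, 0, 2, 0],
               [0, 0, 2, 0, 1],
               [0, 0, 0, 3, 0 :: complex]])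
        = {3, complex_of_real (sqrt 3), 0, - complex_of_real (sqrt 3), -3}
    \<and> spectrum (mat_of_rows_list 3
                 [[0, 2, 0],
                  [1, 0, 1],
                  [0, 1, 0 :: complex]])
        = {complex_of_real (sqrt 3), 0, - complex_of_real (sqrt 3)}
    \<and> spectrum (mat_of_rows_list 1 [[0 :: complex]]) = {0}
    \<and> spectrum (mat_of_rows_list 2
                 [[0, 3],
                  [1, 0 :: complex]])
        = {complex_of_real (sqrt 3), - complex_of_real (sqrt 3)}
    \<and> cmat.dim (terwilliger adj x) = 5\<^sup>2 + 3\<^sup>2 + 1\<^sup>2 + 2\<^sup>2 + 2\<^sup>2
    \<and> cmat.dim (terwilliger adj x) = 43"
proof -
  interpret pappus adj
    by unfold_locales (rule pappus)
  obtain us ys zs where orderings: "sphere_ordering adj x 1 us" "length us = 3"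
    "pappus_ordering2 adj x ys" "pappus_ordering3 adj x zs"
    using orderings_exist by blast
  \<comment> \<open>The spectrum and the dimension mention no orderings but are computed in a basis
    built from them, hence the auxiliary choice.\<close>
  have global: "has_spectrum (adjacency_matrix adj) [(3, 1), (sqrt3, 6), (0, 4), (- sqrt3, 6), (-3, 1)]"
    "cmat.dim (terwilliger adj x) = 43"
  proof -
    obtain p1 p2 p3 y1 y2 y3 y4 y5 y6 q1 q2 q3 q4 q5 q6 w w' e n1a n1b n2a n2b n2c n3 where
      "pappus_seeds adj x p1 p2 p3 y1 y2 y3 y4 y5 y6 q1 q2 q3 q4 q5 q6 w w' n1a n1b n2a n2b n2c n3 e"
      using seeds_exist[OF orderings] by (elim exE) (rule that)
    then interpret pappus_seeds adj x p1 p2 p3 y1 y2 y3 y4 y5 y6 q1 q2 q3 q4 q5 q6 w w'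
      n1a n1b n2a n2b n2c n3 e .
    show "has_spectrum (adjacency_matrix adj) [(3, 1), (sqrt3, 6), (0, 4), (- sqrt3, 6), (-3, 1)]"
      "cmat.dim (terwilliger adj x) = 43"
      by (rule adjacency_spectrum dim_terwilliger)+
  qed
  show ?thesis
  proof (intro conjI allI impI, goal_cases)
    case (3 us ys zs)
    let ?n1a = "vector_on us [1, -1, 0]" and ?n1b = "vector_on us [1, 1, -2]"
    let ?n2a = "vector_on ys [-1, 1, 1, -1, -1, 1]" and ?n2b = "vector_on ys [1, -1, 0, 0, -1, 1]"
    let ?n2c = "vector_on ys [1, -1, 2, -2, 1, -1]" and ?n3 = "vector_on zs [1, -1, -1, 1, -1, 1]"
    \<comment> \<open>The labelling is redone for the given orderings, with the seeds that they
      prescribe.\<close>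
    obtain p1 p2 p3 y1 y2 y3 y4 y5 y6 q1 q2 q3 q4 q5 q6 w w' e where
      "pappus_seeds adj x p1 p2 p3 y1 y2 y3 y4 y5 y6 q1 q2 q3 q4 q5 q6 w w' ?n1a ?n1b ?n2a ?n2b ?n2c ?n3 e"
      using seeds_exist[OF 3] by (elim exE) (rule that)
    then interpret pappus_seeds adj x p1 p2 p3 y1 y2 y3 y4 y5 y6 q1 q2 q3 q4 q5 q6 w w'
      ?n1a ?n1b ?n2a ?n2b ?n2c ?n3 e .
    have "distinct us" "distinct ys" "distinct zs" "length ys = 6" "length zs = 6"
      using 3 unfolding pappus_ordering2_def pappus_ordering3_def sphere_ordering_def by blast+
    note parts = essential_part_vector_on[OF this(1)] essential_part_vector_on[OF this(2)]
      essential_part_vector_on[OF this(3)] and lengths = 3(2) this(4,5)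
    note seeds' = seeds(1)[OF parts(1)] seeds(2)[OF parts(1)] seeds(3)[OF parts(2)]
      seeds(4)[OF parts(2)] seeds(5)[OF parts(2)] seeds(6)[OF parts(3)]
    show ?case
      apply (rule exI[of _ "thin.W 0"], rule exI[of _ "thin.W 1"], rule exI[of _ "thin.W 2"],
          rule exI[of _ "thin.W 3"], rule exI[of _ "thin.W 4"], rule exI[of _ "thin.W 5"],
          rule exI[of _ "thin.W 6"])
      apply (rule exI[of _ ?n1a], rule exI[of _ ?n1b], rule exI[of _ ?n2a], rule exI[of _ ?n2b],
          rule exI[of _ ?n2c], rule exI[of _ ?n3])
      apply (intro conjI)
      apply (rule decomposition)
      apply (rule isomorphism_types)
      apply (rule seeds', simp add: lengths)+
      apply (rule summands(1)[unfolded block.simps])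
      apply (use type_II_chain(1)[OF n1(1)] type_II_chain(1)[OF n1(2)] summands(2,3)[unfolded block.simps] in simp)
      apply (rule summands(4)[unfolded block.simps])
      apply (use seed_chains(2,4) summands(5,6)[unfolded block.simps] in simp)
      apply (rule seed_chains(6)[symmetric])
      apply (rule summands(7)[unfolded block.simps])
      done
  next
    case 2
    show ?case
      by (rule orderings_exist)
  qed (rule global(1) spectrum_5 spectrum_3 spectrum_1 spectrum_2 | simp add: global(2))+
qed

end
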